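(* Let $L(\lambda)$ be a regular $n\times n$ skew-symmetric matrix pencil and let $\lambda_1,\dots,\lambda_\kappa\in\mathbb C$ be its pairwise distinct eigenvalues, having the nonzero partial multiplicities $n_{i,1}\geq n_{i,2}\geq\cdots\geq n_{i,g_i}>0$ for $i=1,\dots,\kappa$, respectively. Let $r$ be a nonzero (positive) even integer and let $\Phi$ be the map on $\mathbb C^{3rn/2}$ defined in the context. Then there is a generic set $\mathcal G$ in $\mathbb C^{3rn/2}$ such that, for all $E(\lambda)\in\Phi(\mathcal G)$, the perturbed pencil $L+E$ is regular and the partial multiplicities of $L+E$ at $\lambda_i$ are $n_{i,r+1}\geq\cdots\geq n_{i,g_i}$, for $i=1,\dots,\kappa$. Furthermore, all eigenvalues of $L+E$ that are not eigenvalues of $L$ have algebraic multiplicity precisely two.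
   Context: A matrix pencil $L(\lambda)=A+\lambda B$ with $A,B\in\mathbb C^{n\times n}$ is skew-symmetric if $A^\top=-A$ and $B^\top=-B$; it is regular if $\det L(\lambda)\not\equiv 0$. For a regular pencil, a finite eigenvalue is a root of $\det L(\lambda)$; $\infty$ is an eigenvalue if $0$ is an eigenvalue of the reversal $\operatorname{rev}L(\lambda)=B+\lambda A$. The partial multiplicities of a regular pencil at an eigenvalue are the sizes of the corresponding Jordan blocks in its Weierstrass canonical form (at $\infty$: the partial multiplicities of $\operatorname{rev}L$ at $0$); the algebraic multiplicity is their sum. If $r\geq g_i$ the list $n_{i,r+1}\geq\cdots\geq n_{i,g_i}$ is empty, meaning that $\lambda_i$ is not an eigenvalue of $L+E$. The map $\Phi$: put $s=r/2$. A point of $\mathbb C^{3rn/2}=\mathbb C^{3sn}$ consists of vectors $v_1,\dots,v_s,\gamma_1,\dots,\gamma_s,\delta_1,\dots,\delta_s\in\mathbb C^n$ and is mapped to the skew-symmetric pencil $$\sum_{j=1}^s\big(v_jw_j^\top-w_jv_j^\top\big),\qquad w_j(\lambda)=\gamma_j+\lambda\delta_j.$$ Genericity: a subset of $\mathbb C^m$ is generic if its complement is contained in a proper algebraic set, i.e., in a set of common zeros of finitely many complex polynomials in $m$ variables that is not all of $\mathbb C^m$. *)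

theory Defs
  imports "Jordan_Normal_Form.Jordan_Normal_Form" "HOL-Library.Poly_Mapping"
begin

text \<open>Pencils are matrices over \<^typ>\<open>complex poly\<close>, the polynomial variable being \<open>\<lambda>\<close>.\<close>

definition const_mat :: "complex mat \<Rightarrow> complex poly mat" where
  "const_mat A = map_mat (\<lambda>a. [:a:]) A"

definition pencil :: "complex mat \<Rightarrow> complex mat \<Rightarrow> complex poly mat" where
  "pencil A B = const_mat A + [:0, 1:] \<cdot>\<^sub>m const_mat B"

definition regular_pencil :: "complex poly mat \<Rightarrow> bool" where
  "regular_pencil L \<longleftrightarrow> det L \<noteq> 0"

text \<open>The reversal is meant for entries of degree at most one only.\<close>

definition rev_pencil :: "complex poly mat \<Rightarrow> complex poly mat" where
  "rev_pencil L = map_mat (\<lambda>p. [:coeff p 1, coeff p 0:]) L"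

lemma rev_pencil_pencil:
  assumes "A \<in> carrier_mat n n" "B \<in> carrier_mat n n"
  shows "rev_pencil (pencil A B) = pencil B A"
  using assms by (intro eq_matI) (auto simp: rev_pencil_def pencil_def const_mat_def)

datatype ext_complex = Fin complex | Infty

fun pencil_eigenvalue :: "complex poly mat \<Rightarrow> ext_complex \<Rightarrow> bool" where
  "pencil_eigenvalue L (Fin \<mu>) \<longleftrightarrow> poly (det L) \<mu> = 0"
| "pencil_eigenvalue L Infty \<longleftrightarrow> poly (det (rev_pencil L)) 0 = 0"

text \<open>The canonical form is \<open>diag (\<lambda> I - J, \<lambda> N - I)\<close>, where \<open>J\<close> is the Jordan matrix with
  the blocks \<open>js\<close> (pairs of size and eigenvalue) and \<open>N\<close> is the nilpotent Jordan matrix with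
  block sizes \<open>ks\<close>.\<close>

definition weierstrass_mat :: "(nat \<times> complex) list \<Rightarrow> nat list \<Rightarrow> complex poly mat" where
  "weierstrass_mat js ks =
    (let J = jordan_matrix js; N = jordan_matrix (map (\<lambda>k. (k, 0)) ks);
         p = dim_row J; q = dim_row N
     in pencil (four_block_mat (- J) (0\<^sub>m p q) (0\<^sub>m q p) (- 1\<^sub>m q))
               (four_block_mat (1\<^sub>m p) (0\<^sub>m p q) (0\<^sub>m q p) N))"

definition weierstrass_form ::
  "complex poly mat \<Rightarrow> (nat \<times> complex) list \<Rightarrow> nat list \<Rightarrow> bool" where
  "weierstrass_form L js ks \<longleftrightarrow>
    0 \<notin> fst ` set js \<and> 0 \<notin> set ks \<and>
    (\<exists>P Q. P \<in> carrier_mat (dim_row L) (dim_row L) \<and> invertible_mat P \<and>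
           Q \<in> carrier_mat (dim_col L) (dim_col L) \<and> invertible_mat Q \<and>
           const_mat P * L * const_mat Q = weierstrass_mat js ks)"

text \<open>The Weierstrass form of a regular pencil exists and is unique up to the order of its
  blocks; hence for regular \<open>L\<close> and given \<open>\<mu>\<close> the following relations determine the list
  \<open>ms\<close>, which is nonincreasing, has positive entries, and is empty iff \<open>\<mu>\<close> is not an
  eigenvalue.\<close>

definition finite_partial_multiplicities ::
  "complex poly mat \<Rightarrow> complex \<Rightarrow> nat list \<Rightarrow> bool" where
  "finite_partial_multiplicities L \<mu> ms \<longleftrightarrow>
    (\<exists>js ks. weierstrass_form L js ks \<and>
             ms = rev (sort (map fst (filter (\<lambda>(k, a). a = \<mu>) js))))"

fun partial_multiplicities :: "complex poly mat \<Rightarrow> ext_complex \<Rightarrow> nat list \<Rightarrow> bool" where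
  "partial_multiplicities L (Fin \<mu>) ms \<longleftrightarrow> finite_partial_multiplicities L \<mu> ms"
| "partial_multiplicities L Infty ms \<longleftrightarrow> finite_partial_multiplicities (rev_pencil L) 0 ms"

definition algebraic_multiplicity :: "complex poly mat \<Rightarrow> ext_complex \<Rightarrow> nat \<Rightarrow> bool" where
  "algebraic_multiplicity L \<mu> k \<longleftrightarrow> (\<exists>ms. partial_multiplicities L \<mu> ms \<and> k = sum_list ms)"

text \<open>Multivariate polynomials are finitely supported maps from monomials to coefficients, and
  monomials are finitely supported maps from variable indices to exponents.\<close>

type_synonym cmpoly = "(nat \<Rightarrow>\<^sub>0 nat) \<Rightarrow>\<^sub>0 complex"

definition poly_in_vars :: "nat \<Rightarrow> cmpoly \<Rightarrow> bool" where
  "poly_in_vars m p \<longleftrightarrow> (\<forall>t \<in> Poly_Mapping.keys p. Poly_Mapping.keys t \<subseteq> {..<m})"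

definition eval_cmpoly :: "cmpoly \<Rightarrow> complex vec \<Rightarrow> complex" where
  "eval_cmpoly p x =
    (\<Sum>t \<in> Poly_Mapping.keys p. Poly_Mapping.lookup p t *
       (\<Prod>i \<in> Poly_Mapping.keys t. (x $ i) ^ Poly_Mapping.lookup t i))"

definition algebraic_set :: "nat \<Rightarrow> complex vec set \<Rightarrow> bool" where
  "algebraic_set m Z \<longleftrightarrow>
    (\<exists>S. finite S \<and> (\<forall>p \<in> S. poly_in_vars m p) \<and>
         Z = {x \<in> carrier_vec m. \<forall>p \<in> S. eval_cmpoly p x = 0})"

definition generic :: "nat \<Rightarrow> complex vec set \<Rightarrow> bool" where
  "generic m G \<longleftrightarrow>
    G \<subseteq> carrier_vec m \<and>
    (\<exists>Z. algebraic_set m Z \<and> Z \<noteq> carrier_vec m \<and> carrier_vec m - G \<subseteq> Z)"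

text \<open>With \<open>s = r div 2\<close>, a point of the parameter space lists first the vectors \<open>v\<close>, then
  the \<open>\<gamma>\<close>, then the \<open>\<delta>\<close>; vectors are counted from \<open>0\<close>.\<close>

definition subvector :: "nat \<Rightarrow> complex vec \<Rightarrow> nat \<Rightarrow> complex vec" where
  "subvector n x j = vec n (\<lambda>i. x $ (j * n + i))"

definition Phi :: "nat \<Rightarrow> nat \<Rightarrow> complex vec \<Rightarrow> complex poly mat" where
  "Phi n r x =
    (let s = r div 2;
         v = (\<lambda>j. map_vec (\<lambda>c. [:c:]) (subvector n x j));
         w = (\<lambda>j. map_vec (\<lambda>c. [:c:]) (subvector n x (s + j))
                   + [:0, 1:] \<cdot>\<^sub>v map_vec (\<lambda>c. [:c:]) (subvector n x (2 * s + j)))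
     in mat n n (\<lambda>(a, b). \<Sum>j<s. v j $ a * w j $ b - w j $ a * v j $ b))"

end

theory Submission
  imports Defs "Jordan_Normal_Form.Jordan_Normal_Form_Existence"
begin

text \<open>Write \<open>L\<close> for the given pencil, \<open>t\<close> for \<open>\<lambda> - \<mu>\<close>, and \<open>n\<^sub>1 \<ge> n\<^sub>2 \<ge> \<dots>\<close> for the partial
multiplicities of \<open>L\<close> at a point \<open>\<mu>\<close>. The order of \<open>det L\<close> at \<open>\<mu>\<close> is \<open>n\<^sub>1 + n\<^sub>2 + \<dots>\<close>. The proof
bounds the multiplicities of the perturbed pencil from below for every perturbation and from above
for a single one; vanishing to low order is an open condition, so one perturbation is enough.

Lower bound. The number of \<open>n\<^sub>j \<ge> k\<close> is the largest \<open>d\<close> for which there are polynomial vectors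
\<open>x\<^sub>1, \<dots>, x\<^sub>d\<close> with linearly independent values at \<open>\<mu>\<close> and \<open>t ^ k\<close> dividing \<open>L x\<^sub>i\<close>
(\<open>root_frame\<close>, \<open>finite_partial_multiplicities_profile\<close>). An update of \<open>L\<close> by a polynomial matrix
of rank one costs at most one of these vectors (\<open>root_frame_rank_one_update\<close>). Hence an update of
rank \<open>r\<close> leaves a pencil whose \<open>j\<close>-th multiplicity is at least \<open>n\<^sub>r\<^sub>+\<^sub>j\<close>, and if the order of
its determinant is no more than \<open>n\<^sub>r\<^sub>+\<^sub>1 + n\<^sub>r\<^sub>+\<^sub>2 + \<dots>\<close>, then its multiplicities are these numbers
(\<open>interlacing\<close>).

Upper bound. For a skew-symmetric pencil
\<open>det L * det (L + v w\<^sup>T - w v\<^sup>T) = (det L + g)\<^sup>2\<close> with \<open>g = w\<^sup>T adj(L) v\<close>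
(\<open>det_skew_outer_update\<close>). Some entry of \<open>adj(L)\<close> vanishes at \<open>\<mu>\<close> to order at most
\<open>n\<^sub>2 + n\<^sub>3 + \<dots>\<close>, so the generic \<open>g\<close> does; then the new determinant has order at most
\<open>n\<^sub>2 + n\<^sub>3 + \<dots> - n\<^sub>1 \<le> n\<^sub>3 + n\<^sub>4 + \<dots>\<close> (\<open>skew_update_order_bound\<close>). Together with the lower bound
this also shows \<open>n\<^sub>1 = n\<^sub>2\<close>. Multiplying \<open>v\<close> by a scalar \<open>c\<close> makes the zeros of \<open>det L + c g\<close>
outside the spectrum simple unless \<open>-1 / c\<close> is one of the finitely many critical values of
\<open>g / det L\<close> (\<open>good_rank_two_perturbation\<close>). Iterating gives one good perturbation of rank \<open>r\<close>
(\<open>good_perturbation\<close>).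

New eigenvalues. The same identity, applied to the successive partial sums of the perturbation, shows
that the determinant of a generic perturbed pencil has even order at each point outside the spectrum of \<open>L\<close>
(\<open>even_order_det_skew_sum\<close>), so new eigenvalues have multiplicity at least two. The point at infinity
is the point \<open>0\<close> of the reversed pencil and obeys the same bounds; therefore the degree of the
determinant of a generic perturbed pencil is that of the good one, and so are the orders at the old
eigenvalues. Finally a generic perturbation has at least as many distinct eigenvalues as the good one
(\<open>generically_card_roots_ge\<close>), where the new ones are double. Counting roots then leaves exactly two
for each new eigenvalue.\<close>

section \<open>Polynomial functions and generic sets\<close>

text \<open>The evaluation maps of polynomials in \<open>m\<close> variables, described by closure rules: induction over these
rules replaces the manipulation of monomials.\<close>

inductive polyfun :: "nat \<Rightarrow> (complex vec \<Rightarrow> complex) \<Rightarrow> bool" for m where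
  polyfun_const [intro!, simp]: "polyfun m (\<lambda>x. c)"
| polyfun_index: "i < m \<Longrightarrow> polyfun m (\<lambda>x. x $ i)"
| polyfun_add: "polyfun m f \<Longrightarrow> polyfun m g \<Longrightarrow> polyfun m (\<lambda>x. f x + g x)"
| polyfun_mult: "polyfun m f \<Longrightarrow> polyfun m g \<Longrightarrow> polyfun m (\<lambda>x. f x * g x)"

lemma polyfun_sum: "(\<And>i. i \<in> I \<Longrightarrow> polyfun m (f i)) \<Longrightarrow> polyfun m (\<lambda>x. \<Sum>i\<in>I. f i x)"
  by (induction I rule: infinite_finite_induct) (auto intro!: polyfun_add)

lemma polyfun_prod: "(\<And>i. i \<in> I \<Longrightarrow> polyfun m (f i)) \<Longrightarrow> polyfun m (\<lambda>x. \<Prod>i\<in>I. f i x)"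
  by (induction I rule: infinite_finite_induct) (auto intro!: polyfun_mult)

lemma polyfun_uminus: "polyfun m f \<Longrightarrow> polyfun m (\<lambda>x. - f x)"
  using polyfun_mult[OF polyfun_const[of m "-1"]] by simp

lemma polyfun_diff: "polyfun m f \<Longrightarrow> polyfun m g \<Longrightarrow> polyfun m (\<lambda>x. f x - g x)"
  using polyfun_add[OF _ polyfun_uminus] by fastforce

definition monom_value :: "(nat \<Rightarrow>\<^sub>0 nat) \<Rightarrow> complex vec \<Rightarrow> complex" where
  "monom_value t x = (\<Prod>i \<in> Poly_Mapping.keys t. (x $ i) ^ Poly_Mapping.lookup t i)"

lemma monom_value_superset:
  assumes "finite I" "Poly_Mapping.keys t \<subseteq> I"
  shows "monom_value t x = (\<Prod>i \<in> I. (x $ i) ^ Poly_Mapping.lookup t i)"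
  unfolding monom_value_def using assms
  by (intro prod.mono_neutral_left) (auto simp: in_keys_iff)

lemma monom_value_add: "monom_value (t + u) x = monom_value t x * monom_value u x"
proof -
  let ?I = "Poly_Mapping.keys t \<union> Poly_Mapping.keys u"
  have "Poly_Mapping.keys (t + u) \<subseteq> ?I" by (rule Poly_Mapping.keys_add)
  then show ?thesis
    by (simp add: monom_value_superset[of ?I] lookup_add power_add prod.distrib)
qed

lemma eval_cmpoly_superset:
  assumes "finite S" "Poly_Mapping.keys p \<subseteq> S"
  shows "eval_cmpoly p x = (\<Sum>t\<in>S. Poly_Mapping.lookup p t * monom_value t x)"
  unfolding eval_cmpoly_def monom_value_def using assms
  by (intro sum.mono_neutral_left) (auto simp: in_keys_iff)

lemma eval_cmpoly_add: "eval_cmpoly (p + q) x = eval_cmpoly p x + eval_cmpoly q x"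
proof -
  let ?S = "Poly_Mapping.keys p \<union> Poly_Mapping.keys q"
  have "Poly_Mapping.keys (p + q) \<subseteq> ?S" by (rule Poly_Mapping.keys_add)
  then show ?thesis
    by (simp add: eval_cmpoly_superset[of ?S] lookup_add algebra_simps sum.distrib)
qed

lemma eval_cmpoly_zero [simp]: "eval_cmpoly 0 x = 0"
  by (simp add: eval_cmpoly_def)

lemma eval_cmpoly_single [simp]:
  "eval_cmpoly (Poly_Mapping.single t c) x = c * monom_value t x"
  by (cases "c = 0") (auto simp: eval_cmpoly_def monom_value_def)

lemma eval_cmpoly_sum: "eval_cmpoly (\<Sum>i\<in>I. f i) x = (\<Sum>i\<in>I. eval_cmpoly (f i) x)"
  by (induction I rule: infinite_finite_induct) (auto simp: eval_cmpoly_add)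

lemma poly_in_vars_add: "poly_in_vars m p \<Longrightarrow> poly_in_vars m q \<Longrightarrow> poly_in_vars m (p + q)"
  unfolding poly_in_vars_def using Poly_Mapping.keys_add[of p q] by blast

lemma poly_in_vars_sum: "(\<And>i. i \<in> I \<Longrightarrow> poly_in_vars m (f i)) \<Longrightarrow> poly_in_vars m (\<Sum>i\<in>I. f i)"
  by (induction I rule: infinite_finite_induct)
    (auto intro!: poly_in_vars_add, auto simp: poly_in_vars_def)

lemma polyfun_imp_cmpoly:
  assumes "polyfun m f"
  obtains p where "poly_in_vars m p" "\<And>x. eval_cmpoly p x = f x"
proof -
  have "\<exists>p. poly_in_vars m p \<and> (\<forall>x. eval_cmpoly p x = f x)"
    using assms
  proof induction
    case (polyfun_const c)
    show ?case
      by (rule exI[of _ "Poly_Mapping.single 0 c"])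
        (auto simp: poly_in_vars_def monom_value_def split: if_splits)
  next
    case (polyfun_index i)
    then show ?case
      by (intro exI[of _ "Poly_Mapping.single (Poly_Mapping.single i 1) 1"])
        (auto simp: poly_in_vars_def monom_value_def split: if_splits)
  next
    case (polyfun_add f g)
    then obtain p q where "poly_in_vars m p" "\<forall>x. eval_cmpoly p x = f x"
      "poly_in_vars m q" "\<forall>x. eval_cmpoly q x = g x" by blast
    then show ?case
      by (intro exI[of _ "p + q"]) (auto simp: eval_cmpoly_add poly_in_vars_add)
  next
    case (polyfun_mult f g)
    then obtain p q where p: "poly_in_vars m p" "\<forall>x. eval_cmpoly p x = f x"
      and q: "poly_in_vars m q" "\<forall>x. eval_cmpoly q x = g x" by blast
    define r where "r = (\<Sum>t\<in>Poly_Mapping.keys p. \<Sum>u\<in>Poly_Mapping.keys q.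
      Poly_Mapping.single (t + u) (Poly_Mapping.lookup p t * Poly_Mapping.lookup q u))"
    have "poly_in_vars m r" unfolding r_def
    proof (intro poly_in_vars_sum)
      fix t u assume tu: "t \<in> Poly_Mapping.keys p" "u \<in> Poly_Mapping.keys q"
      then have "Poly_Mapping.keys t \<union> Poly_Mapping.keys u \<subseteq> {..<m}"
        using p q by (auto simp: poly_in_vars_def)
      then show "poly_in_vars m (Poly_Mapping.single (t + u)
          (Poly_Mapping.lookup p t * Poly_Mapping.lookup q u))"
        using Poly_Mapping.keys_add[of t u] by (auto simp: poly_in_vars_def split: if_splits)
    qed
    moreover have "eval_cmpoly r x = f x * g x" for x
    proof -
      have "eval_cmpoly r x = eval_cmpoly p x * eval_cmpoly q x"
        unfolding r_def eval_cmpoly_sum eval_cmpoly_single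
        by (simp add: eval_cmpoly_superset[OF finite_keys subset_refl] sum_product
            monom_value_add mult_ac)
      then show ?thesis using p q by simp
    qed
    ultimately show ?case by blast
  qed
  then show ?thesis using that by blast
qed

lemma generic_nonvanishing:
  assumes "polyfun m f" "x \<in> carrier_vec m" "f x \<noteq> 0"
  shows "generic m {x \<in> carrier_vec m. f x \<noteq> 0}"
proof -
  obtain p where p: "poly_in_vars m p" "\<And>x. eval_cmpoly p x = f x"
    using polyfun_imp_cmpoly[OF assms(1)] by blast
  have "algebraic_set m {x \<in> carrier_vec m. f x = 0}"
    unfolding algebraic_set_def by (rule exI[of _ "{p}"]) (auto simp: p)
  then show ?thesis unfolding generic_def using assms(2,3) by blast
qed

text \<open>On a line a polynomial function is a polynomial in one variable. Two polynomial functions that are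
nonzero at two different points are therefore both nonzero at a point of the line that joins them.\<close>

lemma polyfun_restrict_line:
  assumes "polyfun m f"
  obtains q where "\<And>t. f (vec m (\<lambda>i. x $ i + t * (y $ i - x $ i))) = poly q t"
proof -
  have "\<exists>q. \<forall>t. f (vec m (\<lambda>i. x $ i + t * (y $ i - x $ i))) = poly q t"
    using assms
  proof induction
    case (polyfun_const c)
    show ?case by (rule exI[of _ "[:c:]"]) auto
  next
    case (polyfun_index i)
    then show ?case by (intro exI[of _ "[:x $ i, y $ i - x $ i:]"]) auto
  next
    case (polyfun_add f g)
    then show ?case by (metis poly_add)
  next
    case (polyfun_mult f g)
    then show ?case by (metis poly_mult)
  qed
  then show ?thesis using that by blast
qed

lemma polyfun_common_nonzero2:
  assumes f: "polyfun m f" "x \<in> carrier_vec m" "f x \<noteq> 0"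
    and g: "polyfun m g" "y \<in> carrier_vec m" "g y \<noteq> 0"
  obtains z where "z \<in> carrier_vec m" "f z \<noteq> 0" "g z \<noteq> 0"
proof -
  let ?l = "\<lambda>t. vec m (\<lambda>i. x $ i + t * (y $ i - x $ i))"
  obtain p where p: "\<And>t. f (?l t) = poly p t" using polyfun_restrict_line[OF f(1)] by blast
  obtain q where q: "\<And>t. g (?l t) = poly q t" using polyfun_restrict_line[OF g(1)] by blast
  have "?l 0 = x" "?l 1 = y" using f(2) g(2) by auto
  then have "poly p 0 \<noteq> 0" "poly q 1 \<noteq> 0" using p[of 0] q[of 1] f(3) g(3) by auto
  then have "p * q \<noteq> 0" by auto
  then obtain t where "poly (p * q) t \<noteq> 0" using poly_all_0_iff_0 by blast
  then show ?thesis using that[of "?l t"] p q by auto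
qed

text \<open>A predicate version of genericity with a single polynomial function as witness; products of witnesses
make it closed under conjunction.\<close>

definition generically :: "nat \<Rightarrow> (complex vec \<Rightarrow> bool) \<Rightarrow> bool" where
  "generically m C \<longleftrightarrow> (\<exists>h. polyfun m h \<and> (\<exists>x\<in>carrier_vec m. h x \<noteq> 0) \<and>
    (\<forall>x\<in>carrier_vec m. h x \<noteq> 0 \<longrightarrow> C x))"

lemma generically_obtain:
  assumes "generically m C"
  obtains x where "x \<in> carrier_vec m" "C x"
  using assms by (auto simp: generically_def)

lemma generically_imp_generic:
  assumes "generically m C"
  shows "\<exists>G. generic m G \<and> (\<forall>x\<in>G. C x)"
proof -
  obtain h x where h: "polyfun m h" "x \<in> carrier_vec m" "h x \<noteq> 0"
    "\<And>x. x \<in> carrier_vec m \<Longrightarrow> h x \<noteq> 0 \<Longrightarrow> C x"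
    using assms unfolding generically_def by blast
  show ?thesis using generic_nonvanishing[OF h(1-3)] h(4) by blast
qed

lemma generically_conj:
  assumes "generically m C1" "generically m C2"
  shows "generically m (\<lambda>x. C1 x \<and> C2 x)"
proof -
  obtain f x where f: "polyfun m f" "x \<in> carrier_vec m" "f x \<noteq> 0"
    "\<And>x. x \<in> carrier_vec m \<Longrightarrow> f x \<noteq> 0 \<Longrightarrow> C1 x"
    using assms(1) unfolding generically_def by blast
  obtain g y where g: "polyfun m g" "y \<in> carrier_vec m" "g y \<noteq> 0"
    "\<And>x. x \<in> carrier_vec m \<Longrightarrow> g x \<noteq> 0 \<Longrightarrow> C2 x"
    using assms(2) unfolding generically_def by blast
  obtain z where z: "z \<in> carrier_vec m" "f z \<noteq> 0" "g z \<noteq> 0"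
    using polyfun_common_nonzero2[OF f(1-3) g(1-3)] by blast
  show ?thesis unfolding generically_def
    using f(4) g(4) z
    by (intro exI[of _ "\<lambda>x. f x * g x"] conjI polyfun_mult f(1) g(1)) auto
qed

lemma generically_ball:
  assumes "finite I" "\<And>i. i \<in> I \<Longrightarrow> generically m (C i)"
  shows "generically m (\<lambda>x. \<forall>i\<in>I. C i x)"
  using assms
proof (induction I)
  case empty
  show ?case unfolding generically_def
    by (intro exI[of _ "\<lambda>_. 1"]) (auto intro: exI[of _ "0\<^sub>v m"])
next
  case (insert i I)
  then have "generically m (\<lambda>x. C i x \<and> (\<forall>i\<in>I. C i x))" by (intro generically_conj) auto
  then show ?case by simp
qed

text \<open>The uniform bound on the degree confines the family to a finite-dimensional space of polynomials.\<close>

definition polyfun_poly :: "nat \<Rightarrow> (complex vec \<Rightarrow> complex poly) \<Rightarrow> bool" where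
  "polyfun_poly m F \<longleftrightarrow>
    (\<exists>N. \<forall>x. degree (F x) \<le> N) \<and> (\<forall>i. polyfun m (\<lambda>x. coeff (F x) i))"

lemma polyfun_poly_const [intro!, simp]: "polyfun_poly m (\<lambda>x. p)"
  by (auto simp: polyfun_poly_def)

lemma polyfun_poly_of_polyfun: "polyfun m f \<Longrightarrow> polyfun_poly m (\<lambda>x. [:f x:])"
  unfolding polyfun_poly_def
proof (intro conjI allI)
  show "polyfun m f \<Longrightarrow> polyfun m (\<lambda>x. coeff [:f x:] i)" for i by (cases i) auto
qed (auto intro!: exI[of _ 0])

lemma polyfun_poly_add:
  assumes "polyfun_poly m F" "polyfun_poly m G"
  shows "polyfun_poly m (\<lambda>x. F x + G x)"
proof -
  from assms obtain M N where "\<And>x. degree (F x) \<le> M" "\<And>x. degree (G x) \<le> N"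
    by (auto simp: polyfun_poly_def)
  then have "degree (F x + G x) \<le> max M N" for x
    by (meson degree_add_le max.coboundedI1 max.coboundedI2)
  then show ?thesis using assms by (auto simp: polyfun_poly_def intro!: polyfun_add)
qed

lemma polyfun_poly_mult:
  assumes "polyfun_poly m F" "polyfun_poly m G"
  shows "polyfun_poly m (\<lambda>x. F x * G x)"
proof -
  from assms obtain M N where "\<And>x. degree (F x) \<le> M" "\<And>x. degree (G x) \<le> N"
    by (auto simp: polyfun_poly_def)
  then have "degree (F x * G x) \<le> M + N" for x
    by (meson degree_mult_le add_mono order_trans)
  then show ?thesis using assms
    by (auto simp: polyfun_poly_def coeff_mult intro!: polyfun_sum polyfun_mult)
qed

lemma polyfun_poly_sum:
  "(\<And>i. i \<in> I \<Longrightarrow> polyfun_poly m (F i)) \<Longrightarrow> polyfun_poly m (\<lambda>x. \<Sum>i\<in>I. F i x)"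
  by (induction I rule: infinite_finite_induct) (auto intro!: polyfun_poly_add)

lemma polyfun_poly_prod:
  "(\<And>i. i \<in> I \<Longrightarrow> polyfun_poly m (F i)) \<Longrightarrow> polyfun_poly m (\<lambda>x. \<Prod>i\<in>I. F i x)"
  by (induction I rule: infinite_finite_induct) (auto intro!: polyfun_poly_mult)

lemma polyfun_poly_det:
  assumes "\<And>x. M x \<in> carrier_mat n n"
    and "\<And>i j. i < n \<Longrightarrow> j < n \<Longrightarrow> polyfun_poly m (\<lambda>x. M x $$ (i, j))"
  shows "polyfun_poly m (\<lambda>x. det (M x))"
proof -
  have eq: "(\<lambda>x. det (M x)) =
    (\<lambda>x. \<Sum>p | p permutes {0..<n}. signof p * (\<Prod>i = 0..<n. M x $$ (i, p i)))"
    using assms(1) by (auto simp: det_def')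
  show ?thesis unfolding eq
    by (intro polyfun_poly_sum polyfun_poly_mult polyfun_poly_prod assms polyfun_poly_const)
      (auto simp: permutes_in_image)
qed

text \<open>On polynomials of bounded degree a linear functional is a fixed linear combination of the coefficients.
The functionals used below are Taylor coefficients at a point and coefficients of multiples of a
polynomial and of its derivative.\<close>

lemma polyfun_linear_functional:
  assumes F: "polyfun_poly m F"
    and add: "\<And>p q. \<phi> (p + q) = \<phi> p + \<phi> q" and smult: "\<And>c p. \<phi> (Polynomial.smult c p) = c * \<phi> p"
  shows "polyfun m (\<lambda>x. \<phi> (F x))"
proof -
  obtain N where N: "\<And>x. degree (F x) \<le> N" using F by (auto simp: polyfun_poly_def)
  have zero: "\<phi> 0 = 0" using smult[of 0 0] by simp
  have sum: "\<phi> (\<Sum>i\<in>I. g i) = (\<Sum>i\<in>I. \<phi> (g i))" for g and I :: "nat set"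
    by (induction I rule: infinite_finite_induct) (auto simp: add zero)
  have "\<phi> (F x) = (\<Sum>i\<le>N. coeff (F x) i * \<phi> (monom 1 i))" for x
  proof -
    have "F x = (\<Sum>i\<le>N. Polynomial.smult (coeff (F x) i) (monom 1 i))"
      using poly_as_sum_of_monoms'[OF N[of x]] by (simp add: smult_monom)
    then have "\<phi> (F x) = \<phi> (\<Sum>i\<le>N. Polynomial.smult (coeff (F x) i) (monom 1 i))" by simp
    then show ?thesis by (simp add: sum smult)
  qed
  then show ?thesis using F
    by (auto simp: polyfun_poly_def intro!: polyfun_sum polyfun_mult)
qed

lemma power_dvd_iff_taylor_coeffs:
  fixes p :: "complex poly"
  shows "[:-a, 1:] ^ k dvd p \<longleftrightarrow> (\<forall>j<k. coeff (p \<circ>\<^sub>p [:a, 1:]) j = 0)"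
proof -
  have shift: "[:-a, 1:] \<circ>\<^sub>p [:a, 1:] = [:0, 1:]" "[:0, 1:] \<circ>\<^sub>p [:-a, 1:] = [:-a, 1:]"
    "[:a, 1:] \<circ>\<^sub>p [:-a, 1:] = [:0, 1:]"
    by (simp_all add: pcompose_pCons)
  have "[:-a, 1:] ^ k dvd p \<longleftrightarrow> [:0, 1:] ^ k dvd p \<circ>\<^sub>p [:a, 1:]"
  proof
    assume "[:-a, 1:] ^ k dvd p"
    then obtain q where q: "p = [:-a, 1:] ^ k * q" unfolding dvd_def by blast
    show "[:0, 1:] ^ k dvd p \<circ>\<^sub>p [:a, 1:]"
      unfolding q pcompose_mult pcompose_hom.hom_power shift by (rule dvd_triv_left)
  next
    assume "[:0, 1:] ^ k dvd p \<circ>\<^sub>p [:a, 1:]"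
    then obtain q where q: "p \<circ>\<^sub>p [:a, 1:] = [:0, 1:] ^ k * q" unfolding dvd_def by blast
    have "p = (p \<circ>\<^sub>p [:a, 1:]) \<circ>\<^sub>p [:-a, 1:]"
      by (simp add: shift flip: pcompose_assoc)
    also have "\<dots> = [:-a, 1:] ^ k * (q \<circ>\<^sub>p [:-a, 1:])"
      unfolding q pcompose_mult pcompose_hom.hom_power shift by (rule refl)
    finally show "[:-a, 1:] ^ k dvd p" by (rule dvdI)
  qed
  then show ?thesis using monom_1_dvd_iff'[of k "p \<circ>\<^sub>p [:a, 1:]"] by (simp add: monom_altdef)
qed

text \<open>If \<open>t ^ k\<close> does not divide \<open>F x0\<close>, then one of the first \<open>k\<close> Taylor coefficients is nonzero at
\<open>x0\<close>, and wherever this coefficient is nonzero the divisibility fails.\<close>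

lemma generically_not_power_dvd:
  assumes F: "polyfun_poly m F" and x0: "x0 \<in> carrier_vec m" "\<not> [:-a, 1:] ^ k dvd F x0"
  shows "generically m (\<lambda>x. \<not> [:-a, 1:] ^ k dvd F x)"
proof -
  obtain j where j: "j < k" "coeff (F x0 \<circ>\<^sub>p [:a, 1:]) j \<noteq> 0"
    using x0 by (auto simp: power_dvd_iff_taylor_coeffs)
  have "polyfun m (\<lambda>x. coeff (F x \<circ>\<^sub>p [:a, 1:]) j)"
    by (rule polyfun_linear_functional[OF F]) (auto simp: pcompose_add pcompose_smult)
  moreover have "\<not> [:-a, 1:] ^ k dvd F x" if "coeff (F x \<circ>\<^sub>p [:a, 1:]) j \<noteq> 0" for x
    using that j(1) by (auto simp: power_dvd_iff_taylor_coeffs)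
  ultimately show ?thesis unfolding generically_def using x0(1) j(2) by blast
qed

lemma generically_nonzero:
  assumes F: "polyfun_poly m F" and x0: "x0 \<in> carrier_vec m" "F x0 \<noteq> 0"
  shows "generically m (\<lambda>x. F x \<noteq> 0)"
proof -
  obtain i where "coeff (F x0) i \<noteq> 0" using x0(2) by (auto simp: poly_eq_iff)
  then show ?thesis unfolding generically_def using F x0(1)
    by (intro exI[of _ "\<lambda>x. coeff (F x) i"]) (auto simp: polyfun_poly_def)
qed

section \<open>Root frames\<close>

lemma const_mat_carrier [simp]: "const_mat A \<in> carrier_mat n m \<longleftrightarrow> A \<in> carrier_mat n m"
  by (auto simp: const_mat_def)

lemma const_mat_dim [simp]: "dim_row (const_mat A) = dim_row A" "dim_col (const_mat A) = dim_col A"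
  by (auto simp: const_mat_def)

lemma const_mat_index [simp]:
  "i < dim_row A \<Longrightarrow> j < dim_col A \<Longrightarrow> const_mat A $$ (i, j) = [:A $$ (i, j):]"
  by (simp add: const_mat_def)

interpretation const_poly_hom: comm_ring_hom "\<lambda>a :: complex. [:a:]"
  by unfold_locales (auto simp: one_pCons)

lemma const_mat_mult:
  "A \<in> carrier_mat n m \<Longrightarrow> B \<in> carrier_mat m l \<Longrightarrow> const_mat (A * B) = const_mat A * const_mat B"
  unfolding const_mat_def by (rule const_poly_hom.mat_hom_mult)

lemma const_mat_one [simp]: "const_mat (1\<^sub>m n) = 1\<^sub>m n"
  unfolding const_mat_def by (rule const_poly_hom.mat_hom_one)

lemma det_const_mat: "det (const_mat A) = [:det A:]"
  unfolding const_mat_def by (simp add: const_poly_hom.hom_det)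

lemma poly_eval_comm_ring_hom: "comm_ring_hom (\<lambda>p :: complex poly. poly p \<mu>)"
  by unfold_locales auto

lemma poly_eval_semiring_hom: "semiring_hom (\<lambda>p :: complex poly. poly p \<mu>)"
  by unfold_locales auto

lemma mat_mult_assoc:
  fixes A :: "'a :: semiring_0 mat"
  shows "dim_col A = dim_row B \<Longrightarrow> dim_col B = dim_row C \<Longrightarrow> A * B * C = A * (B * C)"
  by (rule assoc_mult_mat[of A "dim_row A" "dim_row B" B "dim_row C" C "dim_col C"]) auto

definition eval_mat :: "complex \<Rightarrow> complex poly mat \<Rightarrow> complex mat" where
  "eval_mat \<mu> M = map_mat (\<lambda>p. poly p \<mu>) M"

lemma eval_mat_carrier [simp]: "eval_mat \<mu> M \<in> carrier_mat n m \<longleftrightarrow> M \<in> carrier_mat n m"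
  by (auto simp: eval_mat_def)

lemma eval_mat_dim [simp]:
  "dim_row (eval_mat \<mu> M) = dim_row M" "dim_col (eval_mat \<mu> M) = dim_col M"
  by (auto simp: eval_mat_def)

lemma eval_mat_index [simp]:
  "i < dim_row M \<Longrightarrow> j < dim_col M \<Longrightarrow> eval_mat \<mu> M $$ (i, j) = poly (M $$ (i, j)) \<mu>"
  by (simp add: eval_mat_def)

lemma eval_mat_mult:
  "M \<in> carrier_mat n m \<Longrightarrow> N \<in> carrier_mat m l \<Longrightarrow>
    eval_mat \<mu> (M * N) = eval_mat \<mu> M * eval_mat \<mu> N"
  unfolding eval_mat_def by (rule semiring_hom.mat_hom_mult[OF poly_eval_semiring_hom])

lemma eval_const_mat [simp]: "eval_mat \<mu> (const_mat A) = A"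
  by (intro eq_matI) auto

lemma det_eval_mat: "det (eval_mat \<mu> M) = poly (det M) \<mu>"
  unfolding eval_mat_def by (simp add: comm_ring_hom.hom_det[OF poly_eval_comm_ring_hom])

definition dvd_mat :: "complex poly \<Rightarrow> complex poly mat \<Rightarrow> bool" where
  "dvd_mat q M \<longleftrightarrow> (\<forall>i<dim_row M. \<forall>j<dim_col M. q dvd M $$ (i, j))"

lemma dvd_mat_mult_left: "dvd_mat q N \<Longrightarrow> dim_col M = dim_row N \<Longrightarrow> dvd_mat q (M * N)"
  unfolding dvd_mat_def by (auto simp: scalar_prod_def intro!: dvd_sum dvd_mult)

lemma dvd_mat_mult_right: "dvd_mat q M \<Longrightarrow> dim_col M = dim_row N \<Longrightarrow> dvd_mat q (M * N)"
  unfolding dvd_mat_def by (auto simp: scalar_prod_def intro!: dvd_sum dvd_mult2)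

text \<open>The columns of \<open>X\<close> are root polynomials of \<open>L\<close> at \<open>\<mu>\<close>; the left inverse \<open>Z\<close> expresses that
their values at \<open>\<mu>\<close> are linearly independent. The largest possible \<open>d\<close> is the number of partial
multiplicities at \<open>\<mu>\<close> that are at least \<open>k\<close>, and unlike a canonical form it reacts to low-rank
updates in a controlled way.\<close>

definition root_frame :: "complex poly mat \<Rightarrow> complex \<Rightarrow> nat \<Rightarrow> nat \<Rightarrow> bool" where
  "root_frame L \<mu> k d \<longleftrightarrow>
    (\<exists>X Z. X \<in> carrier_mat (dim_col L) d \<and> Z \<in> carrier_mat d (dim_col L) \<and>
      dvd_mat ([:-\<mu>, 1:] ^ k) (L * X) \<and> Z * eval_mat \<mu> X = 1\<^sub>m d)"

text \<open>Divide by the highest power of \<open>[:-\<mu>, 1:]\<close> that is common to all entries.\<close>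

lemma common_local_factor:
  fixes y :: "nat \<Rightarrow> complex poly"
  assumes "0 < m"
  shows "\<exists>s y' q. (\<forall>j<m. y j = s * y' j) \<and> q < m \<and> poly (y' q) \<mu> \<noteq> 0"
proof (cases "\<forall>j<m. y j = 0")
  case True
  then show ?thesis using assms
    by (intro exI[of _ 0] exI[of _ "\<lambda>_. 1"]) auto
next
  case False
  define S where "S = {j. j < m \<and> y j \<noteq> 0}"
  have S: "finite S" "S \<noteq> {}" using False by (auto simp: S_def)
  obtain q where q: "q \<in> S" "\<And>j. j \<in> S \<Longrightarrow> order \<mu> (y q) \<le> order \<mu> (y j)"
    using S using ex_min_if_finite[of "(\<lambda>j. order \<mu> (y j)) ` S"] by force
  define s where "s = [:-\<mu>, 1:] ^ order \<mu> (y q)"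
  have dvd: "s dvd y j" if "j < m" for j
    using that q(2)[of j] order_divides[of \<mu> "order \<mu> (y q)" "y j"] by (auto simp: S_def s_def)
  define y' where "y' j = y j div s" for j
  have eq: "y j = s * y' j" if "j < m" for j using dvd[OF that] by (simp add: y'_def)
  have qm: "q < m" using q(1) by (simp add: S_def)
  have "poly (y' q) \<mu> \<noteq> 0"
  proof
    assume "poly (y' q) \<mu> = 0"
    then have "[:-\<mu>, 1:] dvd y' q" by (simp add: poly_eq_0_iff_dvd)
    then have "s * [:-\<mu>, 1:] dvd y q"
      unfolding eq[OF qm] by (rule mult_dvd_mono[OF dvd_refl])
    then have "[:-\<mu>, 1:] ^ Suc (order \<mu> (y q)) dvd y q"
      by (simp only: s_def power_Suc2)
    then show False using q(1) order_divides[of \<mu> "Suc (order \<mu> (y q))" "y q"]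
      by (auto simp: S_def)
  qed
  with eq qm show ?thesis by blast
qed

lemma insert_index_less: "j < d \<Longrightarrow> q < Suc d \<Longrightarrow> insert_index q j < Suc d"
  by (auto simp: insert_index_def)

lemma insert_index_neq: "insert_index q j \<noteq> q" "q \<noteq> insert_index q j"
  by (auto simp: insert_index_def)

lemma insert_index_inj: "insert_index q i = insert_index q j \<longleftrightarrow> i = j"
  by (auto simp: insert_index_def split: if_splits)

text \<open>After the common factor at \<open>\<mu>\<close> is removed, some entry \<open>y q\<close> of the row is a local unit. The vectors
\<open>y q * e\<^sub>j - y j * e\<^sub>q\<close> for \<open>j \<noteq> q\<close> annihilate the row and stay independent at \<open>\<mu>\<close>. The indices
\<open>j \<noteq> q\<close> are enumerated by \<open>insert_index q\<close>.\<close>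

lemma row_annihilator:
  assumes Y: "Y \<in> carrier_mat 1 (Suc d)"
  obtains C W where "C \<in> carrier_mat (Suc d) d" "W \<in> carrier_mat d (Suc d)"
    "Y * C = 0\<^sub>m 1 d" "W * eval_mat \<mu> C = 1\<^sub>m d"
proof -
  obtain s y q where y: "\<And>j. j < Suc d \<Longrightarrow> Y $$ (0, j) = s * y j" and q: "q < Suc d"
    and yq: "poly (y q) \<mu> \<noteq> 0"
    using common_local_factor[OF zero_less_Suc, of d "\<lambda>j. Y $$ (0, j)" \<mu>] by blast
  define C where "C = mat (Suc d) d (\<lambda>(i, j). if i = insert_index q j then y q
    else if i = q then - y (insert_index q j) else 0)"
  define W where "W = mat d (Suc d) (\<lambda>(j, i). if i = insert_index q j then 1 / poly (y q) \<mu> else 0)"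
  have "Y * C = 0\<^sub>m 1 d"
  proof (intro eq_matI)
    fix i j assume ij: "i < dim_row (0\<^sub>m 1 d)" "j < dim_col (0\<^sub>m 1 d)"
    let ?r = "insert_index q j"
    have r: "?r < Suc d" "?r \<noteq> q" using ij q by (auto simp: insert_index_less insert_index_neq)
    have "(Y * C) $$ (i, j) = (\<Sum>l<Suc d. Y $$ (0, l) * C $$ (l, j))"
      using ij Y by (auto simp: scalar_prod_def C_def atLeast0LessThan)
    also have "\<dots> = (\<Sum>l<Suc d. s * ((if l = ?r then y l * y q else 0)
        - (if l = q then y l * y ?r else 0)))"
      using ij r by (intro sum.cong) (auto simp: C_def y)
    also have "\<dots> = s * (y ?r * y q - y q * y ?r)"
      unfolding sum_distrib_left[symmetric] sum_subtractf using r q by simp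
    finally show "(Y * C) $$ (i, j) = 0\<^sub>m 1 d $$ (i, j)" using ij by simp
  qed (use Y in \<open>auto simp: C_def\<close>)
  moreover have "W * eval_mat \<mu> C = 1\<^sub>m d"
  proof (intro eq_matI)
    fix i j assume ij: "i < dim_row (1\<^sub>m d)" "j < dim_col (1\<^sub>m d)"
    let ?r = "insert_index q i"
    have r: "?r < Suc d" "?r \<noteq> q" using ij q by (auto simp: insert_index_less insert_index_neq)
    have "(W * eval_mat \<mu> C) $$ (i, j) = (\<Sum>l<Suc d. W $$ (i, l) * poly (C $$ (l, j)) \<mu>)"
      using ij by (auto simp: scalar_prod_def C_def W_def atLeast0LessThan)
    also have "\<dots> = (\<Sum>l<Suc d. if l = ?r then 1 / poly (y q) \<mu> * poly (C $$ (l, j)) \<mu> else 0)"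
      using ij by (intro sum.cong) (auto simp: W_def)
    also have "\<dots> = 1 / poly (y q) \<mu> * poly (C $$ (?r, j)) \<mu>" using r by simp
    finally show "(W * eval_mat \<mu> C) $$ (i, j) = 1\<^sub>m d $$ (i, j)"
      using ij r yq by (auto simp: C_def insert_index_inj)
  qed (auto simp: C_def W_def)
  ultimately show ?thesis using that[of C W] by (auto simp: C_def W_def)
qed

text \<open>The combinations of the given root polynomials that the row \<open>b\<close> annihilates do not see the update,
and only one dimension is lost in passing to them.\<close>

lemma root_frame_rank_one_update:
  assumes L: "L \<in> carrier_mat n n" and a: "a \<in> carrier_mat n 1" and b: "b \<in> carrier_mat 1 n"
    and frame: "root_frame L \<mu> k (Suc d)"
  shows "root_frame (L + a * b) \<mu> k d"
proof -
  obtain X Z where X: "X \<in> carrier_mat n (Suc d)" and Z: "Z \<in> carrier_mat (Suc d) n"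
    and dvd: "dvd_mat ([:-\<mu>, 1:] ^ k) (L * X)" and inv: "Z * eval_mat \<mu> X = 1\<^sub>m (Suc d)"
    using frame L unfolding root_frame_def by auto
  have bX: "b * X \<in> carrier_mat 1 (Suc d)" using b X by simp
  obtain C W where C: "C \<in> carrier_mat (Suc d) d" and W: "W \<in> carrier_mat d (Suc d)"
    and ann: "b * X * C = 0\<^sub>m 1 d" and invC: "W * eval_mat \<mu> C = 1\<^sub>m d"
    using row_annihilator[OF bX] by blast
  have "(L + a * b) * (X * C) = L * (X * C) + a * b * (X * C)"
    using L a b X C by (intro add_mult_distrib_mat[of _ n n]) auto
  also have "a * b * (X * C) = a * (b * X * C)"
    using a b X C by (simp add: mat_mult_assoc)
  also have "\<dots> = 0\<^sub>m n d" using a by (simp add: ann)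
  also have "L * (X * C) = L * X * C" using L X C by simp
  finally have eq: "(L + a * b) * (X * C) = L * X * C" using L X C by simp
  have "dvd_mat ([:-\<mu>, 1:] ^ k) ((L + a * b) * (X * C))"
    unfolding eq using L X C by (intro dvd_mat_mult_right dvd) auto
  moreover have "W * Z * eval_mat \<mu> (X * C) = 1\<^sub>m d"
  proof -
    have "W * Z * eval_mat \<mu> (X * C) = W * (Z * eval_mat \<mu> X) * eval_mat \<mu> C"
      using W Z X C
      by (simp add: eval_mat_mult[OF X C] mat_mult_assoc)
    then show ?thesis using W by (simp add: inv invC)
  qed
  ultimately show ?thesis unfolding root_frame_def
    using L a b X C W Z by (intro exI[of _ "X * C"] exI[of _ "W * Z"]) auto
qed

lemma root_frame_equivalence:
  assumes L: "L \<in> carrier_mat n n" and P: "P \<in> carrier_mat n n"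
    and Q: "Q \<in> carrier_mat n n" "Q' \<in> carrier_mat n n" "Q * Q' = 1\<^sub>m n"
    and frame: "root_frame L \<mu> k d"
  shows "root_frame (const_mat P * L * const_mat Q) \<mu> k d"
proof -
  obtain X Z where X: "X \<in> carrier_mat n d" and Z: "Z \<in> carrier_mat d n"
    and dvd: "dvd_mat ([:-\<mu>, 1:] ^ k) (L * X)" and inv: "Z * eval_mat \<mu> X = 1\<^sub>m d"
    using frame L unfolding root_frame_def by auto
  define X' where "X' = const_mat Q' * X"
  have X': "X' \<in> carrier_mat n d" using Q X by (simp add: X'_def)
  have QQ: "const_mat Q * const_mat Q' = 1\<^sub>m n"
    using Q const_mat_mult[of Q n n Q' n] by simp
  have "const_mat P * L * const_mat Q * X' = const_mat P * L * (const_mat Q * const_mat Q') * X"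
    unfolding X'_def using P L Q X
    by (simp add: mat_mult_assoc)
  also have "\<dots> = const_mat P * (L * X)" using P L X unfolding QQ by simp
  finally have "dvd_mat ([:-\<mu>, 1:] ^ k) (const_mat P * L * const_mat Q * X')"
    using P L X dvd_mat_mult_left[OF dvd, of "const_mat P"] by simp
  moreover have "Z * Q * eval_mat \<mu> X' = 1\<^sub>m d"
  proof -
    have "eval_mat \<mu> X' = Q' * eval_mat \<mu> X"
      unfolding X'_def using Q X by (simp add: eval_mat_mult[OF _ X, of _ n])
    then have "Z * Q * eval_mat \<mu> X' = Z * (Q * Q' * eval_mat \<mu> X)"
      using Q(1,2) X Z by (simp add: mat_mult_assoc)
    then show ?thesis using X inv Q by simp
  qed
  ultimately show ?thesis unfolding root_frame_def
    using P L Q X' Z by (intro exI[of _ X'] exI[of _ "Z * Q"]) auto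
qed

text \<open>If \<open>c < d\<close>, padding with zeros gives square matrices; a one-sided inverse is then two-sided, which is
impossible for a matrix with a zero row.\<close>

lemma left_inverse_imp_le:
  fixes A :: "complex mat"
  assumes A: "A \<in> carrier_mat d c" and B: "B \<in> carrier_mat c d" and AB: "A * B = 1\<^sub>m d"
  shows "d \<le> c"
proof (rule ccontr)
  assume "\<not> d \<le> c"
  then have cd: "c < d" by simp
  define A' where "A' = mat d d (\<lambda>(i, j). if j < c then A $$ (i, j) else 0)"
  define B' where "B' = mat d d (\<lambda>(i, j). if i < c then B $$ (i, j) else 0)"
  have "A' * B' = 1\<^sub>m d"
  proof (intro eq_matI)
    fix i j assume ij: "i < dim_row (1\<^sub>m d)" "j < dim_col (1\<^sub>m d)"
    have "(A' * B') $$ (i, j) = (\<Sum>l<d. if l < c then A $$ (i, l) * B $$ (l, j) else 0)"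
      using ij by (auto simp: scalar_prod_def A'_def B'_def atLeast0LessThan intro!: sum.cong)
    also have "\<dots> = (\<Sum>l<c. A $$ (i, l) * B $$ (l, j))"
      using cd by (intro sum.mono_neutral_cong_right) auto
    also have "\<dots> = (A * B) $$ (i, j)"
      using ij A B by (auto simp: scalar_prod_def atLeast0LessThan)
    finally show "(A' * B') $$ (i, j) = 1\<^sub>m d $$ (i, j)" by (simp add: AB)
  qed (auto simp: A'_def B'_def)
  then have "B' * A' = 1\<^sub>m d"
    by (rule mat_mult_left_right_inverse[rotated 2]) (auto simp: A'_def B'_def)
  moreover have "(B' * A') $$ (c, c) = 0"
    using cd by (auto simp: scalar_prod_def B'_def A'_def)
  ultimately show False using cd by simp
qed

section \<open>Multiplicities read off the Weierstrass form\<close>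

declare index_mult_mat_vec [simp del]

lemma pencil_carrier [simp]:
  "A \<in> carrier_mat n m \<Longrightarrow> B \<in> carrier_mat n m \<Longrightarrow> pencil A B \<in> carrier_mat n m"
  by (simp add: pencil_def)

lemma pencil_four_block_diag:
  assumes "A1 \<in> carrier_mat n n" "B1 \<in> carrier_mat n n" "A2 \<in> carrier_mat m m" "B2 \<in> carrier_mat m m"
  shows "pencil (four_block_mat A1 (0\<^sub>m n m) (0\<^sub>m m n) A2) (four_block_mat B1 (0\<^sub>m n m) (0\<^sub>m m n) B2) =
    four_block_mat (pencil A1 B1) (0\<^sub>m n m) (0\<^sub>m m n) (pencil A2 B2)"
  using assms by (intro eq_matI) (auto simp: pencil_def const_mat_def)

definition root_vectors :: "complex poly mat \<Rightarrow> complex \<Rightarrow> nat \<Rightarrow> complex poly vec set" where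
  "root_vectors L \<mu> k =
    {x \<in> carrier_vec (dim_col L). \<forall>i<dim_row L. [:-\<mu>, 1:] ^ k dvd (L *\<^sub>v x) $ i}"

lemma root_vectors_iff:
  "L \<in> carrier_mat n m \<Longrightarrow> x \<in> root_vectors L \<mu> k \<longleftrightarrow>
    x \<in> carrier_vec m \<and> (\<forall>i<n. [:-\<mu>, 1:] ^ k dvd (L *\<^sub>v x) $ i)"
  by (auto simp: root_vectors_def)

text \<open>A coordinate form of the space of values at \<open>\<mu>\<close> of root polynomials: it consists of the vectors
supported on \<open>T\<close>. Canonical forms admit such a \<open>T\<close>, and it is additive over diagonal blocks.\<close>

definition root_support :: "complex poly mat \<Rightarrow> complex \<Rightarrow> nat \<Rightarrow> nat set \<Rightarrow> bool" where
  "root_support L \<mu> k T \<longleftrightarrow> T \<subseteq> {..<dim_col L} \<and>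
    (\<forall>x\<in>root_vectors L \<mu> k. \<forall>i<dim_col L. i \<notin> T \<longrightarrow> poly (x $ i) \<mu> = 0) \<and>
    (\<forall>\<tau>\<in>T. \<exists>x\<in>root_vectors L \<mu> k. \<forall>i\<in>T. poly (x $ i) \<mu> = (if i = \<tau> then 1 else 0))"

lemma zero_root_vector: "0\<^sub>v (dim_col L) \<in> root_vectors L \<mu> k"
proof -
  have "L *\<^sub>v 0\<^sub>v (dim_col L) = 0\<^sub>v (dim_row L)"
    by (intro eq_vecI) (auto simp: index_mult_mat_vec)
  then show ?thesis by (simp add: root_vectors_def)
qed

lemma root_vectors_four_block_diag:
  assumes W: "W1 \<in> carrier_mat n n" "W2 \<in> carrier_mat m m"
    and x: "x1 \<in> carrier_vec n" "x2 \<in> carrier_vec m"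
  shows "x1 @\<^sub>v x2 \<in> root_vectors (four_block_mat W1 (0\<^sub>m n m) (0\<^sub>m m n) W2) \<mu> k \<longleftrightarrow>
    x1 \<in> root_vectors W1 \<mu> k \<and> x2 \<in> root_vectors W2 \<mu> k" (is "_ \<in> root_vectors ?W \<mu> k \<longleftrightarrow> _")
proof -
  have "?W *\<^sub>v (x1 @\<^sub>v x2) = (W1 *\<^sub>v x1) @\<^sub>v (W2 *\<^sub>v x2)"
  proof -
    have "0\<^sub>m n m *\<^sub>v x2 = 0\<^sub>v n" "0\<^sub>m m n *\<^sub>v x1 = 0\<^sub>v m"
      using x by (auto intro!: eq_vecI simp: index_mult_mat_vec)
    then show ?thesis
      using four_block_mat_mult_vec[of W1 n n "0\<^sub>m n m" m "0\<^sub>m m n" m W2 x1 x2] W x by simp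
  qed
  then have "x1 @\<^sub>v x2 \<in> root_vectors ?W \<mu> k \<longleftrightarrow>
    (\<forall>i<n+m. [:-\<mu>, 1:] ^ k dvd ((W1 *\<^sub>v x1) @\<^sub>v (W2 *\<^sub>v x2)) $ i)"
    using W x by (simp add: root_vectors_def)
  also have "\<dots> \<longleftrightarrow> (\<forall>i<n. [:-\<mu>, 1:] ^ k dvd (W1 *\<^sub>v x1) $ i) \<and>
      (\<forall>i<m. [:-\<mu>, 1:] ^ k dvd (W2 *\<^sub>v x2) $ i)" (is "?l \<longleftrightarrow> ?r")
  proof
    assume l: ?l
    show ?r
    proof (intro conjI allI impI)
      fix i assume "i < n"
      then show "[:-\<mu>, 1:] ^ k dvd (W1 *\<^sub>v x1) $ i"
        using l[rule_format, of i] W by (simp add: index_append_vec)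
    next
      fix i assume "i < m"
      then show "[:-\<mu>, 1:] ^ k dvd (W2 *\<^sub>v x2) $ i"
        using l[rule_format, of "n + i"] W by (simp add: index_append_vec)
    qed
  next
    assume r: ?r
    show ?l
    proof (intro allI impI)
      fix i assume i: "i < n + m"
      show "[:-\<mu>, 1:] ^ k dvd ((W1 *\<^sub>v x1) @\<^sub>v (W2 *\<^sub>v x2)) $ i"
        using r i W by (cases "i < n") (auto simp: index_append_vec)
    qed
  qed
  also have "\<dots> \<longleftrightarrow> x1 \<in> root_vectors W1 \<mu> k \<and> x2 \<in> root_vectors W2 \<mu> k"
    using W x by (simp add: root_vectors_def)
  finally show ?thesis .
qed

lemma root_support_four_block_diag:
  assumes W: "W1 \<in> carrier_mat n n" "W2 \<in> carrier_mat m m"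
    and T1: "root_support W1 \<mu> k T1" and T2: "root_support W2 \<mu> k T2"
  shows "root_support (four_block_mat W1 (0\<^sub>m n m) (0\<^sub>m m n) W2) \<mu> k (T1 \<union> (+) n ` T2)"
    (is "root_support ?W \<mu> k ?T")
proof -
  note rv = root_vectors_four_block_diag[OF W]
  have T1n: "T1 \<subseteq> {..<n}" and T2m: "T2 \<subseteq> {..<m}"
    using T1 T2 W by (auto simp: root_support_def)
  have dim: "dim_col ?W = n + m" using W by simp
  have "poly (x $ i) \<mu> = 0" if x: "x \<in> root_vectors ?W \<mu> k" and i: "i < n + m" "i \<notin> ?T" for x i
  proof -
    have xc: "x \<in> carrier_vec (n + m)" using x dim by (simp add: root_vectors_def)
    have c: "vec_first x n \<in> carrier_vec n" "vec_last x m \<in> carrier_vec m" by auto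
    have split: "vec_first x n @\<^sub>v vec_last x m = x" using xc by simp
    have x12: "vec_first x n \<in> root_vectors W1 \<mu> k" "vec_last x m \<in> root_vectors W2 \<mu> k"
      using rv[OF c] x split by auto
    show ?thesis
    proof (cases "i < n")
      case True
      then have "x $ i = vec_first x n $ i" by (simp add: vec_first_def)
      then show ?thesis using T1 x12 True i W by (auto simp: root_support_def)
    next
      case False
      then have "n + m - m + (i - n) = i" "i - n < m" "dim_vec x = n + m" using i xc by auto
      then have "x $ i = vec_last x m $ (i - n)" by (simp only: vec_last_def index_vec)
      moreover have "i - n \<notin> T2" using i False by (metis UnI2 imageI le_add_diff_inverse not_less)
      ultimately show ?thesis using T2 x12 False i W by (auto simp: root_support_def)
    qed
  qed
  moreover have "\<exists>x\<in>root_vectors ?W \<mu> k. \<forall>i\<in>?T. poly (x $ i) \<mu> = (if i = \<tau> then 1 else 0)"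
    if tau: "\<tau> \<in> ?T" for \<tau>
  proof (cases "\<tau> \<in> T1")
    case True
    then obtain x where x: "x \<in> root_vectors W1 \<mu> k"
      "\<And>i. i \<in> T1 \<Longrightarrow> poly (x $ i) \<mu> = (if i = \<tau> then 1 else 0)"
      using T1 by (auto simp: root_support_def)
    have c: "x \<in> carrier_vec n" "0\<^sub>v m \<in> carrier_vec m" using x(1) W by (auto simp: root_vectors_def)
    have "x @\<^sub>v 0\<^sub>v m \<in> root_vectors ?W \<mu> k"
      using rv[OF c] x(1) zero_root_vector[of W2] W by simp
    then show ?thesis using x(2) c T1n T2m True
      by (intro bexI[of _ "x @\<^sub>v 0\<^sub>v m"]) (auto simp: index_append_vec)
  next
    case False
    then obtain \<tau>' where \<tau>': "\<tau> = n + \<tau>'" "\<tau>' \<in> T2" using tau by auto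
    then obtain x where x: "x \<in> root_vectors W2 \<mu> k"
      "\<And>i. i \<in> T2 \<Longrightarrow> poly (x $ i) \<mu> = (if i = \<tau>' then 1 else 0)"
      using T2 by (auto simp: root_support_def)
    have c: "0\<^sub>v n \<in> carrier_vec n" "x \<in> carrier_vec m" using x(1) W by (auto simp: root_vectors_def)
    have "0\<^sub>v n @\<^sub>v x \<in> root_vectors ?W \<mu> k"
      using rv[OF c] x(1) zero_root_vector[of W1] W by simp
    then show ?thesis using x(2) c T1n T2m \<tau>'
      by (intro bexI[of _ "0\<^sub>v n @\<^sub>v x"]) (auto simp: index_append_vec subset_iff)
  qed
  moreover have "?T \<subseteq> {..<n + m}" using T1n T2m by auto
  ultimately show ?thesis unfolding root_support_def dim by blast
qed

text \<open>The rows of a frame outside \<open>T\<close> vanish at \<open>\<mu>\<close>, so its left inverse restricts to the rows in \<open>T\<close>;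
conversely the dual root vectors provided by \<open>T\<close> are the columns of a frame.\<close>

lemma root_frame_iff_le_card:
  assumes W: "W \<in> carrier_mat n n" and T: "root_support W \<mu> k T"
  shows "root_frame W \<mu> k d \<longleftrightarrow> d \<le> card T"
proof -
  have Tn: "T \<subseteq> {..<n}" and fin: "finite T"
    using T W by (auto simp: root_support_def intro: finite_subset[of _ "{..<n}"])
  obtain h where h: "bij_betw h {0..<card T} T" using ex_bij_betw_nat_finite[OF fin] by blast
  have hT: "h i \<in> T" if "i < card T" for i using h that by (auto simp: bij_betw_def)
  have hn: "h i < n" if "i < card T" for i using hT[OF that] Tn by auto
  have hinj: "h i = h j \<longleftrightarrow> i = j" if "i < card T" "j < card T" for i j
    using h that by (auto simp: bij_betw_def inj_on_def)
  have col_eq: "(W * X) $$ (i, j) = (W *\<^sub>v col X j) $ i"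
    if "X \<in> carrier_mat n d" "i < n" "j < d" for X i j
    using that W by (simp add: index_mult_mat_vec)
  show ?thesis
  proof
    assume "root_frame W \<mu> k d"
    then obtain X Z where X: "X \<in> carrier_mat n d" and Z: "Z \<in> carrier_mat d n"
      and dvd: "dvd_mat ([:-\<mu>, 1:] ^ k) (W * X)" and inv: "Z * eval_mat \<mu> X = 1\<^sub>m d"
      using W unfolding root_frame_def by auto
    have col: "col X j \<in> root_vectors W \<mu> k" if "j < d" for j
      using dvd X W that unfolding root_vectors_def dvd_mat_def
      by (auto simp: index_mult_mat_vec)
    have zero: "poly (X $$ (i, j)) \<mu> = 0" if "i < n" "j < d" "i \<notin> T" for i j
    proof -
      have "poly (col X j $ i) \<mu> = 0"
        using T W col[OF that(2)] that(1,3) by (auto simp: root_support_def)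
      then show ?thesis using X that by simp
    qed
    define Z' where "Z' = mat d (card T) (\<lambda>(i, l). Z $$ (i, h l))"
    define X' where "X' = mat (card T) d (\<lambda>(l, j). poly (X $$ (h l, j)) \<mu>)"
    have "Z' * X' = 1\<^sub>m d"
    proof (intro eq_matI)
      fix i j assume ij: "i < dim_row (1\<^sub>m d)" "j < dim_col (1\<^sub>m d)"
      have "(Z' * X') $$ (i, j) = (\<Sum>l = 0..<card T. Z $$ (i, h l) * poly (X $$ (h l, j)) \<mu>)"
        using ij by (auto simp: scalar_prod_def Z'_def X'_def)
      also have "\<dots> = (\<Sum>l\<in>T. Z $$ (i, l) * poly (X $$ (l, j)) \<mu>)"
        using sum.reindex_bij_betw[OF h, of "\<lambda>l. Z $$ (i, l) * poly (X $$ (l, j)) \<mu>"] by simp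
      also have "\<dots> = (\<Sum>l = 0..<n. Z $$ (i, l) * poly (X $$ (l, j)) \<mu>)"
        using Tn zero ij by (intro sum.mono_neutral_left) auto
      also have "\<dots> = (Z * eval_mat \<mu> X) $$ (i, j)"
        using ij Z X by (auto simp: scalar_prod_def)
      finally show "(Z' * X') $$ (i, j) = 1\<^sub>m d $$ (i, j)" by (simp add: inv)
    qed (auto simp: Z'_def X'_def)
    then show "d \<le> card T"
      by (rule left_inverse_imp_le[rotated 2]) (auto simp: Z'_def X'_def)
  next
    assume d: "d \<le> card T"
    have "\<forall>\<tau>\<in>T. \<exists>x\<in>root_vectors W \<mu> k. \<forall>i\<in>T. poly (x $ i) \<mu> = (if i = \<tau> then 1 else 0)"
      using T by (auto simp: root_support_def)
    then obtain x where x: "\<And>\<tau>. \<tau> \<in> T \<Longrightarrow> x \<tau> \<in> root_vectors W \<mu> k"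
      "\<And>\<tau> i. \<tau> \<in> T \<Longrightarrow> i \<in> T \<Longrightarrow> poly (x \<tau> $ i) \<mu> = (if i = \<tau> then 1 else 0)"
      by metis
    define X where "X = mat n d (\<lambda>(i, j). x (h j) $ i)"
    define Z :: "complex mat" where "Z = mat d n (\<lambda>(j, i). if i = h j then 1 else 0)"
    have X: "X \<in> carrier_mat n d" and Z: "Z \<in> carrier_mat d n" by (auto simp: X_def Z_def)
    have col: "col X j = x (h j)" if "j < d" for j
      using x(1)[of "h j"] hT[of j] that d W by (intro eq_vecI) (auto simp: X_def root_vectors_def)
    have "dvd_mat ([:-\<mu>, 1:] ^ k) (W * X)"
      unfolding dvd_mat_def
    proof (intro allI impI)
      fix i j assume "i < dim_row (W * X)" "j < dim_col (W * X)"
      then have ij: "i < n" "j < d" using W X by auto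
      then have "x (h j) \<in> root_vectors W \<mu> k" using x(1) hT d by simp
      then show "[:-\<mu>, 1:] ^ k dvd (W * X) $$ (i, j)"
        unfolding col_eq[OF X ij] col[OF ij(2)] using ij W by (simp add: root_vectors_def)
    qed
    moreover have "Z * eval_mat \<mu> X = 1\<^sub>m d"
    proof (intro eq_matI)
      fix i j assume ij: "i < dim_row (1\<^sub>m d)" "j < dim_col (1\<^sub>m d)"
      have "(Z * eval_mat \<mu> X) $$ (i, j) = (\<Sum>l<n. Z $$ (i, l) * poly (X $$ (l, j)) \<mu>)"
        using ij X Z by (auto simp: scalar_prod_def atLeast0LessThan)
      also have "\<dots> = (\<Sum>l<n. if l = h i then poly (X $$ (l, j)) \<mu> else 0)"
        using ij by (intro sum.cong) (auto simp: Z_def)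
      also have "\<dots> = poly (X $$ (h i, j)) \<mu>" using hn[of i] ij d by simp
      also have "\<dots> = 1\<^sub>m d $$ (i, j)"
        using ij d hn[of i] hT[of i] hT[of j] hinj[of i j] x(2)[of "h j" "h i"] by (auto simp: X_def)
      finally show "(Z * eval_mat \<mu> X) $$ (i, j) = 1\<^sub>m d $$ (i, j)" .
    qed (use X Z in auto)
    ultimately show "root_frame W \<mu> k d" unfolding root_frame_def using W X Z by auto
  qed
qed

lemma bidiagonal_mult_index:
  fixes x :: "complex poly vec"
  assumes M: "M \<in> carrier_mat m m" and x: "x \<in> carrier_vec m" and i: "i < m"
    and entries: "\<And>i j. i < m \<Longrightarrow> j < m \<Longrightarrow> M $$ (i, j) = (if i = j then p else if Suc i = j then q else 0)"
  shows "(M *\<^sub>v x) $ i = p * x $ i + (if Suc i < m then q * x $ Suc i else 0)"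
proof -
  have "(M *\<^sub>v x) $ i = (\<Sum>j = 0..<m. M $$ (i, j) * x $ j)"
    using M x i by (auto simp: scalar_prod_def index_mult_mat_vec)
  also have "\<dots> = (\<Sum>j = 0..<m. (if j = i then p * x $ j else 0) + (if j = Suc i then q * x $ j else 0))"
    using i by (intro sum.cong) (auto simp: entries)
  finally show ?thesis using i by (simp add: sum.distrib)
qed

text \<open>Modulo \<open>t ^ k\<close> the rows read \<open>x\<^sub>i\<^sub>+\<^sub>1 = (\<lambda> - a) x\<^sub>i\<close> and \<open>(\<lambda> - a) x\<^sub>m\<^sub>-\<^sub>1 = 0\<close>. If \<open>a \<noteq> \<mu>\<close>,
evaluation at \<open>\<mu>\<close> from the last row upwards gives zero throughout. If \<open>a = \<mu>\<close>, only \<open>x\<^sub>0\<close> can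
survive at \<open>\<mu>\<close>, and \<open>t ^ m * x\<^sub>0 = 0\<close> modulo \<open>t ^ k\<close> forbids this exactly when \<open>m < k\<close>; for
\<open>k \<le> m\<close> the vector of powers of \<open>t\<close> is a root vector.\<close>

lemma root_support_jordan_pencil_block:
  assumes k: "0 < k"
  shows "root_support (pencil (- jordan_block m a) (1\<^sub>m m)) \<mu> k
    (if a = \<mu> \<and> k \<le> m \<and> 0 < m then {0} else {})" (is "root_support ?W \<mu> k ?T")
proof -
  have W: "?W \<in> carrier_mat m m" by simp
  let ?t = "[:-\<mu>, 1:]"
  have mult: "(?W *\<^sub>v x) $ i = [:-a, 1:] * x $ i + (if Suc i < m then -1 * x $ Suc i else 0)"
    if "x \<in> carrier_vec m" "i < m" for x i
    by (rule bidiagonal_mult_index[OF W that])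
      (auto simp: pencil_def const_mat_def jordan_block_def pCons_one)
  have "poly (x $ i) \<mu> = 0" if x: "x \<in> root_vectors ?W \<mu> k" and i: "i < m" "i \<notin> ?T" for x i
  proof -
    have xc: "x \<in> carrier_vec m" using x by (simp add: root_vectors_iff[OF W])
    have dvd: "?t ^ k dvd [:-a, 1:] * x $ i + (if Suc i < m then -1 * x $ Suc i else 0)"
      if "i < m" for i
      using x that unfolding mult[OF xc that, symmetric] by (simp add: root_vectors_iff[OF W])
    have val: "(\<mu> - a) * poly (x $ i) \<mu> = (if Suc i < m then poly (x $ Suc i) \<mu> else 0)"
      if "i < m" for i
    proof -
      have "?t dvd [:-a, 1:] * x $ i + (if Suc i < m then -1 * x $ Suc i else 0)"
        using dvd[OF that] k by (meson dvd_power dvd_trans)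
      then have "poly ([:-a, 1:] * x $ i + (if Suc i < m then -1 * x $ Suc i else 0)) \<mu> = 0"
        by (simp only: poly_eq_0_iff_dvd)
      then show ?thesis by (auto simp: algebra_simps split: if_splits)
    qed
    show ?thesis
    proof (cases "a = \<mu>")
      case False
      have "poly (x $ (m - 1 - l)) \<mu> = 0" if "l < m" for l
        using that
      proof (induction l)
        case 0
        then show ?case using val[of "m - 1"] False by auto
      next
        case (Suc l)
        have "Suc (m - 1 - Suc l) = m - 1 - l" using Suc.prems by simp
        then show ?case using Suc val[of "m - 1 - Suc l"] False by auto
      qed
      from this[of "m - 1 - i"] show ?thesis using i by simp
    next
      case True
      show ?thesis
      proof (cases i)
        case (Suc l)
        then show ?thesis using val[of l] i True by simp
      next
        case 0
        then have mk: "m < k" using i True by (auto split: if_splits)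
        define t where "t = ?t"
        have step: "t ^ k dvd t * x $ l - x $ Suc l" if "Suc l < m" for l
          using dvd[of l] that True by (simp add: t_def)
        have last: "t ^ k dvd t * x $ (m - 1)"
          using dvd[of "m - 1"] i True by (simp add: t_def)
        have t0: "t \<noteq> 0" by (simp add: t_def)
        have "t ^ k dvd t ^ l * x $ 0 - x $ l" if "l < m" for l
          using that
        proof (induction l)
          case 0
          then show ?case by simp
        next
          case (Suc l)
          have "t ^ k dvd t * (t ^ l * x $ 0 - x $ l) + (t * x $ l - x $ Suc l)"
            using Suc step by (intro dvd_add dvd_mult) auto
          then show ?case by (simp add: algebra_simps)
        qed
        then have "t ^ k dvd t * (t ^ (m - 1) * x $ 0 - x $ (m - 1)) + t * x $ (m - 1)"
          using i by (intro dvd_add[OF dvd_mult last]) simp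
        also have "\<dots> = t * t ^ (m - 1) * x $ 0" by (simp add: algebra_simps)
        also have "t * t ^ (m - 1) = t ^ m" using i by (simp add: power_eq_if)
        also have "t ^ k = t ^ m * t ^ (k - m)" using mk by (simp flip: power_add)
        finally have "t ^ (k - m) dvd x $ 0" using t0 by simp
        then have "t dvd x $ 0" using mk by (meson dvd_power dvd_trans zero_less_diff)
        then have "?t dvd x $ 0" by (simp only: t_def)
        then show ?thesis using 0 by (simp only: poly_eq_0_iff_dvd)
      qed
    qed
  qed
  moreover have "\<exists>x\<in>root_vectors ?W \<mu> k. \<forall>i\<in>?T. poly (x $ i) \<mu> = (if i = \<tau> then 1 else 0)"
    if "\<tau> \<in> ?T" for \<tau>
  proof -
    have am: "a = \<mu>" "k \<le> m" "0 < m" "\<tau> = 0" using that by (auto split: if_splits)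
    define x where "x = vec m (\<lambda>i. ?t ^ i)"
    have xc: "x \<in> carrier_vec m" by (simp add: x_def)
    have "?t ^ k dvd (?W *\<^sub>v x) $ i" if "i < m" for i
    proof (cases "Suc i < m")
      case True
      then have "(?W *\<^sub>v x) $ i = 0" unfolding mult[OF xc that] using am by (simp add: x_def)
      then show ?thesis by simp
    next
      case False
      then have "(?W *\<^sub>v x) $ i = ?t * ?t ^ i" unfolding mult[OF xc that]
        using am that by (simp add: x_def)
      also have "\<dots> = ?t ^ m" using False that by (metis Suc_lessI power_Suc)
      finally show ?thesis using am by (simp only: le_imp_power_dvd)
    qed
    then have "x \<in> root_vectors ?W \<mu> k" using xc by (simp add: root_vectors_iff[OF W])
    then show ?thesis using am by (intro bexI[of _ x]) (auto simp: x_def)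
  qed
  ultimately show ?thesis unfolding root_support_def carrier_matD[OF W] by auto
qed

lemma root_support_nilpotent_pencil_block:
  assumes k: "0 < k"
  shows "root_support (pencil (- 1\<^sub>m m) (jordan_block m 0)) \<mu> k {}" (is "root_support ?W \<mu> k _")
proof -
  have W: "?W \<in> carrier_mat m m" by simp
  have mult: "(?W *\<^sub>v x) $ i = -1 * x $ i + (if Suc i < m then [:0, 1:] * x $ Suc i else 0)"
    if "x \<in> carrier_vec m" "i < m" for x i
    by (rule bidiagonal_mult_index[OF W that])
      (auto simp: pencil_def const_mat_def jordan_block_def pCons_one)
  have "poly (x $ i) \<mu> = 0" if x: "x \<in> root_vectors ?W \<mu> k" and i: "i < m" for x i
  proof -
    have xc: "x \<in> carrier_vec m" using x by (simp add: root_vectors_iff[OF W])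
    have val: "poly (x $ i) \<mu> = (if Suc i < m then \<mu> * poly (x $ Suc i) \<mu> else 0)"
      if "i < m" for i
    proof -
      have "[:-\<mu>, 1:] ^ k dvd -1 * x $ i + (if Suc i < m then [:0, 1:] * x $ Suc i else 0)"
        using x that unfolding mult[OF xc that, symmetric] by (simp add: root_vectors_iff[OF W])
      then have "[:-\<mu>, 1:] dvd -1 * x $ i + (if Suc i < m then [:0, 1:] * x $ Suc i else 0)"
        using k by (meson dvd_power dvd_trans)
      then have "poly (-1 * x $ i + (if Suc i < m then [:0, 1:] * x $ Suc i else 0)) \<mu> = 0"
        by (simp only: poly_eq_0_iff_dvd)
      then show ?thesis by (auto split: if_splits)
    qed
    have "poly (x $ (m - 1 - l)) \<mu> = 0" if "l < m" for l
      using that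
    proof (induction l)
      case 0
      then show ?case using val[of "m - 1"] by auto
    next
      case (Suc l)
      have "Suc (m - 1 - Suc l) = m - 1 - l" using Suc.prems by simp
      then show ?case using Suc val[of "m - 1 - Suc l"] by auto
    qed
    from this[of "m - 1 - i"] show ?thesis using i by simp
  qed
  then show ?thesis unfolding root_support_def carrier_matD[OF W] by auto
qed

lemma uminus_four_block_diag:
  "A \<in> carrier_mat n n \<Longrightarrow> B \<in> carrier_mat m m \<Longrightarrow>
    - four_block_mat A (0\<^sub>m n m) (0\<^sub>m m n) B =
    four_block_mat (- A :: 'a :: ring_1 mat) (0\<^sub>m n m) (0\<^sub>m m n) (- B)"
  by (intro eq_matI) auto

lemma root_support_jordan_pencil:
  assumes k: "0 < k" and pos: "0 \<notin> fst ` set js"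
  shows "\<exists>T. root_support (pencil (- jordan_matrix js) (1\<^sub>m (sum_list (map fst js)))) \<mu> k T \<and>
    card T = length (filter (\<lambda>(m, a). a = \<mu> \<and> k \<le> m) js)"
  using pos
proof (induction js)
  case Nil
  then show ?case by (auto simp: root_support_def jordan_matrix_def pencil_def)
next
  case (Cons na js)
  obtain m a where na: "na = (m, a)" by force
  let ?n = "sum_list (map fst js)"
  obtain T where T: "root_support (pencil (- jordan_matrix js) (1\<^sub>m ?n)) \<mu> k T"
    and card: "card T = length (filter (\<lambda>(m, a). a = \<mu> \<and> k \<le> m) js)"
    using Cons by auto
  define T0 where "T0 = (if a = \<mu> \<and> k \<le> m \<and> 0 < m then {0 :: nat} else {})"
  have T0: "root_support (pencil (- jordan_block m a) (1\<^sub>m m)) \<mu> k T0"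
    unfolding T0_def by (rule root_support_jordan_pencil_block[OF k])
  have eq: "pencil (- jordan_matrix (na # js)) (1\<^sub>m (sum_list (map fst (na # js)))) =
    four_block_mat (pencil (- jordan_block m a) (1\<^sub>m m)) (0\<^sub>m m ?n) (0\<^sub>m ?n m)
      (pencil (- jordan_matrix js) (1\<^sub>m ?n))"
    unfolding na jordan_matrix_Cons
    by (subst pencil_four_block_diag[symmetric]) (auto simp: uminus_four_block_diag)
  have disj: "T0 \<inter> (+) m ` T = {}" by (auto simp: T0_def)
  have finT: "finite T" using T by (auto simp: root_support_def intro: finite_subset[OF _ finite_lessThan])
  have "card (T0 \<union> (+) m ` T) = card T0 + card T"
    using disj finT by (subst card_Un_disjoint) (auto simp: T0_def card_image)
  moreover have "root_support (pencil (- jordan_matrix (na # js)) (1\<^sub>m (sum_list (map fst (na # js))))) \<mu> k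
      (T0 \<union> (+) m ` T)"
    unfolding eq by (rule root_support_four_block_diag[OF _ _ T0 T]) auto
  ultimately show ?case using card Cons.prems by (intro exI[of _ "T0 \<union> (+) m ` T"]) (auto simp: T0_def na)
qed

lemma jordan_matrix_zeros_carrier:
  "jordan_matrix (map (\<lambda>k. (k, 0 :: complex)) ks) \<in> carrier_mat (sum_list ks) (sum_list ks)"
  by (rule carrier_matI) (simp_all add: comp_def)

lemma root_support_nilpotent_pencil:
  assumes k: "0 < k"
  shows "root_support (pencil (- 1\<^sub>m (sum_list ks)) (jordan_matrix (map (\<lambda>k. (k, 0)) ks))) \<mu> k {}"
proof (induction ks)
  case Nil
  then show ?case by (auto simp: root_support_def jordan_matrix_def pencil_def)
next
  case (Cons m ks)
  let ?n = "sum_list ks"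
  have [simp]: "sum_list (map (fst \<circ> (\<lambda>k :: nat. (k, 0 :: complex))) ks) = ?n"
    by (simp add: comp_def)
  have J: "jordan_matrix (map (\<lambda>k. (k, 0 :: complex)) (m # ks)) =
    four_block_mat (jordan_block m 0) (0\<^sub>m m ?n) (0\<^sub>m ?n m) (jordan_matrix (map (\<lambda>k. (k, 0)) ks))"
    by (simp add: jordan_matrix_Cons)
  note Jc = jordan_matrix_zeros_carrier[of ks]
  have I: "- 1\<^sub>m (sum_list (m # ks)) =
    four_block_mat (- 1\<^sub>m m) (0\<^sub>m m ?n) (0\<^sub>m ?n m) (- (1\<^sub>m ?n :: complex mat))"
    by (intro eq_matI) auto
  have eq: "pencil (- 1\<^sub>m (sum_list (m # ks))) (jordan_matrix (map (\<lambda>k. (k, 0)) (m # ks))) =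
    four_block_mat (pencil (- 1\<^sub>m m) (jordan_block m 0)) (0\<^sub>m m ?n) (0\<^sub>m ?n m)
      (pencil (- 1\<^sub>m ?n) (jordan_matrix (map (\<lambda>k. (k, 0)) ks)))"
    unfolding J I by (rule pencil_four_block_diag) (use Jc in auto)
  have "root_support (pencil (- 1\<^sub>m (sum_list (m # ks))) (jordan_matrix (map (\<lambda>k. (k, 0)) (m # ks)))) \<mu> k
      ({} \<union> (+) m ` {})"
    unfolding eq
    by (rule root_support_four_block_diag[OF _ _ root_support_nilpotent_pencil_block[OF k] Cons])
      (use Jc in auto)
  then show ?case by simp
qed

lemma weierstrass_blocks_carrier:
  "pencil (- jordan_matrix js) (1\<^sub>m (sum_list (map fst js))) \<in>
    carrier_mat (sum_list (map fst js)) (sum_list (map fst js))"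
  "pencil (- 1\<^sub>m (sum_list ks)) (jordan_matrix (map (\<lambda>k. (k, 0)) ks)) \<in>
    carrier_mat (sum_list ks) (sum_list ks)"
  using jordan_matrix_zeros_carrier[of ks] by auto

lemma weierstrass_mat_blocks:
  "weierstrass_mat js ks =
    four_block_mat (pencil (- jordan_matrix js) (1\<^sub>m (sum_list (map fst js))))
      (0\<^sub>m (sum_list (map fst js)) (sum_list ks)) (0\<^sub>m (sum_list ks) (sum_list (map fst js)))
      (pencil (- 1\<^sub>m (sum_list ks)) (jordan_matrix (map (\<lambda>k. (k, 0)) ks)))"
  unfolding weierstrass_mat_def Let_def carrier_matD(1)[OF jordan_matrix_zeros_carrier]
    jordan_matrix_dim(1)[of js]
  by (rule pencil_four_block_diag) (use jordan_matrix_zeros_carrier[of ks] in auto)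

lemma root_frame_weierstrass_mat:
  assumes k: "0 < k" and pos: "0 \<notin> fst ` set js"
  shows "root_frame (weierstrass_mat js ks) \<mu> k d \<longleftrightarrow>
    d \<le> length (filter (\<lambda>(m, a). a = \<mu> \<and> k \<le> m) js)"
proof -
  obtain T where T: "root_support (pencil (- jordan_matrix js) (1\<^sub>m (sum_list (map fst js)))) \<mu> k T"
    and card: "card T = length (filter (\<lambda>(m, a). a = \<mu> \<and> k \<le> m) js)"
    using root_support_jordan_pencil[OF k pos] by blast
  have "root_support (weierstrass_mat js ks) \<mu> k (T \<union> (+) (sum_list (map fst js)) ` {})"
    unfolding weierstrass_mat_blocks
    by (rule root_support_four_block_diag[OF weierstrass_blocks_carrier T
          root_support_nilpotent_pencil[OF k]])
  moreover have "weierstrass_mat js ks \<in> carrier_mat (sum_list (map fst js) + sum_list ks)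
      (sum_list (map fst js) + sum_list ks)"
    unfolding weierstrass_mat_blocks using weierstrass_blocks_carrier by (intro four_block_carrier_mat)
  ultimately show ?thesis using root_frame_iff_le_card card by auto
qed

lemma order_linear_power:
  "order \<mu> ([:-a, 1:] ^ m) = (if a = \<mu> then m else (0 :: nat))" for a \<mu> :: complex
proof (cases "a = \<mu>")
  case True
  then show ?thesis using order_power_n_n[of \<mu> m] by simp
next
  case False
  then have "poly ([:-a, 1:] ^ m) \<mu> \<noteq> 0" by (simp add: poly_power)
  then show ?thesis using False by (simp add: order_0I)
qed

lemma det_weierstrass_mat:
  "\<exists>c\<noteq>0. det (weierstrass_mat js ks) = Polynomial.smult c (\<Prod>(m, a)\<leftarrow>js. [:-a, 1:] ^ m)"
proof -
  let ?J = "pencil (- jordan_matrix js) (1\<^sub>m (sum_list (map fst js)))"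
  let ?N = "pencil (- 1\<^sub>m (sum_list ks)) (jordan_matrix (map (\<lambda>k. (k, 0 :: complex)) ks))"
  have sum [simp]: "sum_list (map (fst \<circ> (\<lambda>k :: nat. (k, 0 :: complex))) ks) = sum_list ks"
    by (simp add: comp_def)
  have "?J = char_poly_matrix (jordan_matrix js)"
    unfolding char_poly_matrix_def pencil_def const_mat_def
    by (intro eq_matI) (auto simp: pCons_one)
  then have J: "det ?J = (\<Prod>(m, a)\<leftarrow>js. [:-a, 1:] ^ m)"
    using jordan_matrix_char_poly[of js] by (simp add: char_poly_def)
  have nilp: "jordan_matrix (map (\<lambda>k. (k, 0 :: complex)) ks) $$ (i, i) = 0" if "i < sum_list ks" for i
    using that
  proof (induction ks arbitrary: i)
    case (Cons m ks)
    have [simp]: "sum_list (map (fst \<circ> (\<lambda>k :: nat. (k, 0 :: complex))) ks) = sum_list ks"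
      by (simp add: comp_def)
    show ?case using Cons by (auto simp: jordan_matrix_Cons)
  qed simp
  have diag: "?N $$ (i, i) = -1" if "i < sum_list ks" for i
    using that nilp[OF that] by (auto simp: pencil_def const_mat_def pCons_one)
  have "upper_triangular ?N"
    using jordan_matrix_upper_triangular[of _ "map (\<lambda>k. (k, 0 :: complex)) ks"]
    by (auto simp: upper_triangular_def pencil_def const_mat_def)
  then have "det ?N = prod_list (diag_mat ?N)"
    by (rule det_upper_triangular[OF _ weierstrass_blocks_carrier(2)])
  also have "diag_mat ?N = map (\<lambda>_. -1) [0..<sum_list ks]"
    unfolding diag_mat_def using weierstrass_blocks_carrier(2)[of ks] diag by auto
  also have "prod_list \<dots> = (-1) ^ sum_list ks" by (simp add: map_replicate_const)
  finally have N: "det ?N = (-1) ^ sum_list ks" .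
  have "det (weierstrass_mat js ks) = det ?J * det ?N"
    unfolding weierstrass_mat_blocks
    by (rule det_four_block_mat_upper_right_zero[OF weierstrass_blocks_carrier(1) refl _
          weierstrass_blocks_carrier(2)]) auto
  also have "\<dots> = Polynomial.smult ((-1) ^ sum_list ks) (\<Prod>(m, a)\<leftarrow>js. [:-a, 1:] ^ m)"
    unfolding J N by (cases "even (sum_list ks)") auto
  finally show ?thesis by (intro exI[of _ "(-1) ^ sum_list ks"]) auto
qed

lemma order_prod_linear_powers:
  fixes js :: "(nat \<times> complex) list"
  shows "(\<Prod>(m, a)\<leftarrow>js. [:-a, 1:] ^ m) \<noteq> 0"
    "order \<mu> (\<Prod>(m, a)\<leftarrow>js. [:-a, 1:] ^ m) = sum_list (map fst (filter (\<lambda>(m, a). a = \<mu>) js))"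
proof (induction js)
  case (Cons na js)
  obtain m a where na: "na = (m, a)" by force
  have nz: "[:-a, 1:] ^ m * (\<Prod>(m, a)\<leftarrow>js. [:-a, 1:] ^ m) \<noteq> 0" using Cons(1) by simp
  show "(\<Prod>(m, a)\<leftarrow>na # js. [:-a, 1:] ^ m) \<noteq> 0" using nz by (simp add: na)
  show "order \<mu> (\<Prod>(m, a)\<leftarrow>na # js. [:-a, 1:] ^ m) =
      sum_list (map fst (filter (\<lambda>(m, a). a = \<mu>) (na # js)))"
    using order_mult[OF nz] Cons(2) order_linear_power[of \<mu> a m] by (simp add: na)
qed auto

lemma invertible_mat_obtain_inverse:
  fixes P :: "complex mat"
  assumes "P \<in> carrier_mat n n" "invertible_mat P"
  obtains P' where "P' \<in> carrier_mat n n" "P * P' = 1\<^sub>m n" "P' * P = 1\<^sub>m n"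
proof -
  obtain B where B: "P * B = 1\<^sub>m (dim_row P)" "B * P = 1\<^sub>m (dim_row B)"
    using assms(2) by (auto simp: invertible_mat_def inverts_mat_def)
  have "dim_col B = n" using arg_cong[OF B(1), of dim_col] assms(1) by simp
  moreover have "dim_row B = n" using arg_cong[OF B(2), of dim_col] assms(1) by simp
  ultimately show ?thesis using that[of B] B assms(1) by auto
qed

lemma invertible_mat_det:
  fixes P :: "complex mat"
  assumes "P \<in> carrier_mat n n" "invertible_mat P"
  shows "det P \<noteq> 0"
proof -
  obtain P' where P': "P' \<in> carrier_mat n n" "P * P' = 1\<^sub>m n"
    using invertible_mat_obtain_inverse[OF assms] by blast
  then have "det P * det P' = 1" using det_mult[OF assms(1) P'(1)] by simp
  then show ?thesis by auto
qed

lemma length_filter_block_sizes: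
  "length (filter (\<lambda>m. k \<le> m) (map fst (filter (\<lambda>(m, a). a = \<mu>) js))) =
    length (filter (\<lambda>(m, a). a = \<mu> \<and> k \<le> (m :: nat)) js)"
  by (induction js) auto

lemma length_filter_rev_sort:
  "length (filter P (rev (sort xs))) = length (filter P (xs :: nat list))"
  by (metis mset_filter mset_rev mset_sort size_mset)

text \<open>Strict equivalence changes the determinant by a nonzero constant and transports root frames, so all
these data can be read off the canonical form. In particular the list \<open>ms\<close> is determined by \<open>L\<close>
and \<open>\<mu>\<close>.\<close>

lemma finite_partial_multiplicities_profile:
  assumes L: "L \<in> carrier_mat n n" and ms: "finite_partial_multiplicities L \<mu> ms"
  shows "sorted (rev ms)" "0 \<notin> set ms" "det L \<noteq> 0" "order \<mu> (det L) = sum_list ms"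
    "0 < k \<Longrightarrow> root_frame L \<mu> k d \<longleftrightarrow> d \<le> length (filter (\<lambda>m. k \<le> m) ms)"
proof -
  obtain js ks P Q where pos: "0 \<notin> fst ` set js"
    and P: "P \<in> carrier_mat n n" "invertible_mat P"
    and Q: "Q \<in> carrier_mat n n" "invertible_mat Q"
    and eq: "const_mat P * L * const_mat Q = weierstrass_mat js ks"
    and ms_eq: "ms = rev (sort (map fst (filter (\<lambda>(k, a). a = \<mu>) js)))"
    using ms L unfolding finite_partial_multiplicities_def weierstrass_form_def by auto
  show "sorted (rev ms)" by (simp add: ms_eq)
  show "0 \<notin> set ms" using pos by (force simp: ms_eq)
  obtain c where c: "c \<noteq> 0"
    "det (weierstrass_mat js ks) = Polynomial.smult c (\<Prod>(m, a)\<leftarrow>js. [:-a, 1:] ^ m)"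
    using det_weierstrass_mat by blast
  have "det (const_mat P * L * const_mat Q) = [:det P:] * det L * [:det Q:]"
    using P Q L by (simp add: det_mult[of _ n] det_const_mat)
  then have det: "Polynomial.smult (det P * det Q) (det L) =
      Polynomial.smult c (\<Prod>(m, a)\<leftarrow>js. [:-a, 1:] ^ m)"
    using eq c by (simp add: mult_ac)
  have nz: "det P * det Q \<noteq> 0" using invertible_mat_det P Q by auto
  then show "det L \<noteq> 0" using det c order_prod_linear_powers(1)[of js] by auto
  have "order \<mu> (det L) = order \<mu> (\<Prod>(m, a)\<leftarrow>js. [:-a, 1:] ^ m)"
    using arg_cong[OF det, of "order \<mu>"] nz c by (simp add: order_smult)
  also have "\<dots> = sum_list (map fst (filter (\<lambda>(m, a). a = \<mu>) js))"
    by (rule order_prod_linear_powers(2))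
  also have "\<dots> = sum_list ms" unfolding ms_eq by (metis mset_rev mset_sort sum_mset_sum_list)
  finally show "order \<mu> (det L) = sum_list ms" .
  show "root_frame L \<mu> k d \<longleftrightarrow> d \<le> length (filter (\<lambda>m. k \<le> m) ms)" if k: "0 < k"
  proof -
    obtain P' where P': "P' \<in> carrier_mat n n" "P * P' = 1\<^sub>m n" "P' * P = 1\<^sub>m n"
      using invertible_mat_obtain_inverse[OF P] by blast
    obtain Q' where Q': "Q' \<in> carrier_mat n n" "Q * Q' = 1\<^sub>m n" "Q' * Q = 1\<^sub>m n"
      using invertible_mat_obtain_inverse[OF Q] by blast
    have W: "weierstrass_mat js ks \<in> carrier_mat n n" unfolding eq[symmetric] using P Q L by simp
    have PP: "const_mat P' * const_mat P = 1\<^sub>m n" "const_mat Q * const_mat Q' = 1\<^sub>m n"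
      using P P' Q Q' const_mat_mult[of P' n n P n] const_mat_mult[of Q n n Q' n] by auto
    have "const_mat P' * weierstrass_mat js ks * const_mat Q' =
        const_mat P' * const_mat P * (L * (const_mat Q * const_mat Q'))"
      unfolding eq[symmetric] using P P' Q Q' L by (simp add: mat_mult_assoc)
    also have "\<dots> = L" unfolding PP using L by simp
    finally have L_eq: "const_mat P' * weierstrass_mat js ks * const_mat Q' = L" .
    have "root_frame L \<mu> k d \<longleftrightarrow> root_frame (weierstrass_mat js ks) \<mu> k d"
      using root_frame_equivalence[OF L P(1) Q(1) Q'(1,2), of \<mu> k d]
        root_frame_equivalence[OF W P'(1) Q'(1) Q(1) Q'(3), of \<mu> k d] eq L_eq by auto
    then show ?thesis
      unfolding root_frame_weierstrass_mat[OF k pos] ms_eq length_filter_rev_sort length_filter_block_sizes .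
  qed
qed

section \<open>Existence of the Weierstrass form\<close>

declare minus_carrier_mat [simp]

lemma const_mult_pencil:
  assumes "A \<in> carrier_mat n n" "B \<in> carrier_mat n n" "P \<in> carrier_mat n n" "Q \<in> carrier_mat n n"
  shows "const_mat P * pencil A B * const_mat Q = pencil (P * A * Q) (P * B * Q)"
proof -
  have "const_mat P * pencil A B = const_mat (P * A) + [:0, 1:] \<cdot>\<^sub>m const_mat (P * B)"
    unfolding pencil_def using assms
    by (simp add: mult_add_distrib_mat[of _ n n] mult_smult_distrib[where nr=n and n=n and nc=n] const_mat_mult[of _ n n _ n])
  then show ?thesis
    unfolding pencil_def using assms
    by (simp add: add_mult_distrib_mat[of _ n n] mult_smult_assoc_mat[where nr=n and n=n and nc=n] const_mat_mult[of _ n n _ n])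
qed

lemma eval_mat_pencil:
  "A \<in> carrier_mat n n \<Longrightarrow> B \<in> carrier_mat n n \<Longrightarrow> eval_mat \<mu> (pencil A B) = A + \<mu> \<cdot>\<^sub>m B"
  by (intro eq_matI) (auto simp: pencil_def)

lemma invertible_matI:
  fixes P :: "complex mat"
  assumes "P \<in> carrier_mat n n" "P' \<in> carrier_mat n n" "P * P' = 1\<^sub>m n"
  shows "invertible_mat P"
  using assms mat_mult_left_right_inverse[OF assms]
  unfolding invertible_mat_def inverts_mat_def by auto

lemma det_nonzero_obtain_inverse:
  fixes P :: "complex mat"
  assumes P: "P \<in> carrier_mat n n" and "det P \<noteq> 0"
  obtains P' where "P' \<in> carrier_mat n n" "P * P' = 1\<^sub>m n" "P' * P = 1\<^sub>m n"
proof -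
  define P' where "P' = (1 / det P) \<cdot>\<^sub>m adj_mat P"
  have P': "P' \<in> carrier_mat n n" using adj_mat(1)[OF P] by (simp add: P'_def)
  have "P * P' = (1 / det P) \<cdot>\<^sub>m (P * adj_mat P)"
    unfolding P'_def using P adj_mat(1)[OF P] by (simp add: mult_smult_distrib[where nr=n and n=n and nc=n])
  also have "\<dots> = 1\<^sub>m n" unfolding adj_mat(2)[OF P] using assms(2) by (intro eq_matI) auto
  finally have "P * P' = 1\<^sub>m n" .
  then show ?thesis using that[OF P'] mat_mult_left_right_inverse[OF P P'] by blast
qed

abbreviation block_diag :: "'a :: zero mat \<Rightarrow> 'a mat \<Rightarrow> 'a mat" where
  "block_diag X Y \<equiv> four_block_mat X (0\<^sub>m (dim_row X) (dim_col Y)) (0\<^sub>m (dim_row Y) (dim_col X)) Y"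

lemma block_diag_mult:
  fixes X1 :: "'a :: semiring_1 mat"
  assumes "X1 \<in> carrier_mat n n" "X2 \<in> carrier_mat n n" "Y1 \<in> carrier_mat m m" "Y2 \<in> carrier_mat m m"
  shows "block_diag X1 Y1 * block_diag X2 Y2 = block_diag (X1 * X2) (Y1 * Y2)"
  using assms by (subst mult_four_block_mat[of _ n n _ m _ m]) auto

lemma block_diag_one: "block_diag (1\<^sub>m n) (1\<^sub>m m) = 1\<^sub>m (n + m)"
  by (intro eq_matI) auto

lemma similar_block_diag_commute:
  fixes X Y :: "'a :: comm_ring_1 mat"
  assumes X: "X \<in> carrier_mat n n" and Y: "Y \<in> carrier_mat m m"
  shows "similar_mat (block_diag X Y) (block_diag Y X)"
proof -
  define P Q :: "'a mat" where "P = four_block_mat (0\<^sub>m n m) (1\<^sub>m n) (1\<^sub>m m) (0\<^sub>m m n)"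
    and "Q = four_block_mat (0\<^sub>m m n) (1\<^sub>m m) (1\<^sub>m n) (0\<^sub>m n m)"
  let ?XY = "four_block_mat X (0\<^sub>m n m) (0\<^sub>m m n) Y" and ?YX = "four_block_mat Y (0\<^sub>m m n) (0\<^sub>m n m) X"
  have P: "P \<in> carrier_mat (n + m) (n + m)" and Q: "Q \<in> carrier_mat (n + m) (n + m)"
    by (intro carrier_matI; simp add: P_def Q_def)+
  have "P * Q = four_block_mat (0\<^sub>m n m * 0\<^sub>m m n + 1\<^sub>m n * 1\<^sub>m n) (0\<^sub>m n m * 1\<^sub>m m + 1\<^sub>m n * 0\<^sub>m n m)
      (1\<^sub>m m * 0\<^sub>m m n + 0\<^sub>m m n * 1\<^sub>m n) (1\<^sub>m m * 1\<^sub>m m + 0\<^sub>m m n * 0\<^sub>m n m)"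
    unfolding P_def Q_def by (rule mult_four_block_mat) (rule one_carrier_mat zero_carrier_mat)+
  then have PQ: "P * Q = 1\<^sub>m (n + m)" by simp
  have "Q * P = four_block_mat (0\<^sub>m m n * 0\<^sub>m n m + 1\<^sub>m m * 1\<^sub>m m) (0\<^sub>m m n * 1\<^sub>m n + 1\<^sub>m m * 0\<^sub>m m n)
      (1\<^sub>m n * 0\<^sub>m n m + 0\<^sub>m n m * 1\<^sub>m m) (1\<^sub>m n * 1\<^sub>m n + 0\<^sub>m n m * 0\<^sub>m m n)"
    unfolding P_def Q_def by (rule mult_four_block_mat) (rule one_carrier_mat zero_carrier_mat)+
  then have QP: "Q * P = 1\<^sub>m (m + n)" by simp
  have "P * ?YX = four_block_mat (0\<^sub>m n m * Y + 1\<^sub>m n * 0\<^sub>m n m) (0\<^sub>m n m * 0\<^sub>m m n + 1\<^sub>m n * X)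
      (1\<^sub>m m * Y + 0\<^sub>m m n * 0\<^sub>m n m) (1\<^sub>m m * 0\<^sub>m m n + 0\<^sub>m m n * X)"
    unfolding P_def by (rule mult_four_block_mat) (rule one_carrier_mat zero_carrier_mat X Y)+
  also have "\<dots> = four_block_mat (0\<^sub>m n m) X Y (0\<^sub>m m n)"
    using X Y by simp
  also have "\<dots> * Q = four_block_mat (0\<^sub>m n m * 0\<^sub>m m n + X * 1\<^sub>m n) (0\<^sub>m n m * 1\<^sub>m m + X * 0\<^sub>m n m)
      (Y * 0\<^sub>m m n + 0\<^sub>m m n * 1\<^sub>m n) (Y * 1\<^sub>m m + 0\<^sub>m m n * 0\<^sub>m n m)"
    unfolding Q_def by (rule mult_four_block_mat) (rule one_carrier_mat zero_carrier_mat X Y)+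
  also have "\<dots> = ?XY" using X Y by simp
  finally have eq: "?XY = P * ?YX * Q" ..
  have c: "?XY \<in> carrier_mat (n + m) (n + m)" "?YX \<in> carrier_mat (n + m) (n + m)"
    by (intro carrier_matI; use X Y in simp)+
  have "similar_mat_wit ?XY ?YX P Q"
    by (rule similar_mat_witI[OF PQ _ eq c P Q]) (simp add: QP add.commute)
  then have "similar_mat ?XY ?YX" unfolding similar_mat_def by blast
  then show ?thesis using X Y by simp
qed

lemma jordan_matrix_Cons_block_diag:
  "jordan_matrix ((m, a) # js) = block_diag (jordan_block m a) (jordan_matrix js)"
  by (simp add: jordan_matrix_Cons)

text \<open>Blocks of a Jordan matrix can be reordered by similarity; sorting them by whether the eigenvalue is zero
splits a matrix into an invertible and a nilpotent part.\<close>

lemma similar_jordan_matrix_partition: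
  fixes js :: "(nat \<times> 'a :: comm_ring_1) list"
  shows "similar_mat (jordan_matrix js)
    (block_diag (jordan_matrix (filter R js)) (jordan_matrix (filter (\<lambda>x. \<not> R x) js)))"
proof (induction js)
  case Nil
  have "jordan_matrix [] = (0\<^sub>m 0 0 :: 'a mat)" by (simp add: jordan_matrix_def)
  moreover have "block_diag (0\<^sub>m 0 0) (0\<^sub>m 0 0) = (0\<^sub>m 0 0 :: 'a mat)" by (intro eq_matI) auto
  ultimately show ?case by (auto intro!: similar_mat_refl)
next
  case (Cons x js)
  obtain m a where x: "x = (m, a)" by force
  let ?B = "jordan_block m a"
  let ?X = "jordan_matrix (filter R js)" and ?Y = "jordan_matrix (filter (\<lambda>x. \<not> R x) js)"
  let ?n = "sum_list (map fst (filter R js))" and ?l = "sum_list (map fst (filter (\<lambda>x. \<not> R x) js))"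
  have len: "sum_list (map fst js) = ?n + ?l" by (induction js) auto
  have X: "?X \<in> carrier_mat ?n ?n" and Y: "?Y \<in> carrier_mat ?l ?l" by auto
  have XY: "block_diag ?X ?Y \<in> carrier_mat (?n + ?l) (?n + ?l)" by auto
  have Jc: "jordan_matrix js \<in> carrier_mat (?n + ?l) (?n + ?l)" by (rule carrier_matI) (simp_all add: len)
  have "similar_mat (block_diag ?B (jordan_matrix js)) (block_diag ?B (block_diag ?X ?Y))"
    using similar_mat_four_block_0_0[OF similar_mat_refl[OF jordan_block_carrier] Cons jordan_block_carrier Jc]
    by (simp add: len)
  also have "block_diag ?B (block_diag ?X ?Y) = block_diag (block_diag ?B ?X) ?Y"
    by (rule assoc_four_block_mat)
  finally have sim: "similar_mat (jordan_matrix (x # js)) (block_diag (block_diag ?B ?X) ?Y)"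
    unfolding x jordan_matrix_Cons_block_diag .
  show ?case
  proof (cases "R x")
    case True
    then show ?thesis using sim by (simp add: x jordan_matrix_Cons_block_diag)
  next
    case False
    have "similar_mat (block_diag (block_diag ?B ?X) ?Y) (block_diag (block_diag ?X ?B) ?Y)"
    proof -
      have "block_diag ?B ?X \<in> carrier_mat (m + ?n) (m + ?n)" by auto
      from similar_mat_four_block_0_0[OF similar_block_diag_commute[OF jordan_block_carrier X]
          similar_mat_refl[OF Y] this Y]
      show ?thesis by (simp add: add.commute)
    qed
    also have "block_diag (block_diag ?X ?B) ?Y = block_diag ?X (block_diag ?B ?Y)"
      by (rule assoc_four_block_mat[symmetric])
    finally have "similar_mat (jordan_matrix (x # js)) (block_diag ?X (block_diag ?B ?Y))"
      using sim similar_mat_trans by blast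
    then show ?thesis using False by (simp add: x jordan_matrix_Cons_block_diag)
  qed
qed

lemma pencil_uminus_one_eq_char_poly_matrix:
  "M \<in> carrier_mat n n \<Longrightarrow> pencil (- M) (1\<^sub>m n) = char_poly_matrix M"
  unfolding char_poly_matrix_def pencil_def const_mat_def by (intro eq_matI) auto

lemma poly_char_poly_eq_det:
  fixes M :: "complex mat"
  assumes M: "M \<in> carrier_mat n n"
  shows "poly (char_poly M) a = det (a \<cdot>\<^sub>m 1\<^sub>m n - M)"
proof -
  have "a \<cdot>\<^sub>m 1\<^sub>m n - M = eval_mat a (pencil (- M) (1\<^sub>m n))"
    using M by (subst eval_mat_pencil) auto
  then show ?thesis
    using M by (simp add: det_eval_mat pencil_uminus_one_eq_char_poly_matrix char_poly_def)
qed

lemma det_affine_nilpotent_jordan: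
  assumes zero: "\<And>m a. (m, a) \<in> set js \<Longrightarrow> a = 0"
  shows "det (a \<cdot>\<^sub>m 1\<^sub>m (sum_list (map fst js)) + c \<cdot>\<^sub>m jordan_matrix js) = (a :: complex) ^ sum_list (map fst js)"
proof -
  let ?n = "sum_list (map fst js)"
  let ?M = "a \<cdot>\<^sub>m 1\<^sub>m ?n + c \<cdot>\<^sub>m jordan_matrix js"
  have diag: "jordan_matrix js $$ (i, i) = 0" if "i < ?n" for i
    using zero that
  proof (induction js arbitrary: i)
    case (Cons x js)
    have "jordan_matrix js $$ (i, i) = 0" if "i < sum_list (map fst js)" for i
      by (rule Cons.IH[OF _ that]) (use Cons.prems(1) in auto)
    moreover have "snd x = 0" using Cons.prems(1)[of "fst x" "snd x"] by simp
    ultimately show ?case using Cons.prems(2) by (cases x) (auto simp: jordan_matrix_Cons)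
  qed simp
  have M: "?M \<in> carrier_mat ?n ?n" by simp
  have "upper_triangular ?M"
    using jordan_matrix_upper_triangular[of _ js] by (auto simp: upper_triangular_def)
  then have "det ?M = prod_list (diag_mat ?M)" by (rule det_upper_triangular[OF _ M])
  also have "diag_mat ?M = map (\<lambda>_. a) [0..<?n]"
    unfolding diag_mat_def using diag by auto
  finally show ?thesis by (simp add: map_replicate_const)
qed

lemma jordan_matrix_nonzero_det:
  assumes "\<And>m a. (m, a) \<in> set js \<Longrightarrow> a \<noteq> (0 :: complex)"
  shows "det (jordan_matrix js) \<noteq> 0"
proof -
  have "poly (char_poly (jordan_matrix js)) 0 \<noteq> 0"
    unfolding jordan_matrix_char_poly using assms
  proof (induction js)
    case (Cons x js)
    have "poly (\<Prod>(m, a)\<leftarrow>js. [:-a, 1:] ^ m) 0 \<noteq> 0"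
      by (rule Cons.IH) (use Cons.prems in auto)
    moreover have "snd x \<noteq> 0" using Cons.prems[of "fst x" "snd x"] by simp
    ultimately show ?case by (cases x) (auto simp: poly_power)
  qed simp
  moreover have "0 \<cdot>\<^sub>m 1\<^sub>m (sum_list (map fst js)) - jordan_matrix js = - jordan_matrix js"
    by (intro eq_matI) auto
  ultimately have "det (- jordan_matrix js) \<noteq> 0"
    using poly_char_poly_eq_det[of "jordan_matrix js" "sum_list (map fst js)" 0] by simp
  then show ?thesis using det_0_negate[of "jordan_matrix js" "sum_list (map fst js)"] by simp
qed

lemma jordan_nf_complex_obtain:
  fixes M :: "complex mat"
  assumes M: "M \<in> carrier_mat n n"
  obtains js S T where "0 \<notin> fst ` set js" "sum_list (map fst js) = n"
    "S \<in> carrier_mat n n" "T \<in> carrier_mat n n" "S * T = 1\<^sub>m n" "T * S = 1\<^sub>m n"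
    "T * M * S = jordan_matrix js" "char_poly M = (\<Prod>(m, a)\<leftarrow>js. [:- a, 1:] ^ m)"
proof -
  obtain js where js: "jordan_nf M js"
    using char_poly_factorized[OF M] jordan_nf_exists[OF M] by blast
  then have "similar_mat M (jordan_matrix js)" by (simp add: jordan_nf_def)
  then obtain S T where "similar_mat_wit M (jordan_matrix js) S T" unfolding similar_mat_def by blast
  note w = similar_mat_witD2[OF M this]
  have "dim_row (jordan_matrix js) = n" using w by auto
  then have n: "sum_list (map fst js) = n" by simp
  have "T * M * S = T * S * jordan_matrix js * (T * S)"
    unfolding w(3) using w(5-7) n by (simp add: mat_mult_assoc)
  also have "\<dots> = jordan_matrix js" 
    unfolding w(2) left_mult_one_mat[OF w(5)] right_mult_one_mat[OF w(5)] ..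
  finally show ?thesis
    using that[of js S T] n w js jordan_nf_char_poly[OF js] by (auto simp: jordan_nf_def)
qed

text \<open>Multiplication by the inverse \<open>K'\<close> of \<open>K\<close> turns the pair \<open>K\<close>, \<open>1 - \<mu> K\<close> into \<open>1\<close>,
\<open>-(\<mu> - K')\<close>, and the Jordan form of \<open>\<mu> - K'\<close> finishes the job.\<close>

lemma invertible_part_normal_form:
  fixes K :: "complex mat"
  assumes K: "K \<in> carrier_mat n n" and "det K \<noteq> 0"
  obtains js U V where "0 \<notin> fst ` set js" "sum_list (map fst js) = n"
    "U \<in> carrier_mat n n" "V \<in> carrier_mat n n" "invertible_mat U" "invertible_mat V"
    "U * K * V = 1\<^sub>m n" "U * (1\<^sub>m n - \<mu> \<cdot>\<^sub>m K) * V = - jordan_matrix js"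
proof -
  obtain K' where K': "K' \<in> carrier_mat n n" "K * K' = 1\<^sub>m n" "K' * K = 1\<^sub>m n"
    using det_nonzero_obtain_inverse[OF assms] by blast
  define C where "C = \<mu> \<cdot>\<^sub>m 1\<^sub>m n - K'"
  have C: "C \<in> carrier_mat n n" using K' by (simp add: C_def)
  obtain js S T where js: "0 \<notin> fst ` set js" "sum_list (map fst js) = n"
    and ST: "S \<in> carrier_mat n n" "T \<in> carrier_mat n n" "S * T = 1\<^sub>m n" "T * S = 1\<^sub>m n"
      "T * C * S = jordan_matrix js"
    using jordan_nf_complex_obtain[OF C] by metis
  have "T * K' * K * S = T * (K' * K) * S" using ST(1,2) K K'(1) by (simp add: mat_mult_assoc)
  then have 1: "T * K' * K * S = 1\<^sub>m n" using ST K' by simp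
  have "K' * (1\<^sub>m n - \<mu> \<cdot>\<^sub>m K) = K' - \<mu> \<cdot>\<^sub>m (K' * K)"
    using K K'(1) by (simp add: mult_minus_distrib_mat[where nr=n and n=n and nc=n] mult_smult_distrib[where nr=n and n=n and nc=n])
  also have "\<dots> = - C" unfolding C_def K' using K' by (intro eq_matI) auto
  finally have "T * K' * (1\<^sub>m n - \<mu> \<cdot>\<^sub>m K) * S = T * (- C) * S"
    using ST(1,2) K K'(1) C by (simp add: mat_mult_assoc)
  also have "\<dots> = - (T * C * S)" using ST C by simp
  finally have 2: "T * K' * (1\<^sub>m n - \<mu> \<cdot>\<^sub>m K) * S = - jordan_matrix js" using ST by simp
  have "T * K' * (K * S) = 1\<^sub>m n" using 1 ST(1,2) K K'(1) by (simp add: mat_mult_assoc)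
  then have "invertible_mat (T * K')" using ST K K' by (intro invertible_matI[of _ n "K * S"]) auto
  moreover have "invertible_mat S" using ST by (intro invertible_matI[of _ n T]) auto
  ultimately show ?thesis using that[of js "T * K'" S] js ST K' 1 2 by auto
qed

text \<open>Here \<open>1 - \<mu> K\<close> is the invertible member of the pair, and the Jordan form is taken of
\<open>N = -(1 - \<mu> K)\<^sup>-\<^sup>1 K\<close>. All its eigenvalues vanish, since
\<open>det (1 - \<mu> K) * det (a - N) = det (a + (1 - a \<mu>) K) = a ^ n\<close>.\<close>

lemma nilpotent_part_normal_form:
  assumes zero: "\<And>m a. (m, a) \<in> set xs \<Longrightarrow> a = (0 :: complex)"
    and n: "n = sum_list (map fst xs)" and K: "K = jordan_matrix xs"
  obtains ks U V where "0 \<notin> set ks" "sum_list ks = n"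
    "U \<in> carrier_mat n n" "V \<in> carrier_mat n n" "invertible_mat U" "invertible_mat V"
    "U * K * V = jordan_matrix (map (\<lambda>k. (k, 0)) ks)" "U * (1\<^sub>m n - \<mu> \<cdot>\<^sub>m K) * V = - 1\<^sub>m n"
proof -
  have Kc: "K \<in> carrier_mat n n" by (simp add: K n)
  define R where "R = 1\<^sub>m n - \<mu> \<cdot>\<^sub>m K"
  have R: "R \<in> carrier_mat n n" unfolding R_def by (rule minus_carrier_mat) (use Kc in simp)
  have affine: "det (a \<cdot>\<^sub>m 1\<^sub>m n + c \<cdot>\<^sub>m K) = a ^ n" for a c
    unfolding K n by (rule det_affine_nilpotent_jordan[OF zero])
  have "R = 1 \<cdot>\<^sub>m 1\<^sub>m n + (- \<mu>) \<cdot>\<^sub>m K" unfolding R_def using Kc by (intro eq_matI) auto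
  then have detR: "det R \<noteq> 0" using affine[of 1 "-\<mu>"] by simp
  obtain R' where R': "R' \<in> carrier_mat n n" "R * R' = 1\<^sub>m n" "R' * R = 1\<^sub>m n"
    using det_nonzero_obtain_inverse[OF R detR] by blast
  define N where "N = - R' * K"
  have N: "N \<in> carrier_mat n n" using R' Kc by (simp add: N_def)
  obtain js S T where js: "0 \<notin> fst ` set js" "sum_list (map fst js) = n"
    and ST: "S \<in> carrier_mat n n" "T \<in> carrier_mat n n" "S * T = 1\<^sub>m n" "T * S = 1\<^sub>m n"
      "T * N * S = jordan_matrix js"
    and cp: "char_poly N = (\<Prod>(m, a)\<leftarrow>js. [:- a, 1:] ^ m)"
    using jordan_nf_complex_obtain[OF N] by metis
  have js0: "a = 0" if ma: "(m, a) \<in> set js" for m a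
  proof -
    have m: "0 < m" using ma js by (cases m) force+
    have "[:-a, 1:] ^ m dvd char_poly N"
      unfolding cp using ma by (intro prod_list_dvd) force
    then have "poly (char_poly N) a = 0"
      using m by (meson dvd_power dvd_trans poly_eq_0_iff_dvd)
    then have "det (a \<cdot>\<^sub>m 1\<^sub>m n - N) = 0" using poly_char_poly_eq_det[OF N] by simp
    then have "det (R * (a \<cdot>\<^sub>m 1\<^sub>m n - N)) = 0" using R N by (subst det_mult[of _ n]) auto
    also have "R * (a \<cdot>\<^sub>m 1\<^sub>m n - N) = a \<cdot>\<^sub>m R - R * N"
      using R N by (simp add: mult_minus_distrib_mat[where nr=n and n=n and nc=n] mult_smult_distrib[where nr=n and n=n and nc=n])
    also have "R * N = - (R * R' * K)" using R R'(1) Kc by (simp add: N_def mat_mult_assoc)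
    also have "\<dots> = - K" using R' Kc by simp
    also have "a \<cdot>\<^sub>m R - (- K) = a \<cdot>\<^sub>m 1\<^sub>m n + (1 - a * \<mu>) \<cdot>\<^sub>m K"
      unfolding R_def using Kc by (intro eq_matI) (auto simp: algebra_simps)
    finally show "a = 0" using affine by simp
  qed
  define ks where "ks = map fst js"
  have js_ks: "js = map (\<lambda>k. (k, 0)) ks"
    unfolding ks_def map_map by (rule map_idI[symmetric]) (use js0 in force)
  let ?U = "T * (- R')"
  have 1: "?U * K * S = jordan_matrix (map (\<lambda>k. (k, 0)) ks)"
    using ST(5) ST(1,2) R'(1) Kc unfolding N_def js_ks by (simp add: mat_mult_assoc)
  have "?U * R * S = T * (- (R' * R)) * S" using ST(1,2) R R'(1) by (simp add: mat_mult_assoc)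
  also have "\<dots> = - 1\<^sub>m n" unfolding R' using ST by simp
  finally have 2: "?U * (1\<^sub>m n - \<mu> \<cdot>\<^sub>m K) * S = - 1\<^sub>m n" by (simp only: R_def)
  have "?U * (- (R * S)) = 1\<^sub>m n"
  proof -
    have "?U * (- (R * S)) = T * (R' * R) * S" using ST(1,2) R R'(1) by (simp add: mat_mult_assoc)
    then show ?thesis unfolding R' using ST by simp
  qed
  then have "invertible_mat ?U" using ST R R' by (intro invertible_matI[of _ n "- (R * S)"]) auto
  moreover have "invertible_mat S" using ST by (intro invertible_matI[of _ n T]) auto
  moreover have "0 \<notin> set ks" "sum_list ks = n" using js by (auto simp: ks_def)
  ultimately show ?thesis using that[of ks ?U S] ST R' 1 2 by auto
qed

lemma invertible_mat_mult:
  fixes P :: "complex mat"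
  assumes "P \<in> carrier_mat n n" "Q \<in> carrier_mat n n" "invertible_mat P" "invertible_mat Q"
  shows "invertible_mat (P * Q)"
proof -
  have "det (P * Q) \<noteq> 0"
    using assms invertible_mat_det[OF assms(1,3)] invertible_mat_det[OF assms(2,4)]
    by (simp add: det_mult)
  then show ?thesis
    using det_nonzero_obtain_inverse[of "P * Q" n] invertible_matI[of "P * Q" n] assms by (metis mult_carrier_mat)
qed

lemma invertible_block_diag:
  fixes P :: "complex mat"
  assumes P: "P \<in> carrier_mat n n" and Q: "Q \<in> carrier_mat m m" and "invertible_mat P" "invertible_mat Q"
  shows "invertible_mat (block_diag P Q)"
proof -
  obtain P' where P': "P' \<in> carrier_mat n n" "P * P' = 1\<^sub>m n"
    using invertible_mat_obtain_inverse[OF P] assms by blast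
  obtain Q' where Q': "Q' \<in> carrier_mat m m" "Q * Q' = 1\<^sub>m m"
    using invertible_mat_obtain_inverse[OF Q] assms by blast
  have "block_diag P Q * block_diag P' Q' = 1\<^sub>m (n + m)"
    using block_diag_mult[OF P P'(1) Q Q'(1)] P' Q' block_diag_one[of n m] by simp
  then show ?thesis using P Q P' Q' by (intro invertible_matI[of _ "n + m" "block_diag P' Q'"]) auto
qed

text \<open>At a point \<open>\<mu>\<close> outside the spectrum \<open>F = A + \<mu> B\<close> is invertible. With \<open>M = F\<^sup>-\<^sup>1 B\<close> the pencil
is \<open>F (1 + (\<lambda> - \<mu>) M)\<close>; the invertible part of \<open>M\<close> yields the finite eigenvalues and the
nilpotent part the infinite ones.\<close>

lemma weierstrass_form_exists:
  assumes A: "A \<in> carrier_mat n n" and B: "B \<in> carrier_mat n n" and reg: "det (pencil A B) \<noteq> 0"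
  obtains js ks where "weierstrass_form (pencil A B) js ks"
proof -
  obtain \<mu> where \<mu>: "poly (det (pencil A B)) \<mu> \<noteq> 0" using reg poly_all_0_iff_0 by blast
  define F where "F = A + \<mu> \<cdot>\<^sub>m B"
  have F: "F \<in> carrier_mat n n" using A B by (simp add: F_def)
  have "det F \<noteq> 0" using \<mu> eval_mat_pencil[OF A B] by (simp add: F_def det_eval_mat[symmetric])
  then obtain F' where F': "F' \<in> carrier_mat n n" "F * F' = 1\<^sub>m n" "F' * F = 1\<^sub>m n"
    using det_nonzero_obtain_inverse[OF F] by blast
  define M where "M = F' * B"
  have M: "M \<in> carrier_mat n n" using F' B by (simp add: M_def)
  have A_eq: "A = F - \<mu> \<cdot>\<^sub>m B" unfolding F_def using A B by (intro eq_matI) auto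
  have F'A: "F' * A = 1\<^sub>m n - \<mu> \<cdot>\<^sub>m M"
    unfolding M_def A_eq using F F' B
    by (simp add: mult_minus_distrib_mat[where nr=n and n=n and nc=n] mult_smult_distrib[where nr=n and n=n and nc=n])
  obtain xs S0 T0 where xs: "0 \<notin> fst ` set xs" "sum_list (map fst xs) = n"
    and ST0: "S0 \<in> carrier_mat n n" "T0 \<in> carrier_mat n n" "S0 * T0 = 1\<^sub>m n" "T0 * S0 = 1\<^sub>m n"
      "T0 * M * S0 = jordan_matrix xs"
    using jordan_nf_complex_obtain[OF M] by metis
  define ys zs where "ys = filter (\<lambda>x. snd x \<noteq> 0) xs" and "zs = filter (\<lambda>x. \<not> snd x \<noteq> 0) xs"
  define p q where "p = sum_list (map fst ys)" and "q = sum_list (map fst zs)"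
  define K1 K2 where "K1 = jordan_matrix ys" and "K2 = jordan_matrix zs"
  have K1: "K1 \<in> carrier_mat p p" and K2: "K2 \<in> carrier_mat q q"
    by (simp_all add: K1_def K2_def p_def q_def)
  have Jc: "jordan_matrix xs \<in> carrier_mat n n" using xs by (intro carrier_matI) auto
  have "similar_mat (jordan_matrix xs) (block_diag K1 K2)"
    unfolding K1_def K2_def ys_def zs_def by (rule similar_jordan_matrix_partition)
  then obtain S1 T1 where "similar_mat_wit (jordan_matrix xs) (block_diag K1 K2) S1 T1"
    unfolding similar_mat_def by blast
  note w = similar_mat_witD2[OF Jc this]
  have npq: "n = p + q" using carrier_matD(1)[OF w(5)] carrier_matD[OF K1] carrier_matD[OF K2] by simp
  define K where "K = block_diag K1 K2"
  have K: "K \<in> carrier_mat n n" using w(5) unfolding K_def .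
  define S T where "S = S0 * S1" and "T = T1 * T0"
  have S: "S \<in> carrier_mat n n" and T: "T \<in> carrier_mat n n" using ST0(1,2) w(6,7) by (auto simp: S_def T_def)
  have TS: "T * S = 1\<^sub>m n"
  proof -
    have "T * S = T1 * (T0 * S0) * S1" unfolding S_def T_def using ST0(1,2) w(6,7) by (simp add: mat_mult_assoc)
    then show ?thesis using ST0(4) w(2,7) by simp
  qed
  have TMS: "T * M * S = K"
  proof -
    have "T * M * S = T1 * (T0 * M * S0) * S1"
      unfolding S_def T_def using ST0(1,2) w(6,7) M by (simp add: mat_mult_assoc)
    also have "\<dots> = T1 * S1 * K * (T1 * S1)"
      unfolding ST0(5) w(3) K_def[symmetric] using w(6,7) K by (simp add: mat_mult_assoc)
    finally show ?thesis using w(2) K by simp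
  qed
  obtain js U1 V1 where js: "0 \<notin> fst ` set js" "sum_list (map fst js) = p"
    and UV1: "U1 \<in> carrier_mat p p" "V1 \<in> carrier_mat p p" "invertible_mat U1" "invertible_mat V1"
      "U1 * K1 * V1 = 1\<^sub>m p" "U1 * (1\<^sub>m p - \<mu> \<cdot>\<^sub>m K1) * V1 = - jordan_matrix js"
  proof (rule invertible_part_normal_form[OF K1])
    show "det K1 \<noteq> 0" unfolding K1_def by (rule jordan_matrix_nonzero_det) (auto simp: ys_def)
  qed blast
  obtain ks U2 V2 where ks: "0 \<notin> set ks" "sum_list ks = q"
    and UV2: "U2 \<in> carrier_mat q q" "V2 \<in> carrier_mat q q" "invertible_mat U2" "invertible_mat V2"
      "U2 * K2 * V2 = jordan_matrix (map (\<lambda>k. (k, 0)) ks)" "U2 * (1\<^sub>m q - \<mu> \<cdot>\<^sub>m K2) * V2 = - 1\<^sub>m q"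
  proof (rule nilpotent_part_normal_form[OF _ q_def K2_def])
    show "\<And>m a. (m, a) \<in> set zs \<Longrightarrow> a = 0" by (auto simp: zs_def)
  qed blast
  define U V where "U = block_diag U1 U2" and "V = block_diag V1 V2"
  have U: "U \<in> carrier_mat n n" "invertible_mat U" and V: "V \<in> carrier_mat n n" "invertible_mat V"
    using invertible_block_diag[OF UV1(1) UV2(1) UV1(3) UV2(3)]
      invertible_block_diag[OF UV1(2) UV2(2) UV1(4) UV2(4)]
      four_block_carrier_mat[OF UV1(1) UV2(1)] four_block_carrier_mat[OF UV1(2) UV2(2)]
    unfolding U_def V_def npq by blast+
  define P where "P = U * (T * F')"
  define Q where "Q = S * V"
  have TF: "T * F' \<in> carrier_mat n n" "invertible_mat (T * F')"
  proof -
    have "T * F' * (F * S) = T * (F' * F) * S" using T F'(1) F S by (simp add: mat_mult_assoc)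
    then have "T * F' * (F * S) = 1\<^sub>m n" using F' T TS by simp
    then show "invertible_mat (T * F')" using T F' F S by (intro invertible_matI[of _ n "F * S"]) auto
  qed (use T F' in auto)
  have "invertible_mat S" using S T mat_mult_left_right_inverse[OF T S TS] by (intro invertible_matI[of _ n T])
  then have P: "P \<in> carrier_mat n n" "invertible_mat P" and Q: "Q \<in> carrier_mat n n" "invertible_mat Q"
    using U V TF S by (auto simp: P_def Q_def intro: invertible_mat_mult)
  have PBQ: "P * B * Q = block_diag (1\<^sub>m p) (jordan_matrix (map (\<lambda>k. (k, 0)) ks))"
  proof -
    have "P * B * Q = U * (T * M * S) * V"
      unfolding P_def Q_def M_def using U V T F'(1) B S by (simp add: mat_mult_assoc)
    also have "\<dots> = block_diag U1 U2 * block_diag K1 K2 * block_diag V1 V2"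
      by (simp only: TMS K_def U_def V_def)
    also have "\<dots> = block_diag (U1 * K1 * V1) (U2 * K2 * V2)"
      by (simp only: block_diag_mult[OF UV1(1) K1 UV2(1) K2] block_diag_mult[OF
          mult_carrier_mat[OF UV1(1) K1] UV1(2) mult_carrier_mat[OF UV2(1) K2] UV2(2)])
    finally show ?thesis by (simp only: UV1(5) UV2(5))
  qed
  have PAQ: "P * A * Q = block_diag (- jordan_matrix js) (- 1\<^sub>m q)"
  proof -
    have R: "1\<^sub>m p - \<mu> \<cdot>\<^sub>m K1 \<in> carrier_mat p p" "1\<^sub>m q - \<mu> \<cdot>\<^sub>m K2 \<in> carrier_mat q q"
      using K1 K2 by auto
    have "P * A * Q = U * (T * (F' * A) * S) * V"
      unfolding P_def Q_def using U V T F'(1) A S by (simp add: mat_mult_assoc)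
    also have "T * (F' * A) * S = T * S - \<mu> \<cdot>\<^sub>m (T * M * S)"
      unfolding F'A using T M S
      by (simp add: mult_minus_distrib_mat[where nr=n and n=n and nc=n] minus_mult_distrib_mat[where nr=n and n=n and nc=n]
          mult_smult_distrib[where nr=n and n=n and nc=n] mult_smult_assoc_mat[where nr=n and n=n and nc=n])
    also have "\<dots> = block_diag (1\<^sub>m p - \<mu> \<cdot>\<^sub>m K1) (1\<^sub>m q - \<mu> \<cdot>\<^sub>m K2)"
      unfolding TS TMS K_def npq using K1 K2 by (intro eq_matI) auto
    also have "U * \<dots> * V = block_diag (U1 * (1\<^sub>m p - \<mu> \<cdot>\<^sub>m K1) * V1) (U2 * (1\<^sub>m q - \<mu> \<cdot>\<^sub>m K2) * V2)"
      by (simp only: U_def V_def block_diag_mult[OF UV1(1) R(1) UV2(1) R(2)] block_diag_mult[OF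
          mult_carrier_mat[OF UV1(1) R(1)] UV1(2) mult_carrier_mat[OF UV2(1) R(2)] UV2(2)])
    finally show ?thesis by (simp only: UV1(6) UV2(6))
  qed
  have "const_mat P * pencil A B * const_mat Q = weierstrass_mat js ks"
    unfolding const_mult_pencil[OF A B P(1) Q(1)] PAQ PBQ weierstrass_mat_def Let_def
    using js ks carrier_matD[OF jordan_matrix_zeros_carrier, of ks] by simp
  then have "weierstrass_form (pencil A B) js ks"
    unfolding weierstrass_form_def carrier_matD[OF pencil_carrier[OF A B]] using js ks P Q by blast
  then show ?thesis by (rule that)
qed

lemma finite_partial_multiplicities_exist:
  assumes "A \<in> carrier_mat n n" "B \<in> carrier_mat n n" "det (pencil A B) \<noteq> 0"
  obtains ms where "finite_partial_multiplicities (pencil A B) \<mu> ms"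
  using weierstrass_form_exists[OF assms] unfolding finite_partial_multiplicities_def by metis

section \<open>Rank two skew-symmetric perturbations\<close>

definition skew_outer :: "nat \<Rightarrow> 'a :: comm_ring_1 vec \<Rightarrow> 'a vec \<Rightarrow> 'a mat" where
  "skew_outer n v w = mat n n (\<lambda>(i, j). v $ i * w $ j - w $ i * v $ j)"

lemma skew_outer_carrier [simp]: "skew_outer n v w \<in> carrier_mat n n"
  by (simp add: skew_outer_def)

lemma skew_outer_dim [simp]: "dim_row (skew_outer n v w) = n" "dim_col (skew_outer n v w) = n"
  by (simp_all add: skew_outer_def)

text \<open>The bilinear form \<open>x\<^sup>T adj(L) y\<close>.\<close>

definition adj_form :: "'a :: comm_ring_1 mat \<Rightarrow> 'a vec \<Rightarrow> 'a vec \<Rightarrow> 'a" where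
  "adj_form L x y = (\<Sum>i<dim_row L. \<Sum>j<dim_row L. x $ i * adj_mat L $$ (i, j) * y $ j)"

text \<open>Transposing \<open>L adj(L) = det L\<close> gives \<open>- adj(L)\<^sup>T L = det L\<close>; multiply by \<open>adj(L)\<close> from the right
and cancel \<open>det L\<close>.\<close>

lemma adj_mat_skew:
  fixes L :: "'a :: idom mat"
  assumes L: "L \<in> carrier_mat n n" and skew: "L\<^sup>T = - L" and det: "det L \<noteq> 0"
    and ij: "i < n" "j < n"
  shows "adj_mat L $$ (i, j) = - adj_mat L $$ (j, i)"
proof -
  let ?R = "adj_mat L"
  note R = adj_mat[OF L]
  have RT: "?R\<^sup>T \<in> carrier_mat n n" using R(1) by simp
  have "- (?R\<^sup>T * L) = ?R\<^sup>T * L\<^sup>T" unfolding skew using L RT by simp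
  also have "\<dots> = (L * ?R)\<^sup>T" using L R(1) by (simp add: transpose_mult)
  also have "\<dots> = det L \<cdot>\<^sub>m 1\<^sub>m n" unfolding R(2) by (intro eq_matI) auto
  finally have 1: "- (?R\<^sup>T * L) = det L \<cdot>\<^sub>m 1\<^sub>m n" .
  have "- (det L \<cdot>\<^sub>m ?R\<^sup>T) = - (?R\<^sup>T * (L * ?R))"
    unfolding R(2) using RT by (simp add: mult_smult_distrib[of _ n n _ n])
  also have "\<dots> = - (?R\<^sup>T * L) * ?R"
    using RT R(1) L by (simp add: assoc_mult_mat[of _ n n _ n _ n])
  also have "\<dots> = det L \<cdot>\<^sub>m ?R" unfolding 1 using R(1) by (simp add: mult_smult_assoc_mat[of _ n n _ n])
  finally have "(- (det L \<cdot>\<^sub>m ?R\<^sup>T)) $$ (j, i) = (det L \<cdot>\<^sub>m ?R) $$ (j, i)" by simp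
  then have "det L * (- ?R $$ (i, j)) = det L * ?R $$ (j, i)" using ij R(1) by simp
  then have "- ?R $$ (i, j) = ?R $$ (j, i)" using det by (simp only: mult_cancel_left) simp
  then show ?thesis by (metis minus_minus)
qed

lemma adj_form_skew:
  fixes L :: "'a :: idom mat"
  assumes "L \<in> carrier_mat n n" "L\<^sup>T = - L" "det L \<noteq> 0"
  shows "adj_form L x y = - adj_form L y x"
proof -
  have "adj_form L x y = (\<Sum>i<n. \<Sum>j<n. x $ i * adj_mat L $$ (i, j) * y $ j)"
    using assms by (simp add: adj_form_def)
  also have "\<dots> = (\<Sum>j<n. \<Sum>i<n. x $ i * adj_mat L $$ (i, j) * y $ j)" by (rule sum.swap)
  also have "\<dots> = (\<Sum>j<n. \<Sum>i<n. - (y $ j * adj_mat L $$ (j, i) * x $ i))"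
  proof (intro sum.cong refl)
    fix i j assume "j \<in> {..<n}" "i \<in> {..<n}"
    then have "adj_mat L $$ (i, j) = - adj_mat L $$ (j, i)" by (intro adj_mat_skew[OF assms]) auto
    then show "x $ i * adj_mat L $$ (i, j) * y $ j = - (y $ j * adj_mat L $$ (j, i) * x $ i)"
      by (simp add: mult_ac)
  qed
  also have "\<dots> = - adj_form L y x" using assms by (simp add: adj_form_def sum_negf)
  finally show ?thesis .
qed

lemma det_adj_mat:
  fixes L :: "'a :: idom mat"
  assumes L: "L \<in> carrier_mat n n"
  shows "det L * det (adj_mat L) = det L ^ n"
proof -
  have "det (L * adj_mat L) = det L * det (adj_mat L)" using adj_mat(1)[OF L] by (rule det_mult[OF L])
  then show ?thesis unfolding adj_mat(2)[OF L] by simp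
qed

text \<open>The matrix determinant lemma without division. Block elimination from the right and from the left in
the matrix with rows \<open>(L, -U)\<close> and \<open>(V, 1)\<close> computes its determinant in two ways.\<close>

lemma det_add_mult_adj:
  fixes L :: "'a :: idom mat"
  assumes L: "L \<in> carrier_mat n n" and U: "U \<in> carrier_mat n m" and V: "V \<in> carrier_mat m n"
    and det: "det L \<noteq> 0"
  shows "det L ^ m * det (L + U * V) = det L * det (det L \<cdot>\<^sub>m 1\<^sub>m m + V * (adj_mat L * U))"
proof -
  define D where "D = det L"
  define R where "R = adj_mat L"
  define K where "K = D \<cdot>\<^sub>m 1\<^sub>m m + V * (R * U)"
  note R = adj_mat[OF L, folded R_def D_def]
  define X where "X = four_block_mat L (- U) V (1\<^sub>m m)"
  define Z where "Z = four_block_mat (1\<^sub>m n) (0\<^sub>m n m) (- V) (1\<^sub>m m)"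
  define Y where "Y = four_block_mat R (0\<^sub>m n m) (- (V * R)) (D \<cdot>\<^sub>m 1\<^sub>m m)"
  have X: "X \<in> carrier_mat (n + m) (n + m)" and Z: "Z \<in> carrier_mat (n + m) (n + m)"
    and Y: "Y \<in> carrier_mat (n + m) (n + m)"
    unfolding X_def Y_def Z_def using L R(1) by (intro four_block_carrier_mat; simp)+
  have RU: "R * U \<in> carrier_mat n m" and VR: "V * R \<in> carrier_mat m n" and UV: "U * V \<in> carrier_mat n n"
    using U V R(1) by auto
  have "X * Z = four_block_mat (L * 1\<^sub>m n + (- U) * (- V)) (L * 0\<^sub>m n m + (- U) * 1\<^sub>m m)
      (V * 1\<^sub>m n + 1\<^sub>m m * (- V)) (V * 0\<^sub>m n m + 1\<^sub>m m * 1\<^sub>m m)"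
    unfolding X_def Z_def
    by (rule mult_four_block_mat)
      (rule one_carrier_mat zero_carrier_mat L U V uminus_carrier_mat)+
  also have "\<dots> = four_block_mat (L + U * V) (- U) (0\<^sub>m m n) (1\<^sub>m m)"
    using L U V by (intro cong_four_block_mat) (auto intro!: eq_matI)
  finally have "det (X * Z) = det (L + U * V)"
    using det_four_block_mat_lower_left_zero[of "L + U * V" n "- U" m "0\<^sub>m m n" "1\<^sub>m m"] L U UV by simp
  moreover have "det Z = 1"
    unfolding Z_def using V
    by (subst det_four_block_mat_upper_right_zero[of _ n _ m]) auto
  ultimately have detX: "det X = det (L + U * V)" using det_mult[OF X Z] by simp
  have "Y * X = four_block_mat (R * L + 0\<^sub>m n m * V) (R * (- U) + 0\<^sub>m n m * 1\<^sub>m m)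
      (- (V * R) * L + (D \<cdot>\<^sub>m 1\<^sub>m m) * V) (- (V * R) * (- U) + (D \<cdot>\<^sub>m 1\<^sub>m m) * 1\<^sub>m m)"
    unfolding X_def Y_def
    by (rule mult_four_block_mat)
      (rule one_carrier_mat zero_carrier_mat L U V R(1) VR uminus_carrier_mat smult_carrier_mat)+
  also have "\<dots> = four_block_mat (D \<cdot>\<^sub>m 1\<^sub>m n) (- (R * U)) (0\<^sub>m m n) K"
  proof (intro cong_four_block_mat)
    show "R * L + 0\<^sub>m n m * V = D \<cdot>\<^sub>m 1\<^sub>m n" using R V by simp
    show "R * (- U) + 0\<^sub>m n m * 1\<^sub>m m = - (R * U)" using R(1) U RU by simp
    have "V * R * L = D \<cdot>\<^sub>m V"
      using assoc_mult_mat[OF V R(1) L] V by (simp add: R mult_smult_distrib[of _ m n _ n])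
    moreover have "(D \<cdot>\<^sub>m 1\<^sub>m m) * V = D \<cdot>\<^sub>m V" using V by (simp add: mult_smult_assoc_mat[of _ m m _ n])
    moreover have "- (V * R) * L = - (V * R * L)" using L VR by (intro uminus_mult_left_mat) auto
    ultimately show "- (V * R) * L + (D \<cdot>\<^sub>m 1\<^sub>m m) * V = 0\<^sub>m m n"
      using V by (intro eq_matI) auto
    have "- (V * R) * (- U) = V * (R * U)"
      using assoc_mult_mat[OF V R(1) U] U V R(1) by simp
    moreover have "V * (R * U) \<in> carrier_mat m m" using V RU by simp
    ultimately show "- (V * R) * (- U) + (D \<cdot>\<^sub>m 1\<^sub>m m) * 1\<^sub>m m = K"
      unfolding K_def by (simp add: comm_add_mat[of _ m m])
  qed
  finally have "det (Y * X) = D ^ n * det K"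
    using det_four_block_mat_lower_left_zero[of "D \<cdot>\<^sub>m 1\<^sub>m n" n "- (R * U)" m "0\<^sub>m m n" K] RU V
    by (simp add: K_def)
  moreover have "det Y = det R * D ^ m"
    unfolding Y_def using R(1) VR
    by (subst det_four_block_mat_upper_right_zero[of _ n _ m]) auto
  ultimately have "det R * D ^ m * det X = D ^ n * det K" using det_mult[OF Y X] by simp
  then have "D * det R * D ^ m * det X = D * D ^ n * det K" by (simp add: mult_ac)
  then have "D ^ n * (D ^ m * det X) = D ^ n * (D * det K)"
    using det_adj_mat[OF L] by (simp add: D_def R_def mult_ac)
  then show ?thesis using det detX by (simp add: D_def K_def R_def)
qed

text \<open>The form \<open>adj_form L\<close> is alternating, so for \<open>U = (v, w)\<close> and \<open>V = (w, -v)\<^sup>T\<close> the two-by-two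
matrix in \<open>det_add_mult_adj\<close> is the scalar \<open>det L + adj_form L w v\<close>.\<close>

lemma det_skew_outer_update:
  fixes L :: "'a :: {idom, ring_char_0} mat"
  assumes L: "L \<in> carrier_mat n n" and skew: "L\<^sup>T = - L" and det: "det L \<noteq> 0"
    and v: "v \<in> carrier_vec n" and w: "w \<in> carrier_vec n"
  shows "det L * det (L + skew_outer n v w) = (det L + adj_form L w v) ^ 2"
proof -
  define U where "U = mat n 2 (\<lambda>(i, j). if j = 0 then v $ i else w $ i)"
  define V where "V = mat 2 n (\<lambda>(i, j). if i = 0 then w $ j else - v $ j)"
  have U: "U \<in> carrier_mat n 2" and V: "V \<in> carrier_mat 2 n" by (simp_all add: U_def V_def)
  have UV: "U * V = skew_outer n v w"
    by (intro eq_matI) (auto simp: U_def V_def skew_outer_def scalar_prod_def numeral_2_eq_2)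
  have R: "adj_mat L \<in> carrier_mat n n" by (rule adj_mat(1)[OF L])
  have entry: "(V * (adj_mat L * U)) $$ (i, j) =
      adj_form L (if i = 0 then w else - v) (if j = 0 then v else w)" if "i < 2" "j < 2" for i j
  proof -
    have "(V * (adj_mat L * U)) $$ (i, j) =
        (\<Sum>k<n. V $$ (i, k) * (\<Sum>l<n. adj_mat L $$ (k, l) * U $$ (l, j)))"
      using that U V R by (auto simp: scalar_prod_def atLeast0LessThan)
    also have "\<dots> = (\<Sum>k<n. \<Sum>l<n. (if i = 0 then w else - v) $ k * adj_mat L $$ (k, l) *
        (if j = 0 then v else w) $ l)"
      unfolding sum_distrib_left using that v w
      by (intro sum.cong) (auto simp: U_def V_def mult_ac)
    finally show ?thesis using L by (simp add: adj_form_def)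
  qed
  have zero: "adj_form L x x = 0" for x
    using adj_form_skew[OF L skew det, of x x] by (simp add: eq_neg_iff_add_eq_0 flip: mult_2)
  have neg: "adj_form L (- v) x = - adj_form L v x" for x
    unfolding adj_form_def sum_negf[symmetric] using v L by (intro sum.cong) auto
  have "det L \<cdot>\<^sub>m 1\<^sub>m 2 + V * (adj_mat L * U) = (det L + adj_form L w v) \<cdot>\<^sub>m 1\<^sub>m 2"
  proof (intro eq_matI)
    fix i j assume ij: "i < dim_row ((det L + adj_form L w v) \<cdot>\<^sub>m 1\<^sub>m 2)"
      "j < dim_col ((det L + adj_form L w v) \<cdot>\<^sub>m 1\<^sub>m 2)"
    then have ij: "i < 2" "j < 2" by auto
    have "(det L \<cdot>\<^sub>m 1\<^sub>m 2 + V * (adj_mat L * U)) $$ (i, j) =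
      (if i = j then det L else 0) + adj_form L (if i = 0 then w else - v) (if j = 0 then v else w)"
      using ij entry[OF ij] U V by simp
    also have "\<dots> = ((det L + adj_form L w v) \<cdot>\<^sub>m 1\<^sub>m 2) $$ (i, j)"
      using ij zero neg adj_form_skew[OF L skew det, of v w] by (auto simp: less_2_cases_iff)
    finally show "(det L \<cdot>\<^sub>m 1\<^sub>m 2 + V * (adj_mat L * U)) $$ (i, j) =
        ((det L + adj_form L w v) \<cdot>\<^sub>m 1\<^sub>m 2) $$ (i, j)" .
  qed (use U V in auto)
  then have "det L ^ 2 * det (L + skew_outer n v w) = det L * (det L + adj_form L w v) ^ 2"
    using det_add_mult_adj[OF L U V det] by (simp add: UV)
  then show ?thesis using det by (simp add: power2_eq_square)
qed

section \<open>Interlacing of partial multiplicities\<close>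

lemma root_frame_zero: "root_frame L \<mu> k 0"
  unfolding root_frame_def dvd_mat_def
  by (intro exI[of _ "0\<^sub>m (dim_col L) 0"] exI[of _ "0\<^sub>m 0 (dim_col L)"]) auto

lemma root_frame_rank_one_update_diff:
  assumes "L \<in> carrier_mat n n" "a \<in> carrier_mat n 1" "b \<in> carrier_mat 1 n" "root_frame L \<mu> k d"
  shows "root_frame (L + a * b) \<mu> k (d - 1)"
  using assms root_frame_rank_one_update[OF assms(1-3)] by (cases d) (auto intro: root_frame_zero)

lemma root_frame_skew_outer_update:
  assumes L: "L \<in> carrier_mat n n" and frame: "root_frame L \<mu> k d"
  shows "root_frame (L + skew_outer n v w) \<mu> k (d - 2)"
proof -
  define a1 b1 where "a1 = mat n 1 (\<lambda>(i, j). v $ i)" and "b1 = mat 1 n (\<lambda>(i, j). w $ j)"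
  define a2 b2 where "a2 = mat n 1 (\<lambda>(i, j). - w $ i)" and "b2 = mat 1 n (\<lambda>(i, j). v $ j)"
  have "root_frame (L + a1 * b1 + a2 * b2) \<mu> k (d - 1 - 1)"
    using L frame
    by (intro root_frame_rank_one_update_diff[of _ n]) (auto simp: a1_def b1_def a2_def b2_def)
  also have "L + a1 * b1 + a2 * b2 = L + skew_outer n v w"
    using L by (intro eq_matI)
      (auto simp: a1_def b1_def a2_def b2_def skew_outer_def scalar_prod_def)
  finally show ?thesis by (simp add: numeral_2_eq_2)
qed

lemma count_ge_drop:
  assumes "sorted (rev xs)"
  shows "length (filter (\<lambda>m. k \<le> m) (drop r xs)) = length (filter (\<lambda>m. k \<le> m) xs) - r"
  using assms
proof (induction xs arbitrary: r)
  case (Cons x xs)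
  have sorted: "sorted (rev xs)" and le: "\<And>y. y \<in> set xs \<Longrightarrow> y \<le> x"
    using Cons.prems by (auto simp: sorted_append)
  show ?case
  proof (cases r)
    case (Suc q)
    show ?thesis
    proof (cases "k \<le> x")
      case True
      then show ?thesis using Cons.IH[OF sorted, of q] Suc by simp
    next
      case False
      then have "filter (\<lambda>m. k \<le> m) xs = []" using le by (fastforce simp: filter_empty_conv)
      then show ?thesis using Cons.IH[OF sorted, of q] Suc False by simp
    qed
  qed simp
qed simp

lemma sum_list_eq_sum_count_ge:
  assumes "\<And>x. x \<in> set xs \<Longrightarrow> x \<le> N"
  shows "sum_list xs = (\<Sum>k = 1..N. length (filter (\<lambda>m. k \<le> m) xs))"
  using assms
proof (induction xs)
  case (Cons x xs)
  have "(\<Sum>k = 1..N. if k \<le> x then 1 else 0) = card {k \<in> {1..N}. k \<le> x}"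
    by (simp add: sum.If_cases Int_def)
  also have "{k \<in> {1..N}. k \<le> x} = {1..x}" using Cons.prems[of x] by auto
  finally have x: "(\<Sum>k = 1..N. if k \<le> x then 1 else 0) = x" by simp
  have "(\<Sum>k = 1..N. length (filter (\<lambda>m. k \<le> m) (x # xs))) =
      (\<Sum>k = 1..N. (if k \<le> x then 1 else 0) + length (filter (\<lambda>m. k \<le> m) xs))"
    by (intro sum.cong) auto
  then show ?case using Cons x by (simp add: sum.distrib)
qed simp

text \<open>The multiplicity of \<open>k\<close> in a list is the number of entries at least \<open>k\<close> minus the number of entries
at least \<open>k + 1\<close>.\<close>

lemma eq_if_count_ge_eq:
  assumes "sorted (rev xs)" "sorted (rev ys)" "0 \<notin> set xs" "0 \<notin> set ys"
    and eq: "\<And>k. 0 < k \<Longrightarrow> length (filter (\<lambda>m. k \<le> m) xs) = length (filter (\<lambda>m. k \<le> m) ys)"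
  shows "xs = (ys :: nat list)"
proof -
  have split: "length (filter (\<lambda>m. k \<le> m) zs) = count (mset zs) k + length (filter (\<lambda>m. Suc k \<le> m) zs)"
    for k and zs :: "nat list"
    by (induction zs) auto
  have "count (mset xs) k = count (mset ys) k" for k
  proof (cases "k = 0")
    case True
    then show ?thesis using assms by (simp add: count_eq_zero_iff[THEN iffD2])
  next
    case False
    then show ?thesis using split[of k xs] split[of k ys] eq[of k] eq[of "Suc k"] by simp
  qed
  then have "mset (rev xs) = mset (rev ys)" by (simp add: multiset_eq_iff)
  then have "rev xs = rev ys" using assms(1,2) by (metis properties_for_sort)
  then show ?thesis by simp
qed

text \<open>The frames give, for each \<open>k\<close>, at least as many multiplicities \<open>\<ge> k\<close> in \<open>ms\<close> as in \<open>drop r ns\<close>.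
Summing over \<open>k\<close> bounds the order of the determinant, and equality of the sums forces equality for
each \<open>k\<close>.\<close>

lemma interlacing:
  assumes L: "L \<in> carrier_mat n n" and M: "M \<in> carrier_mat n n"
    and frames: "\<And>k d. root_frame L \<mu> k d \<Longrightarrow> root_frame M \<mu> k (d - r)"
    and ns: "finite_partial_multiplicities L \<mu> ns" and ms: "finite_partial_multiplicities M \<mu> ms"
  shows "sum_list (drop r ns) \<le> order \<mu> (det M)"
    and "order \<mu> (det M) \<le> sum_list (drop r ns) \<Longrightarrow> ms = drop r ns"
proof -
  note pL = finite_partial_multiplicities_profile[OF L ns]
  note pM = finite_partial_multiplicities_profile[OF M ms]
  let ?c = "\<lambda>k xs. length (filter (\<lambda>m. k \<le> m) xs)"
  have le: "?c k (drop r ns) \<le> ?c k ms" if "0 < k" for k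
    using frames[of k "?c k ns"] pL(5)[OF that] pM(5)[OF that] by (simp add: count_ge_drop[OF pL(1)])
  define N where "N = sum_list ns + sum_list ms"
  have ns_N: "x \<le> N" if "x \<in> set (drop r ns)" for x
    using member_le_sum_list[of x ns] set_drop_subset[of r ns] that by (auto simp: N_def)
  have ms_N: "x \<le> N" if "x \<in> set ms" for x
    using member_le_sum_list[of x ms] that by (auto simp: N_def)
  have sum_ns: "sum_list (drop r ns) = (\<Sum>k = 1..N. ?c k (drop r ns))"
    by (rule sum_list_eq_sum_count_ge[OF ns_N])
  have sum_ms: "sum_list ms = (\<Sum>k = 1..N. ?c k ms)"
    by (rule sum_list_eq_sum_count_ge[OF ms_N])
  show "sum_list (drop r ns) \<le> order \<mu> (det M)"
    unfolding pM(4) sum_ns sum_ms by (intro sum_mono le) auto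
  assume "order \<mu> (det M) \<le> sum_list (drop r ns)"
  then have sum_le: "(\<Sum>k = 1..N. ?c k ms) \<le> (\<Sum>k = 1..N. ?c k (drop r ns))"
    unfolding pM(4) sum_ns sum_ms .
  show "ms = drop r ns"
  proof (rule eq_if_count_ge_eq)
    show "sorted (rev ms)" "0 \<notin> set ms" by (rule pM(1), rule pM(2))
    show "0 \<notin> set (drop r ns)" using pL(2) set_drop_subset[of r ns] by auto
    show "sorted (rev (drop r ns))" using pL(1) by (simp add: rev_drop sorted_wrt_take)
    fix k :: nat assume k: "0 < k"
    show "?c k ms = ?c k (drop r ns)"
    proof (cases "k \<le> N")
      case True
      show ?thesis
      proof (rule ccontr)
        assume "?c k ms \<noteq> ?c k (drop r ns)"
        then have "?c k (drop r ns) < ?c k ms" using le[OF k] by simp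
        then have "(\<Sum>k = 1..N. ?c k (drop r ns)) < (\<Sum>k = 1..N. ?c k ms)"
          using k True le by (intro sum_strict_mono_ex1) auto
        then show False using sum_le by simp
      qed
    next
      case False
      then have "filter (\<lambda>m. k \<le> m) ms = []" "filter (\<lambda>m. k \<le> m) (drop r ns) = []"
        using ns_N ms_N by (fastforce simp: filter_empty_conv)+
      then show ?thesis by simp
    qed
  qed
qed

section \<open>A good perturbation of rank two\<close>

text \<open>Let \<open>x\<close> be a root vector for the largest multiplicity \<open>n\<^sub>1\<close>. In \<open>adj(L) (L x) = det L * x\<close> the factor
\<open>L x\<close> contributes \<open>t ^ n\<^sub>1\<close>, while \<open>x\<close> does not vanish at \<open>\<mu>\<close>; if \<open>adj(L)\<close> contributed more
than the order of \<open>det L\<close> minus \<open>n\<^sub>1\<close>, the left side would vanish to too high an order.\<close>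

lemma adj_mat_entry_low_order:
  assumes L: "L \<in> carrier_mat n n" and ns: "finite_partial_multiplicities L \<mu> ns" and "ns \<noteq> []"
  shows "\<exists>p<n. \<exists>q<n. \<not> [:-\<mu>, 1:] ^ Suc (sum_list ns - hd ns) dvd adj_mat L $$ (p, q)"
proof (rule ccontr)
  assume "\<not> ?thesis"
  then have adj: "dvd_mat ([:-\<mu>, 1:] ^ Suc (sum_list ns - hd ns)) (adj_mat L)"
    using adj_mat(1)[OF L] by (auto simp: dvd_mat_def)
  note prof = finite_partial_multiplicities_profile[OF L ns]
  obtain n1 rest where ns_eq: "ns = n1 # rest" using \<open>ns \<noteq> []\<close> by (cases ns) auto
  have n1: "0 < n1" using prof(2) by (simp add: ns_eq)
  have "root_frame L \<mu> n1 1" using prof(5)[OF n1] by (simp add: ns_eq)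
  then obtain X Z where X: "X \<in> carrier_mat n 1" and Z: "Z \<in> carrier_mat 1 n"
    and dvd: "dvd_mat ([:-\<mu>, 1:] ^ n1) (L * X)" and inv: "Z * eval_mat \<mu> X = 1\<^sub>m 1"
    using L by (auto simp: root_frame_def)
  have LX: "L * X \<in> carrier_mat n 1" using L X by simp
  have adj_dvd: "[:-\<mu>, 1:] ^ Suc (sum_list ns - hd ns) dvd adj_mat L $$ (i, j)" if "i < n" "j < n" for i j
    using adj that unfolding dvd_mat_def carrier_matD[OF adj_mat(1)[OF L]] by blast
  have LX_dvd: "[:-\<mu>, 1:] ^ n1 dvd (L * X) $$ (j, 0)" if "j < n" for j
    using dvd that unfolding dvd_mat_def carrier_matD[OF LX] by simp
  have adjLX: "adj_mat L * (L * X) = det L \<cdot>\<^sub>m X"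
  proof -
    have "adj_mat L * (L * X) = adj_mat L * L * X"
      using assoc_mult_mat[OF adj_mat(1)[OF L] L X] by simp
    then show ?thesis unfolding adj_mat(3)[OF L] using X by (simp add: mult_smult_assoc_mat[of _ n n _ 1])
  qed
  have "poly (X $$ (i, 0)) \<mu> = 0" if i: "i < n" for i
  proof (rule ccontr)
    assume nz: "poly (X $$ (i, 0)) \<mu> \<noteq> 0"
    have "[:-\<mu>, 1:] ^ Suc (sum_list ns - hd ns) * [:-\<mu>, 1:] ^ n1 dvd (adj_mat L * (L * X)) $$ (i, 0)"
    proof -
      have "(adj_mat L * (L * X)) $$ (i, 0) = (\<Sum>j<n. adj_mat L $$ (i, j) * (L * X) $$ (j, 0))"
        using i adj_mat(1)[OF L] L X by (auto simp: scalar_prod_def atLeast0LessThan)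
      also have "[:-\<mu>, 1:] ^ Suc (sum_list ns - hd ns) * [:-\<mu>, 1:] ^ n1 dvd \<dots>"
        using adj_dvd LX_dvd i by (intro dvd_sum mult_dvd_mono) simp_all
      finally show ?thesis .
    qed
    then have "[:-\<mu>, 1:] ^ (Suc (sum_list ns - hd ns) + n1) dvd det L * X $$ (i, 0)"
      unfolding adjLX power_add using X i by simp
    moreover have nz': "det L * X $$ (i, 0) \<noteq> 0" using prof(3) nz by auto
    ultimately have "Suc (sum_list ns - hd ns) + n1 \<le> order \<mu> (det L * X $$ (i, 0))"
      by (simp only: order_divides) simp
    also have "\<dots> = sum_list ns" using order_mult[OF nz'] prof(4) nz by (simp add: order_0I)
    finally show False by (simp add: ns_eq)
  qed
  then have "(Z * eval_mat \<mu> X) $$ (0, 0) = 0" using X Z by (simp add: scalar_prod_def)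
  then show False by (simp add: inv)
qed

text \<open>The derivative of \<open>p / D\<close> is zero, so this quotient is constant, and it has a zero.\<close>

lemma eq_0_if_wronskian_eq_0:
  fixes D p :: "complex poly"
  assumes wr: "D * pderiv p = pderiv D * p" and D: "poly D \<mu> \<noteq> 0" and p: "poly p \<mu> = 0"
  shows "p = 0"
proof (rule ccontr)
  assume p0: "p \<noteq> 0"
  have "pderiv p \<noteq> 0"
  proof
    assume "pderiv p = 0"
    then have "degree p = 0" by (simp add: pderiv_eq_0_iff)
    then obtain c where "p = [:c:]" by (auto elim: degree_eq_zeroE)
    then show False using p p0 by simp
  qed
  moreover have "D \<noteq> 0" using D by auto
  ultimately have nz: "D * pderiv p \<noteq> 0" by simp
  have ord: "order \<mu> p = Suc (order \<mu> (pderiv p))" by (rule order_pderiv[OF p0 p])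
  have "order \<mu> (D * pderiv p) = order \<mu> (pderiv p)" using order_mult[OF nz] D by (simp add: order_0I)
  moreover have "order \<mu> (pderiv D * p) = order \<mu> (pderiv D) + order \<mu> p"
    using nz wr by (intro order_mult) auto
  ultimately show False using wr ord by simp
qed

text \<open>At an eigenvalue \<open>det L\<close> has order \<open>n\<^sub>1 + n\<^sub>2 + \<dots>\<close>, which exceeds the order of \<open>g\<close>, so
\<open>det L + g\<close> has order at most \<open>n\<^sub>2 + n\<^sub>3 + \<dots>\<close>. Comparing orders, \<open>f\<close> has order at most
\<open>2 (n\<^sub>2 + n\<^sub>3 + \<dots>) - (n\<^sub>1 + n\<^sub>2 + \<dots>)\<close>, and \<open>n\<^sub>2 \<le> n\<^sub>1\<close>.\<close>

lemma skew_update_order_bound: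
  assumes L: "L \<in> carrier_mat n n" and ns: "finite_partial_multiplicities L \<mu> ns"
    and f: "det L * f = (det L + g) ^ 2" and nz: "det L + g \<noteq> 0"
    and g: "ns = [] \<Longrightarrow> poly (det L + g) \<mu> \<noteq> 0"
      "ns \<noteq> [] \<Longrightarrow> \<not> [:-\<mu>, 1:] ^ Suc (sum_list ns - hd ns) dvd g"
  shows "order \<mu> f \<le> sum_list (drop 2 ns)"
proof -
  note prof = finite_partial_multiplicities_profile[OF L ns]
  have "det L * f \<noteq> 0" unfolding f using nz by simp
  then have "order \<mu> (det L) + order \<mu> f = order \<mu> ((det L + g) ^ 2)"
    unfolding f[symmetric] by (rule order_mult[symmetric])
  also have "\<dots> = 2 * order \<mu> (det L + g)"
    using nz by (simp add: power2_eq_square order_mult)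
  finally have eq: "sum_list ns + order \<mu> f = 2 * order \<mu> (det L + g)" by (simp add: prof(4))
  show ?thesis
  proof (cases ns)
    case Nil
    then show ?thesis using eq g(1) by (simp add: order_0I)
  next
    case (Cons n1 rest)
    have n1: "0 < n1" using prof(2) by (simp add: Cons)
    define a where "a = sum_list ns - hd ns"
    have a: "a = sum_list rest" by (simp add: a_def Cons)
    have "[:-\<mu>, 1:] ^ Suc a dvd det L"
      using n1 prof(3,4) by (simp only: order_divides) (simp add: a Cons)
    then have "\<not> [:-\<mu>, 1:] ^ Suc a dvd det L + g"
      using g(2) unfolding a_def[symmetric] by (simp only: dvd_add_right_iff) (simp add: Cons)
    then have "order \<mu> (det L + g) \<le> a" by (simp only: order_divides) simp
    then have le: "order \<mu> f + n1 \<le> sum_list rest" using eq by (simp add: a Cons)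
    show ?thesis
    proof (cases rest)
      case Nil
      then show ?thesis using le by (simp add: Cons)
    next
      case (Cons n2 rest')
      have "n2 \<le> n1" using prof(1) by (simp add: \<open>ns = n1 # rest\<close> Cons sorted_append)
      then show ?thesis using le by (simp add: \<open>ns = n1 # rest\<close> Cons)
    qed
  qed
qed

lemma generic_scaling:
  assumes "finite E"
  obtains c :: complex where "c \<noteq> 0" "\<And>x y. (x, y) \<in> E \<Longrightarrow> x \<noteq> 0 \<Longrightarrow> x + c * y \<noteq> 0"
proof -
  have "finite (insert 0 ((\<lambda>(x, y). - x / y) ` E))" using assms by simp
  then obtain c where c: "c \<notin> insert 0 ((\<lambda>(x, y). - x / y) ` E)"
    using infinite_UNIV_char_0[where 'a = complex] ex_new_if_finite by blast
  have "x + c * y \<noteq> 0" if "(x, y) \<in> E" "x \<noteq> 0" for x y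
  proof
    assume 0: "x + c * y = 0"
    then have "y \<noteq> 0" using that by auto
    then have "c = - x / y" using 0 by (simp add: field_simps eq_neg_iff_add_eq_0 add.commute)
    then show False using c that by force
  qed
  then show ?thesis using that c by blast
qed

definition const_vec :: "nat \<Rightarrow> complex vec \<Rightarrow> complex poly vec" where
  "const_vec n v = vec n (\<lambda>i. [:v $ i:])"

definition linear_vec :: "nat \<Rightarrow> complex vec \<Rightarrow> complex vec \<Rightarrow> complex poly vec" where
  "linear_vec n \<gamma> \<delta> = vec n (\<lambda>i. [:\<gamma> $ i, \<delta> $ i:])"

lemma const_vec_carrier [simp]: "const_vec n v \<in> carrier_vec n"
  and linear_vec_carrier [simp]: "linear_vec n \<gamma> \<delta> \<in> carrier_vec n"
  by (simp_all add: const_vec_def linear_vec_def)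

lemma pencil_add_skew_outer:
  assumes "A \<in> carrier_mat n n" "B \<in> carrier_mat n n"
  shows "pencil A B + skew_outer n (const_vec n v) (linear_vec n \<gamma> \<delta>) =
    pencil (A + skew_outer n v \<gamma>) (B + skew_outer n v \<delta>)"
  using assms
  by (intro eq_matI) (auto simp: pencil_def skew_outer_def const_vec_def linear_vec_def algebra_simps)

lemma pencil_skew:
  assumes "A \<in> carrier_mat n n" "B \<in> carrier_mat n n" "A\<^sup>T = - A" "B\<^sup>T = - B"
  shows "(pencil A B)\<^sup>T = - pencil A B"
proof (intro eq_matI)
  fix i j assume "i < dim_row (- pencil A B)" "j < dim_col (- pencil A B)"
  then have ij: "i < n" "j < n" using assms by (auto simp: pencil_def)
  have "A $$ (j, i) = - A $$ (i, j)" "B $$ (j, i) = - B $$ (i, j)"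
    using arg_cong[OF assms(3), of "\<lambda>M. M $$ (i, j)"] arg_cong[OF assms(4), of "\<lambda>M. M $$ (i, j)"]
      assms(1,2) ij by auto
  then show "(pencil A B)\<^sup>T $$ (i, j) = (- pencil A B) $$ (i, j)"
    using assms(1,2) ij by (simp add: pencil_def)
qed (use assms in \<open>auto simp: pencil_def\<close>)

lemma add_skew_outer_skew:
  assumes "A \<in> carrier_mat n n" "A\<^sup>T = - A"
  shows "(A + skew_outer n v w)\<^sup>T = - (A + skew_outer n v w)"
proof (intro eq_matI)
  fix i j assume "i < dim_row (- (A + skew_outer n v w))" "j < dim_col (- (A + skew_outer n v w))"
  then have ij: "i < n" "j < n" by auto
  have "A $$ (j, i) = - A $$ (i, j)"
    using arg_cong[OF assms(2), of "\<lambda>M. M $$ (i, j)"] assms(1) ij by auto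
  then show "(A + skew_outer n v w)\<^sup>T $$ (i, j) = (- (A + skew_outer n v w)) $$ (i, j)"
    using assms(1) ij by (simp add: skew_outer_def)
qed (use assms in auto)

lemma polyfun_poly_linear:
  assumes "polyfun m f" "polyfun m g"
  shows "polyfun_poly m (\<lambda>x. [:f x, g x:])"
proof -
  have eq: "(\<lambda>x. [:f x, g x:]) = (\<lambda>x. [:f x:] + [:g x:] * [:0, 1:])" by auto
  show ?thesis unfolding eq
    using assms by (intro polyfun_poly_add polyfun_poly_mult polyfun_poly_of_polyfun polyfun_poly_const)
qed

text \<open>An entry \<open>(p, q)\<close> of the adjugate of low order is the value of the form at two unit vectors. The
offsets \<open>e1\<close> and \<open>e2\<close> locate the constant and the linear coefficients of \<open>w\<close> among the
parameters; reversing the pencil exchanges them.\<close>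

lemma generically_adj_form_low_order:
  assumes L: "L \<in> carrier_mat n n" and ns: "finite_partial_multiplicities L \<mu> ns" "ns \<noteq> []"
    and offsets: "(e1, e2) = (n, 2 * n) \<or> (e1, e2) = (2 * n, n)"
    and k: "k = Suc (sum_list ns - hd ns)"
  shows "generically (3 * n) (\<lambda>x. \<not> [:-\<mu>, 1:] ^ k dvd
      adj_form L (vec n (\<lambda>i. [:x $ (e1 + i), x $ (e2 + i):])) (vec n (\<lambda>i. [:x $ i:])))"
proof -
  define G where "G x = adj_form L (vec n (\<lambda>i. [:x $ (e1 + i), x $ (e2 + i):])) (vec n (\<lambda>i. [:x $ i:]))"
    for x :: "complex vec"
  have G_eq: "G x = (\<Sum>i<n. \<Sum>j<n. [:x $ (e1 + i), x $ (e2 + i):] * adj_mat L $$ (i, j) * [:x $ j:])" for x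
    unfolding G_def adj_form_def using L by (intro sum.cong) auto
  have G_poly: "polyfun_poly (3 * n) G"
    unfolding G_eq[abs_def] using offsets
    by (intro polyfun_poly_sum polyfun_poly_mult polyfun_poly_linear polyfun_poly_of_polyfun
        polyfun_poly_const polyfun_index) auto
  obtain p q where pq: "p < n" "q < n" "\<not> [:-\<mu>, 1:] ^ k dvd adj_mat L $$ (p, q)"
    using adj_mat_entry_low_order[OF L ns] k by auto
  define x0 where "x0 = vec (3 * n) (\<lambda>i. if i = q \<or> i = e1 + p then 1 else 0 :: complex)"
  have x0: "x0 $ j = (if j = q then 1 else 0)" "x0 $ (e1 + j) = (if j = p then 1 else 0)"
    "x0 $ (e2 + j) = 0" if "j < n" for j
    using offsets that pq(1,2) by (auto simp: x0_def)
  have "G x0 = (\<Sum>i<n. \<Sum>j<n. if j = q then if i = p then adj_mat L $$ (i, j) else 0 else 0)"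
    unfolding G_eq by (intro sum.cong) (auto simp: x0)
  also have "\<dots> = adj_mat L $$ (p, q)" using pq(1,2) by simp
  finally have "\<not> [:-\<mu>, 1:] ^ k dvd G x0" using pq(3) by simp
  moreover have "x0 \<in> carrier_vec (3 * n)" by (simp add: x0_def)
  ultimately have "generically (3 * n) (\<lambda>x. \<not> [:-\<mu>, 1:] ^ k dvd G x)"
    using generically_not_power_dvd[OF G_poly] by blast
  then show ?thesis unfolding G_def .
qed

lemma adj_form_smult_right:
  assumes L: "L \<in> carrier_mat n n" and v: "v \<in> carrier_vec n"
  shows "adj_form L w (const_vec n (c \<cdot>\<^sub>v v)) = Polynomial.smult c (adj_form L w (const_vec n v))"
proof -
  have "adj_form L w (const_vec n (c \<cdot>\<^sub>v v)) =
      (\<Sum>i<n. \<Sum>j<n. [:c:] * (w $ i * adj_mat L $$ (i, j) * const_vec n v $ j))"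
    unfolding adj_form_def using assms
    by (intro sum.cong) (auto simp: const_vec_def algebra_simps)
  also have "\<dots> = [:c:] * adj_form L w (const_vec n v)"
    unfolding adj_form_def sum_distrib_left using assms by simp
  finally show ?thesis by simp
qed

text \<open>A multiple zero \<open>\<mu>\<close> of \<open>D + c g\<close> outside the zeros of \<open>D\<close> is a critical point of \<open>g / D\<close>, that
is, a zero of the Wronskian; if the Wronskian vanishes identically, so does \<open>D + c g\<close>.\<close>

lemma order_le_2_off_spectrum:
  fixes D f g :: "complex poly"
  assumes f: "D * f = (D + Polynomial.smult c g) ^ 2" and nz: "D + Polynomial.smult c g \<noteq> 0"
    and c: "c \<noteq> 0" and D: "poly D \<mu> \<noteq> 0"
    and wr: "D * pderiv g - pderiv D * g \<noteq> 0 \<Longrightarrow> poly (D * pderiv g - pderiv D * g) \<mu> = 0 \<Longrightarrow>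
      poly (D + Polynomial.smult c g) \<mu> \<noteq> 0"
  shows "order \<mu> f \<le> 2"
proof -
  define p where "p = D + Polynomial.smult c g"
  have p0: "p \<noteq> 0" using nz by (simp add: p_def)
  have "D * f \<noteq> 0" unfolding f using nz by simp
  then have "order \<mu> D + order \<mu> f = order \<mu> (p ^ 2)"
    unfolding p_def f[symmetric] by (rule order_mult[symmetric])
  also have "\<dots> = 2 * order \<mu> p" using p0 by (simp add: power2_eq_square order_mult)
  finally have eq: "order \<mu> f = 2 * order \<mu> p" using D by (simp add: order_0I)
  have wr_p: "D * pderiv p - pderiv D * p = Polynomial.smult c (D * pderiv g - pderiv D * g)"
    by (simp add: p_def pderiv_add pderiv_smult algebra_simps smult_diff_right)
  have "order \<mu> p \<le> 1"
  proof (rule ccontr)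
    assume "\<not> order \<mu> p \<le> 1"
    then have "2 \<le> order \<mu> p" by simp
    then have root: "poly p \<mu> = 0" using p0 by (simp add: order_root)
    have root': "poly (pderiv p) \<mu> = 0"
    proof (cases "pderiv p = 0")
      case False
      have "order \<mu> p = Suc (order \<mu> (pderiv p))" by (rule order_pderiv[OF p0 root])
      then show ?thesis using False \<open>2 \<le> order \<mu> p\<close> by (simp add: order_root)
    qed simp
    have "poly (D * pderiv p - pderiv D * p) \<mu> = 0" using root root' by simp
    then have "poly (D * pderiv g - pderiv D * g) \<mu> = 0" unfolding wr_p using c by simp
    then have "D * pderiv g - pderiv D * g = 0" using wr root by (auto simp: p_def)
    then have "D * pderiv p = pderiv D * p" using wr_p by simp
    then show False using eq_0_if_wronskian_eq_0[OF _ D root] p0 by simp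
  qed
  then show ?thesis using eq by simp
qed

text \<open>A generic parameter makes the form \<open>g\<close> vanish to low order at all points of \<open>T\<close> and at infinity.
Scaling \<open>v\<close> does not affect these orders, and it leaves the freedom to avoid finitely many values.\<close>

lemma good_rank_two_perturbation:
  assumes A: "A \<in> carrier_mat n n" "A\<^sup>T = - A" and B: "B \<in> carrier_mat n n" "B\<^sup>T = - B"
    and T: "finite T" "\<And>\<mu>. \<mu> \<in> T \<Longrightarrow> finite_partial_multiplicities (pencil A B) \<mu> (ns \<mu>)"
    and reg: "det (pencil A B) \<noteq> 0"
    and ns': "finite_partial_multiplicities (pencil B A) 0 ns'"
  obtains v \<gamma> \<delta> where "v \<in> carrier_vec n" "\<gamma> \<in> carrier_vec n" "\<delta> \<in> carrier_vec n"
    "det (pencil (A + skew_outer n v \<gamma>) (B + skew_outer n v \<delta>)) \<noteq> 0"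
    "\<And>\<mu>. \<mu> \<in> T \<Longrightarrow> order \<mu> (det (pencil (A + skew_outer n v \<gamma>) (B + skew_outer n v \<delta>)))
      \<le> sum_list (drop 2 (ns \<mu>))"
    "order 0 (det (pencil (B + skew_outer n v \<delta>) (A + skew_outer n v \<gamma>))) \<le> sum_list (drop 2 ns')"
    "\<And>\<mu>. poly (det (pencil A B)) \<mu> \<noteq> 0 \<Longrightarrow>
      order \<mu> (det (pencil (A + skew_outer n v \<gamma>) (B + skew_outer n v \<delta>))) \<le> 2"
proof -
  define L L' where "L = pencil A B" and "L' = pencil B A"
  have L: "L \<in> carrier_mat n n" and L': "L' \<in> carrier_mat n n" using A B by (simp_all add: L_def L'_def)
  define D D' where "D = det L" and "D' = det L'"
  have D: "D \<noteq> 0" using reg by (simp add: D_def L_def)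
  have D': "D' \<noteq> 0"
    using finite_partial_multiplicities_profile(3)[OF L' ns'[folded L'_def]] by (simp add: D'_def)
  note T = T(1) T(2)[folded L_def]
  note ns' = ns'[folded L'_def]
  let ?\<gamma> = "\<lambda>x. subvector n x 1" and ?\<delta> = "\<lambda>x. subvector n x 2" and ?v = "\<lambda>x. subvector n x 0"
  define G where "G x = adj_form L (linear_vec n (?\<gamma> x) (?\<delta> x)) (const_vec n (?v x))" for x
  define G' where "G' x = adj_form L' (linear_vec n (?\<delta> x) (?\<gamma> x)) (const_vec n (?v x))" for x
  have vecs: "linear_vec n (?\<gamma> x) (?\<delta> x) = vec n (\<lambda>i. [:x $ (n + i), x $ (2 * n + i):])"
    "linear_vec n (?\<delta> x) (?\<gamma> x) = vec n (\<lambda>i. [:x $ (2 * n + i), x $ (n + i):])"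
    "const_vec n (?v x) = vec n (\<lambda>i. [:x $ i:])" for x
    by (auto simp: linear_vec_def const_vec_def subvector_def)
  have "generically (3 * n) (\<lambda>x. \<not> [:-\<mu>, 1:] ^ Suc (sum_list (ns \<mu>) - hd (ns \<mu>)) dvd G x)"
    if "\<mu> \<in> {\<mu> \<in> T. ns \<mu> \<noteq> []}" for \<mu>
    using generically_adj_form_low_order[OF L T(2) _ disjI1[OF refl] refl, of \<mu>] that
    unfolding G_def vecs by blast
  then have "generically (3 * n) (\<lambda>x. \<forall>\<mu>\<in>{\<mu> \<in> T. ns \<mu> \<noteq> []}.
      \<not> [:-\<mu>, 1:] ^ Suc (sum_list (ns \<mu>) - hd (ns \<mu>)) dvd G x)"
    using T(1) by (intro generically_ball) auto
  moreover have "generically (3 * n) (\<lambda>x. \<not> [:-0, 1:] ^ Suc (sum_list ms - hd ms) dvd G' x)"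
    if "ms \<in> {ns'} - {[]}" for ms
    using generically_adj_form_low_order[OF L' ns' _ disjI2[OF refl] refl] that
    unfolding G'_def vecs by blast
  then have "generically (3 * n) (\<lambda>x. \<forall>ms\<in>{ns'} - {[]}.
      \<not> [:-0, 1:] ^ Suc (sum_list ms - hd ms) dvd G' x)"
    by (intro generically_ball) auto
  ultimately obtain x where x: "\<forall>\<mu>\<in>{\<mu> \<in> T. ns \<mu> \<noteq> []}.
      \<not> [:-\<mu>, 1:] ^ Suc (sum_list (ns \<mu>) - hd (ns \<mu>)) dvd G x"
    "\<forall>ms\<in>{ns'} - {[]}. \<not> [:-0, 1:] ^ Suc (sum_list ms - hd ms) dvd G' x"
    using generically_obtain[OF generically_conj] by blast
  define g g' where "g = G x" and "g' = G' x"
  have goodT: "\<not> [:-\<mu>, 1:] ^ Suc (sum_list (ns \<mu>) - hd (ns \<mu>)) dvd g" if "\<mu> \<in> T" "ns \<mu> \<noteq> []" for \<mu>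
    using x(1) that by (simp only: g_def) blast
  have good0: "\<not> [:-0, 1:] ^ Suc (sum_list ns' - hd ns') dvd g'" if "ns' \<noteq> []"
    using x(2) that by (simp only: g'_def) blast
  define H where "H = D * pderiv g - pderiv D * g"
  obtain \<mu>0 where \<mu>0: "poly D \<mu>0 \<noteq> 0" using D poly_all_0_iff_0 by blast
  obtain \<mu>1 where \<mu>1: "poly D' \<mu>1 \<noteq> 0" using D' poly_all_0_iff_0 by blast
  \<comment> \<open>At the points of \<open>R\<close> and at infinity \<open>det L + c g\<close> has to be nonzero whenever \<open>det L\<close> is: points
    of \<open>T\<close> outside the spectrum, critical points of \<open>g / det L\<close>, and \<open>\<mu>0\<close>. The points \<open>\<mu>0\<close> and,
    for the reversed pencil, \<open>\<mu>1\<close> keep the new determinants from vanishing identically.\<close>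
  define R where "R = insert \<mu>0 (T \<union> (if H = 0 then {} else {\<mu>. poly H \<mu> = 0}))"
  have "finite R" using T(1) poly_roots_finite[of H] by (simp add: R_def)
  define E where "E = (\<lambda>\<mu>. (poly D \<mu>, poly g \<mu>)) ` R \<union> (\<lambda>\<mu>. (poly D' \<mu>, poly g' \<mu>)) ` {0, \<mu>1}"
  have "finite E" using \<open>finite R\<close> by (simp add: E_def)
  then obtain c where c: "c \<noteq> 0" "\<And>x y. (x, y) \<in> E \<Longrightarrow> x \<noteq> 0 \<Longrightarrow> x + c * y \<noteq> 0"
    using generic_scaling by blast
  define p p' where "p = D + Polynomial.smult c g" and "p' = D' + Polynomial.smult c g'"
  have pR: "poly p \<mu> \<noteq> 0" if "\<mu> \<in> R" "poly D \<mu> \<noteq> 0" for \<mu>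
    using c(2)[of "poly D \<mu>" "poly g \<mu>"] that by (simp add: p_def E_def)
  have p'R: "poly p' \<mu> \<noteq> 0" if "\<mu> \<in> {0, \<mu>1}" "poly D' \<mu> \<noteq> 0" for \<mu>
    using c(2)[of "poly D' \<mu>" "poly g' \<mu>"] that by (auto simp: p'_def E_def)
  have p: "p \<noteq> 0" using pR[of \<mu>0] \<mu>0 by (auto simp: R_def)
  have p': "p' \<noteq> 0" using p'R[of \<mu>1] \<mu>1 by auto
  let ?v' = "c \<cdot>\<^sub>v ?v x"
  define M M' where "M = pencil (A + skew_outer n ?v' (?\<gamma> x)) (B + skew_outer n ?v' (?\<delta> x))"
    and "M' = pencil (B + skew_outer n ?v' (?\<delta> x)) (A + skew_outer n ?v' (?\<gamma> x))"
  have v: "?v x \<in> carrier_vec n" by (simp add: subvector_def)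
  have detM: "D * det M = p ^ 2"
    unfolding M_def pencil_add_skew_outer[OF A(1) B(1), symmetric] L_def[symmetric] D_def p_def g_def G_def
      adj_form_smult_right[OF L v, symmetric]
    using det_skew_outer_update[OF L] pencil_skew[OF A(1) B(1) A(2) B(2)] D by (simp add: L_def D_def)
  have detM': "D' * det M' = p' ^ 2"
    unfolding M'_def pencil_add_skew_outer[OF B(1) A(1), symmetric] L'_def[symmetric] D'_def p'_def g'_def
      G'_def adj_form_smult_right[OF L' v, symmetric]
    using det_skew_outer_update[OF L'] pencil_skew[OF B(1) A(1) B(2) A(2)] D' by (simp add: L'_def D'_def)
  have "det M \<noteq> 0" using detM p by auto
  moreover have "order \<mu> (det M) \<le> sum_list (drop 2 (ns \<mu>))" if \<mu>: "\<mu> \<in> T" for \<mu>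
  proof (rule skew_update_order_bound[OF L T(2)[OF \<mu>], of _ "Polynomial.smult c g"])
    show "det L * det M = (det L + Polynomial.smult c g) ^ 2" "det L + Polynomial.smult c g \<noteq> 0"
      using detM p by (simp_all add: D_def p_def)
    show "poly (det L + Polynomial.smult c g) \<mu> \<noteq> 0" if "ns \<mu> = []"
    proof -
      have "order \<mu> D = 0"
        using finite_partial_multiplicities_profile(4)[OF L T(2)[OF \<mu>]] that by (simp add: D_def)
      then have "poly D \<mu> \<noteq> 0" using D by (simp add: order_root)
      then show ?thesis using pR[of \<mu>] \<mu> by (simp add: p_def D_def R_def)
    qed
    show "\<not> [:-\<mu>, 1:] ^ Suc (sum_list (ns \<mu>) - hd (ns \<mu>)) dvd Polynomial.smult c g" if "ns \<mu> \<noteq> []"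
      using goodT[OF \<mu> that] c(1) dvd_smult_iff by blast
  qed
  moreover have "order 0 (det M') \<le> sum_list (drop 2 ns')"
  proof (rule skew_update_order_bound[OF L' ns', of _ "Polynomial.smult c g'"])
    show "det L' * det M' = (det L' + Polynomial.smult c g') ^ 2" "det L' + Polynomial.smult c g' \<noteq> 0"
      using detM' p' by (simp_all add: D'_def p'_def)
    show "poly (det L' + Polynomial.smult c g') 0 \<noteq> 0" if "ns' = []"
    proof -
      have "order 0 D' = 0"
        using finite_partial_multiplicities_profile(4)[OF L' ns'] that by (simp add: D'_def)
      then have "poly D' 0 \<noteq> 0" using D' by (simp add: order_root)
      then show ?thesis using p'R[of 0] by (simp add: p'_def D'_def)
    qed
    show "\<not> [:-0, 1:] ^ Suc (sum_list ns' - hd ns') dvd Polynomial.smult c g'" if "ns' \<noteq> []"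
      using good0[OF that] c(1) dvd_smult_iff by blast
  qed
  moreover have "order \<mu> (det M) \<le> 2" if "poly (det (pencil A B)) \<mu> \<noteq> 0" for \<mu>
  proof (rule order_le_2_off_spectrum[OF _ _ c(1)])
    show "D * det M = (D + Polynomial.smult c g) ^ 2" "D + Polynomial.smult c g \<noteq> 0"
      using detM p by (simp_all add: p_def)
    show "poly D \<mu> \<noteq> 0" using that by (simp add: D_def L_def)
    then show "poly (D + Polynomial.smult c g) \<mu> \<noteq> 0"
      if "D * pderiv g - pderiv D * g \<noteq> 0" "poly (D * pderiv g - pderiv D * g) \<mu> = 0"
      using pR[of \<mu>] that by (simp add: p_def R_def H_def)
  qed
  moreover have "?v' \<in> carrier_vec n" "?\<gamma> x \<in> carrier_vec n" "?\<delta> x \<in> carrier_vec n"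
    by (simp_all add: subvector_def)
  ultimately show ?thesis using that unfolding M_def M'_def by blast
qed

section \<open>The number of distinct roots is lower semicontinuous\<close>

lemma dvd_if_order_le:
  fixes p q :: "complex poly"
  assumes p: "p \<noteq> 0" and q: "q \<noteq> 0" and le: "\<And>z. order z p \<le> order z q"
  shows "p dvd q"
proof -
  have "proots p \<subseteq># proots q" using p q le by (simp add: subseteq_mset_def)
  then have "(\<Prod>x\<in>#proots p. [:-x, 1:]) dvd (\<Prod>x\<in>#proots q. [:-x, 1:])"
    by (intro prod_mset_subset_imp_dvd image_mset_subseteq_mono)
  then have "Polynomial.smult (lead_coeff p) (\<Prod>x\<in>#proots p. [:-x, 1:]) dvd
      Polynomial.smult (lead_coeff q) (\<Prod>x\<in>#proots q. [:-x, 1:])"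
    using p by (simp add: smult_dvd_iff dvd_smult)
  then show ?thesis unfolding complex_poly_decompose_multiset .
qed

lemma sum_order_eq_degree:
  fixes p :: "complex poly"
  assumes "p \<noteq> 0"
  shows "(\<Sum>z | poly p z = 0. order z p) = degree p"
proof -
  have "degree p = size (proots p)" by (simp add: size_proots_complex)
  also have "\<dots> = (\<Sum>z\<in>set_mset (proots p). count (proots p) z)" by (rule size_multiset_overloaded_eq)
  finally show ?thesis using assms by simp
qed

text \<open>Together with \<open>degree_syzygy_ge_card_roots\<close> this says that the least degree of a nonzero \<open>w\<close> with
\<open>u * f + w * pderiv f = 0\<close> for some \<open>u\<close> is the number of distinct roots of \<open>f\<close>. Having fewer than
\<open>K\<close> distinct roots is thus a linear dependence with coefficients depending polynomially on \<open>f\<close>.\<close>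

lemma poly_dvd_radical_mult_pderiv:
  fixes f :: "complex poly"
  assumes "f \<noteq> 0"
  shows "f dvd (\<Prod>z | poly f z = 0. [:-z, 1:]) * pderiv f"
proof (cases "pderiv f = 0")
  case False
  let ?w = "\<Prod>z | poly f z = 0. [:-z, 1:]"
  have fin: "finite {z. poly f z = 0}" using assms by (rule poly_roots_finite)
  have w: "?w \<noteq> 0" using fin by simp
  then have wf: "?w * pderiv f \<noteq> 0" using False by simp
  show ?thesis
  proof (rule dvd_if_order_le[OF assms wf])
    fix z
    show "order z f \<le> order z (?w * pderiv f)"
    proof (cases "poly f z = 0")
      case True
      then have "order z f = Suc (order z (pderiv f))" by (rule order_pderiv[OF assms])
      moreover have "poly ?w z = 0" using fin True by (auto simp: poly_prod)
      then have "order z ?w \<noteq> 0" using w by (simp add: order_root)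
      ultimately show ?thesis using order_mult[OF wf, of z] by simp
    qed (simp add: order_0I)
  qed
qed simp

lemma degree_syzygy_ge_card_roots:
  fixes f u w :: "complex poly"
  assumes f: "f \<noteq> 0" and eq: "u * f + w * pderiv f = 0" and w: "w \<noteq> 0"
  shows "card {z. poly f z = 0} \<le> degree w"
proof -
  have "{z. poly f z = 0} \<subseteq> {z. poly w z = 0}"
  proof
    fix z assume "z \<in> {z. poly f z = 0}"
    then have z: "poly f z = 0" by simp
    have ord: "order z f = Suc (order z (pderiv f))" by (rule order_pderiv[OF f z])
    have "pderiv f \<noteq> 0"
    proof
      assume "pderiv f = 0"
      then have "degree f = 0" by (simp add: pderiv_eq_0_iff)
      then show False using z f by (auto elim: degree_eq_zeroE)
    qed
    then have nz: "w * pderiv f \<noteq> 0" using w by simp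
    have "w * pderiv f = - u * f" using eq by (simp add: eq_neg_iff_add_eq_0 add.commute)
    then have "order z w + order z (pderiv f) = order z (- u) + order z f"
      using order_mult[OF nz, of z] nz order_mult[of "- u" f z] by simp
    then have "order z w \<noteq> 0" using ord by simp
    then show "z \<in> {z. poly w z = 0}" using w by (simp add: order_root)
  qed
  then have "card {z. poly f z = 0} \<le> card {z. poly w z = 0}"
    using poly_roots_finite[OF w] by (rule card_mono[rotated])
  also have "\<dots> \<le> degree w" using w by (rule card_poly_roots_bound)
  finally show ?thesis .
qed

text \<open>The map \<open>(u, w) \<mapsto> u * f + w * pderiv f\<close> on pairs of polynomials of degree less than \<open>K\<close>, for \<open>f\<close>
of degree at most \<open>N\<close>, in monomial coordinates.\<close>

definition syzygy_mat :: "nat \<Rightarrow> nat \<Rightarrow> complex poly \<Rightarrow> complex mat" where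
  "syzygy_mat N K f = mat (N + K) (2 * K)
    (\<lambda>(i, j). coeff (if j < K then monom 1 j * f else monom 1 (j - K) * pderiv f) i)"

lemma syzygy_mat_mult:
  assumes c: "c \<in> carrier_vec (2 * K)" and i: "i < N + K"
  shows "(syzygy_mat N K f *\<^sub>v c) $ i =
    coeff ((\<Sum>j<K. monom (c $ j) j) * f + (\<Sum>j<K. monom (c $ (K + j)) j) * pderiv f) i"
proof -
  let ?s = "\<lambda>j. coeff (if j < K then monom 1 j * f else monom 1 (j - K) * pderiv f) i * c $ j"
  have "(syzygy_mat N K f *\<^sub>v c) $ i = (\<Sum>j = 0..<2 * K. ?s j)"
    using c i by (auto simp: syzygy_mat_def scalar_prod_def index_mult_mat_vec)
  also have "\<dots> = (\<Sum>j = 0..<K. ?s j) + (\<Sum>j = K..<2 * K. ?s j)"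
    by (rule sum.atLeastLessThan_concat[symmetric]) simp_all
  also have "(\<Sum>j = K..<2 * K. ?s j) = (\<Sum>j = 0..<K. ?s (j + K))"
    using sum.shift_bounds_nat_ivl[of ?s 0 K K] by (simp add: mult_2)
  also have "(\<Sum>j = 0..<K. ?s j) = coeff ((\<Sum>j<K. monom (c $ j) j) * f) i"
    unfolding sum_distrib_right coeff_sum atLeast0LessThan
    by (intro sum.cong) (auto simp: coeff_monom_mult)
  also have "(\<Sum>j = 0..<K. ?s (j + K)) = coeff ((\<Sum>j<K. monom (c $ (K + j)) j) * pderiv f) i"
    unfolding sum_distrib_right coeff_sum atLeast0LessThan
    by (intro sum.cong) (auto simp: coeff_monom_mult add.commute)
  finally show ?thesis by simp
qed

text \<open>The conjugate transpose of \<open>S\<close> will do. With \<open>Z\<close> fixed, \<open>det (Z * S') \<noteq> 0\<close> certifies the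
injectivity of further matrices \<open>S'\<close> by one determinant instead of a family of minors.\<close>

lemma gram_det_nonzero:
  assumes S: "S \<in> carrier_mat m l"
    and inj: "\<And>c. c \<in> carrier_vec l \<Longrightarrow> S *\<^sub>v c = 0\<^sub>v m \<Longrightarrow> c = 0\<^sub>v l"
  obtains Z :: "complex mat" where "Z \<in> carrier_mat l m" "det (Z * S) \<noteq> 0"
proof
  define Z where "Z = mat l m (\<lambda>(j, i). cnj (S $$ (i, j)))"
  show Z: "Z \<in> carrier_mat l m" by (simp add: Z_def)
  show "det (Z * S) \<noteq> 0"
  proof
    assume "det (Z * S) = 0"
    then obtain c where c: "c \<in> carrier_vec l" "c \<noteq> 0\<^sub>v l" "Z * S *\<^sub>v c = 0\<^sub>v l"
      using det_0_iff_vec_prod_zero_field[of "Z * S" l] Z S by auto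
    define y where "y = S *\<^sub>v c"
    have y: "y \<in> carrier_vec m" unfolding y_def using S c(1) by (rule mult_mat_vec_carrier)
    have Zy: "Z *\<^sub>v y = 0\<^sub>v l" using c assoc_mult_mat_vec[OF Z S c(1)] by (simp add: y_def)
    have orth: "(\<Sum>i<m. cnj (S $$ (i, j)) * y $ i) = 0" if "j < l" for j
    proof -
      have "(Z *\<^sub>v y) $ j = (\<Sum>i<m. cnj (S $$ (i, j)) * y $ i)"
        using that y by (auto simp: Z_def scalar_prod_def index_mult_mat_vec atLeast0LessThan)
      then show ?thesis using that by (simp add: Zy)
    qed
    have "(\<Sum>i<m. cnj (y $ i) * y $ i) = (\<Sum>i<m. \<Sum>j<l. cnj (c $ j) * (cnj (S $$ (i, j)) * y $ i))"
    proof (intro sum.cong refl)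
      fix i assume "i \<in> {..<m}"
      then have "y $ i = (\<Sum>j<l. S $$ (i, j) * c $ j)"
        using S c(1) by (auto simp: y_def scalar_prod_def index_mult_mat_vec atLeast0LessThan)
      then have "cnj (y $ i) = (\<Sum>j<l. cnj (S $$ (i, j)) * cnj (c $ j))" by simp
      then show "cnj (y $ i) * y $ i = (\<Sum>j<l. cnj (c $ j) * (cnj (S $$ (i, j)) * y $ i))"
        by (simp only: sum_distrib_right) (simp add: mult_ac)
    qed
    also have "\<dots> = (\<Sum>j<l. cnj (c $ j) * (\<Sum>i<m. cnj (S $$ (i, j)) * y $ i))"
      unfolding sum_distrib_left by (rule sum.swap)
    also have "\<dots> = 0" by (simp add: orth)
    finally have "(\<Sum>i<m. cnj (y $ i) * y $ i) = 0" .
    moreover have "complex_of_real (\<Sum>i<m. (cmod (y $ i))\<^sup>2) = (\<Sum>i<m. cnj (y $ i) * y $ i)"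
      unfolding of_real_sum complex_norm_square by (simp only: mult.commute)
    ultimately have "complex_of_real (\<Sum>i<m. (cmod (y $ i))\<^sup>2) = 0" by simp
    then have "(\<Sum>i<m. (cmod (y $ i))\<^sup>2) = 0" by (simp only: of_real_eq_0_iff)
    then have "\<forall>i\<in>{..<m}. (cmod (y $ i))\<^sup>2 = 0" by (subst (asm) sum_nonneg_eq_0_iff) auto
    then have "S *\<^sub>v c = 0\<^sub>v m" using y unfolding y_def[symmetric] by (intro eq_vecI) auto
    then show False using inj c by blast
  qed
qed

lemma polyfun_det:
  assumes "\<And>x. M x \<in> carrier_mat n n"
    and "\<And>i j. i < n \<Longrightarrow> j < n \<Longrightarrow> polyfun m (\<lambda>x. M x $$ (i, j))"
  shows "polyfun m (\<lambda>x. det (M x))"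
proof -
  have eq: "(\<lambda>x. det (M x)) =
    (\<lambda>x. \<Sum>p | p permutes {0..<n}. signof p * (\<Prod>i = 0..<n. M x $$ (i, p i)))"
    using assms(1) by (auto simp: det_def')
  show ?thesis unfolding eq
    by (intro polyfun_sum polyfun_mult polyfun_prod assms polyfun_const)
      (auto simp: permutes_in_image)
qed

text \<open>At \<open>x0\<close> the syzygy matrix for \<open>K\<close>, the number of distinct roots there, is injective; wherever it stays
injective there are at least \<open>K\<close> distinct roots.\<close>

lemma generically_card_roots_ge:
  assumes F: "polyfun_poly m F" and x0: "x0 \<in> carrier_vec m" "F x0 \<noteq> 0"
  shows "generically m (\<lambda>x. F x \<noteq> 0 \<longrightarrow> card {z. poly (F x0) z = 0} \<le> card {z. poly (F x) z = 0})"
proof -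
  define K where "K = card {z. poly (F x0) z = 0}"
  obtain N where N: "\<And>x. degree (F x) \<le> N" using F by (auto simp: polyfun_poly_def)
  define S where "S x = syzygy_mat N K (F x)" for x
  have S: "S x \<in> carrier_mat (N + K) (2 * K)" for x by (simp add: S_def syzygy_mat_def)
  have inj: "c = 0\<^sub>v (2 * K)" if c: "c \<in> carrier_vec (2 * K)" and zero: "S x0 *\<^sub>v c = 0\<^sub>v (N + K)" for c
  proof (cases "K = 0")
    case False
    define u w where "u = (\<Sum>j<K. monom (c $ j) j)" and "w = (\<Sum>j<K. monom (c $ (K + j)) j)"
    have du: "degree u < K" and dw: "degree w < K"
      using False by (auto simp: u_def w_def intro!: degree_sum_less le_less_trans[OF degree_monom_le])
    have "degree (u * F x0) < N + K"
      using du N[of x0] degree_mult_le[of u "F x0"] by simp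
    moreover have "degree (w * pderiv (F x0)) < N + K"
      using dw N[of x0] degree_mult_le[of w "pderiv (F x0)"] by (simp add: degree_pderiv)
    ultimately have deg: "degree (u * F x0 + w * pderiv (F x0)) < N + K" by (rule degree_add_less)
    have syz: "u * F x0 + w * pderiv (F x0) = 0"
    proof (rule poly_eqI)
      fix i
      show "coeff (u * F x0 + w * pderiv (F x0)) i = coeff 0 i"
      proof (cases "i < N + K")
        case True
        then show ?thesis using syzygy_mat_mult[OF c True, of "F x0"] zero
          by (simp add: S_def u_def w_def)
      next
        case False
        then have "degree (u * F x0 + w * pderiv (F x0)) < i" using deg by simp
        then show ?thesis by (simp only: coeff_eq_0 coeff_0)
      qed
    qed
    have w0: "w = 0"
      using degree_syzygy_ge_card_roots[OF x0(2) syz] dw by (auto simp: K_def)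
    then have "u = 0" using syz x0(2) by simp
    have "c $ j = coeff u j" "c $ (K + j) = coeff w j" if "j < K" for j
      using that by (auto simp: u_def w_def coeff_sum)
    then have "c $ j = 0" if "j < 2 * K" for j
      using that \<open>u = 0\<close> w0 by (cases "j < K") (metis coeff_0, metis add_diff_inverse_nat coeff_0
          mult_2 nat_add_left_cancel_less)
    then show ?thesis using c by (intro eq_vecI) auto
  qed (use c in auto)
  obtain Z where Z: "Z \<in> carrier_mat (2 * K) (N + K)" "det (Z * S x0) \<noteq> 0"
    using gram_det_nonzero[OF S inj] by blast
  have "polyfun m (\<lambda>x. det (Z * S x))"
  proof (rule polyfun_det)
    show "Z * S x \<in> carrier_mat (2 * K) (2 * K)" for x using Z(1) S by simp
    fix i j assume ij: "i < 2 * K" "j < 2 * K"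
    have "(Z * S x) $$ (i, j) = (\<Sum>l<N + K. Z $$ (i, l) *
        coeff (if j < K then monom 1 j * F x else monom 1 (j - K) * pderiv (F x)) l)" for x
      using ij Z(1) by (auto simp: S_def syzygy_mat_def scalar_prod_def atLeast0LessThan)
    moreover have "polyfun m (\<lambda>x. coeff (if j < K then monom 1 j * F x else monom 1 (j - K) * pderiv (F x)) l)" for l
      by (rule polyfun_linear_functional[OF F]) (auto simp: pderiv_add pderiv_smult algebra_simps)
    ultimately show "polyfun m (\<lambda>x. (Z * S x) $$ (i, j))"
      by (auto intro!: polyfun_sum polyfun_mult)
  qed
  moreover have "K \<le> card {z. poly (F x) z = 0}" if det: "det (Z * S x) \<noteq> 0" and nz: "F x \<noteq> 0" for x
  proof (rule ccontr)
    assume less: "\<not> K \<le> card {z. poly (F x) z = 0}"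
    \<comment> \<open>The radical of \<open>F x\<close> has too small a degree, and its syzygy is a kernel vector.\<close>
    define w where "w = (\<Prod>z | poly (F x) z = 0. [:-z, 1:])"
    have w0: "w \<noteq> 0" using poly_roots_finite[OF nz] by (simp add: w_def)
    have dw: "degree w < K" using less by (simp add: w_def degree_prod_sum_eq)
    obtain q where q: "w * pderiv (F x) = F x * q"
      using poly_dvd_radical_mult_pderiv[OF nz] unfolding w_def dvd_def by blast
    define u where "u = - q"
    have eq: "u * F x + w * pderiv (F x) = 0" by (simp add: u_def q)
    have du: "degree u < K"
    proof (cases "q = 0")
      case False
      then have "degree (F x) + degree q = degree (w * pderiv (F x))"
        unfolding q using nz by (simp add: degree_mult_eq)
      also have "\<dots> \<le> degree w + (degree (F x) - 1)"
        using degree_mult_le[of w "pderiv (F x)"] by (simp add: degree_pderiv)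
      finally show ?thesis using dw by (simp add: u_def)
    qed (use dw in \<open>simp add: u_def\<close>)
    define c where "c = vec (2 * K) (\<lambda>j. if j < K then coeff u j else coeff w (j - K))"
    have c: "c \<in> carrier_vec (2 * K)" by (simp add: c_def)
    have "(\<Sum>j<K. monom (c $ j) j) = (\<Sum>j\<le>K - 1. monom (coeff u j) j)"
      using dw by (intro sum.cong) (auto simp: c_def)
    also have "\<dots> = u" using du by (intro poly_as_sum_of_monoms') simp
    finally have u_eq: "(\<Sum>j<K. monom (c $ j) j) = u" .
    have "(\<Sum>j<K. monom (c $ (K + j)) j) = (\<Sum>j\<le>K - 1. monom (coeff w j) j)"
      using dw by (intro sum.cong) (auto simp: c_def)
    also have "\<dots> = w" using dw by (intro poly_as_sum_of_monoms') simp
    finally have w_eq: "(\<Sum>j<K. monom (c $ (K + j)) j) = w" .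
    have "S x *\<^sub>v c = 0\<^sub>v (N + K)"
      using S[of x] syzygy_mat_mult[OF c, of _ N "F x"] unfolding u_eq w_eq eq
      by (intro eq_vecI) (auto simp: S_def)
    then have "Z * S x *\<^sub>v c = 0\<^sub>v (2 * K)"
      using assoc_mult_mat_vec[OF Z(1) S c] Z(1) by (auto intro!: eq_vecI simp: index_mult_mat_vec)
    moreover have "c \<noteq> 0\<^sub>v (2 * K)"
    proof
      assume "c = 0\<^sub>v (2 * K)"
      then have "(\<Sum>j<K. monom (c $ (K + j)) j) = 0" by simp
      then show False using w_eq w0 by simp
    qed
    ultimately have "det (Z * S x) = 0"
      using det_0_iff_vec_prod_zero_field[of "Z * S x" "2 * K"] Z(1) S[of x] c by auto
    then show False using det by simp
  qed
  ultimately show ?thesis unfolding generically_def K_def using Z(2) x0(1)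
    by (intro exI[of _ "\<lambda>x. det (Z * S x)"]) (auto simp: K_def)
qed

section \<open>Reversal\<close>

lemma poly_det_pencil_reversal:
  assumes A: "A \<in> carrier_mat n n" and B: "B \<in> carrier_mat n n" and t: "t \<noteq> 0"
  shows "poly (det (pencil B A)) t = t ^ n * poly (det (pencil A B)) (1 / t)"
proof -
  have "eval_mat t (pencil B A) = t \<cdot>\<^sub>m eval_mat (1 / t) (pencil A B)"
    unfolding eval_mat_pencil[OF A B] eval_mat_pencil[OF B A]
    using A B t by (intro eq_matI) (auto simp: algebra_simps)
  then have "det (eval_mat t (pencil B A)) = t ^ n * det (eval_mat (1 / t) (pencil A B))"
    using A B by (simp add: carrier_matD[OF pencil_carrier[OF A B]])
  then show ?thesis by (simp add: det_eval_mat)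
qed

text \<open>The determinant of the reversed pencil at \<open>t\<close> is \<open>t ^ n\<close> times that of the pencil at \<open>1 / t\<close>, so
the order at \<open>0\<close> of the former is the deficit of the degree of the latter.\<close>

lemma degree_add_order_reversal:
  assumes A: "A \<in> carrier_mat n n" and B: "B \<in> carrier_mat n n" and reg: "det (pencil A B) \<noteq> 0"
  shows "det (pencil B A) \<noteq> 0 \<and> degree (det (pencil A B)) + order 0 (det (pencil B A)) = n"
proof -
  let ?f = "det (pencil A B)" and ?r = "det (pencil B A)"
  define d where "d = degree ?f"
  have "poly (monom 1 d * ?r - monom 1 n * reflect_poly ?f) t = 0" if t: "t \<noteq> 0" for t
    using poly_det_pencil_reversal[OF A B t] t
    by (simp add: poly_monom poly_reflect_poly_nz d_def field_simps)
  then have "UNIV - {0} \<subseteq> {t. poly (monom 1 d * ?r - monom 1 n * reflect_poly ?f) t = 0}" by auto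
  moreover have "infinite (UNIV - {0 :: complex})" by (simp add: infinite_UNIV_char_0)
  ultimately have "infinite {t. poly (monom 1 d * ?r - monom 1 n * reflect_poly ?f) t = 0}"
    using finite_subset by blast
  then have "monom 1 d * ?r - monom 1 n * reflect_poly ?f = 0" using poly_roots_finite by blast
  then have eq: "monom 1 d * ?r = monom 1 n * reflect_poly ?f" by simp
  have refl: "poly (reflect_poly ?f) 0 \<noteq> 0" using reg by simp
  have ord_monom: "order 0 (monom (1 :: complex) k) = k" for k
  proof -
    have "monom (1 :: complex) k = [:- 0, 1:] ^ k" by (simp add: monom_altdef)
    then show ?thesis by (simp only: order_power_n_n)
  qed
  have nz: "monom 1 n * reflect_poly ?f \<noteq> 0" using reg by simp
  then have r: "?r \<noteq> 0" unfolding eq[symmetric] by auto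
  have "d + order 0 ?r = order 0 (monom 1 d * ?r)"
    using order_mult[of "monom 1 d" ?r 0] nz unfolding eq[symmetric] by (simp add: ord_monom)
  also have "\<dots> = n"
    unfolding eq order_mult[OF nz] using refl by (simp add: ord_monom order_0I)
  finally show ?thesis using r by (simp add: d_def)
qed

lemmas det_pencil_reversal_nonzero = degree_add_order_reversal[THEN conjunct1]

section \<open>Perturbations of higher rank\<close>

definition skew_sum :: "nat \<Rightarrow> nat \<Rightarrow> (nat \<Rightarrow> 'a :: comm_ring_1 vec) \<Rightarrow> (nat \<Rightarrow> 'a vec) \<Rightarrow> 'a mat" where
  "skew_sum n s v w = mat n n (\<lambda>(i, j). \<Sum>l<s. v l $ i * w l $ j - w l $ i * v l $ j)"

lemma skew_sum_carrier [simp]: "skew_sum n s v w \<in> carrier_mat n n"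
  by (simp add: skew_sum_def)

lemma skew_sum_dim [simp]: "dim_row (skew_sum n s v w) = n" "dim_col (skew_sum n s v w) = n"
  by (simp_all add: skew_sum_def)

lemma add_skew_sum_0 [simp]: "A \<in> carrier_mat n n \<Longrightarrow> A + skew_sum n 0 v w = A"
  by (intro eq_matI) (auto simp: skew_sum_def)

lemma add_skew_sum_Suc:
  "A \<in> carrier_mat n n \<Longrightarrow>
    A + skew_sum n (Suc s) v w = A + skew_sum n s v w + skew_outer n (v s) (w s)"
  by (intro eq_matI) (auto simp: skew_sum_def skew_outer_def algebra_simps)

lemma skew_sum_cong:
  "(\<And>l. l < s \<Longrightarrow> v l = v' l) \<Longrightarrow> (\<And>l. l < s \<Longrightarrow> w l = w' l) \<Longrightarrow> skew_sum n s v w = skew_sum n s v' w'"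
  unfolding skew_sum_def by (intro cong_mat) auto

lemma add_skew_sum_skew:
  assumes "A \<in> carrier_mat n n" "A\<^sup>T = - A"
  shows "(A + skew_sum n s v w)\<^sup>T = - (A + skew_sum n s v w)"
proof (induction s)
  case (Suc s)
  show ?case unfolding add_skew_sum_Suc[OF assms(1)]
    by (rule add_skew_outer_skew[OF _ Suc]) (use assms in simp)
qed (use assms in simp)

lemma root_frame_skew_update:
  assumes "A \<in> carrier_mat n n" "B \<in> carrier_mat n n" "root_frame (pencil A B) \<mu> k d"
  shows "root_frame (pencil (A + skew_outer n v \<gamma>) (B + skew_outer n v \<delta>)) \<mu> k (d - 2)"
  using root_frame_skew_outer_update[OF pencil_carrier[OF assms(1,2)] assms(3),
      of "const_vec n v" "linear_vec n \<gamma> \<delta>"]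
  by (simp add: pencil_add_skew_outer[OF assms(1,2)])

lemma root_frame_skew_sum_update:
  assumes A: "A \<in> carrier_mat n n" and B: "B \<in> carrier_mat n n" and "root_frame (pencil A B) \<mu> k d"
  shows "root_frame (pencil (A + skew_sum n s v \<gamma>) (B + skew_sum n s v \<delta>)) \<mu> k (d - 2 * s)"
proof (induction s)
  case (Suc s)
  have "root_frame (pencil (A + skew_sum n s v \<gamma> + skew_outer n (v s) (\<gamma> s))
      (B + skew_sum n s v \<delta> + skew_outer n (v s) (\<delta> s))) \<mu> k (d - 2 * s - 2)"
    using A B by (intro root_frame_skew_update Suc) auto
  then show ?case by (simp add: add_skew_sum_Suc[OF A] add_skew_sum_Suc[OF B])
qed (use assms in simp)

text \<open>Add one rank two perturbation after the other, each time controlling also the eigenvalues that have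
arisen so far: their multiplicity does not grow beyond two, and on \<open>T\<close> each step removes the two
largest multiplicities. Since \<open>T\<close> may be any finite set containing the spectrum, it can be enlarged
in the step.\<close>

lemma good_perturbation:
  assumes A: "A \<in> carrier_mat n n" "A\<^sup>T = - A" and B: "B \<in> carrier_mat n n" "B\<^sup>T = - B"
    and T: "finite T" "\<And>\<mu>. \<mu> \<in> T \<Longrightarrow> finite_partial_multiplicities (pencil A B) \<mu> (ns \<mu>)"
    and spec: "\<And>\<mu>. poly (det (pencil A B)) \<mu> = 0 \<Longrightarrow> \<mu> \<in> T"
    and reg: "det (pencil A B) \<noteq> 0"
    and ns': "finite_partial_multiplicities (pencil B A) 0 ns'"
  shows "\<exists>v \<gamma> \<delta>. (\<forall>l. v l \<in> carrier_vec n \<and> \<gamma> l \<in> carrier_vec n \<and> \<delta> l \<in> carrier_vec n) \<and>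
    (let A' = A + skew_sum n s v \<gamma>; B' = B + skew_sum n s v \<delta> in
      det (pencil A' B') \<noteq> 0 \<and>
      (\<forall>\<mu>\<in>T. finite_partial_multiplicities (pencil A' B') \<mu> (drop (2 * s) (ns \<mu>))) \<and>
      finite_partial_multiplicities (pencil B' A') 0 (drop (2 * s) ns') \<and>
      (\<forall>\<mu>. \<mu> \<notin> T \<longrightarrow> order \<mu> (det (pencil A' B')) \<le> 2))"
proof (induction s)
  case 0
  have "order \<mu> (det (pencil A B)) \<le> 2" if "\<mu> \<notin> T" for \<mu>
  proof -
    have "poly (det (pencil A B)) \<mu> \<noteq> 0" using spec that by blast
    then show ?thesis by (simp add: order_0I)
  qed
  then show ?case
    using A B T reg ns' by (intro exI[of _ "\<lambda>_. 0\<^sub>v n"]) (auto simp: Let_def)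
next
  case (Suc s)
  then obtain v \<gamma> \<delta> where carr: "\<And>l. v l \<in> carrier_vec n \<and> \<gamma> l \<in> carrier_vec n \<and> \<delta> l \<in> carrier_vec n"
    and IH: "let A' = A + skew_sum n s v \<gamma>; B' = B + skew_sum n s v \<delta> in
      det (pencil A' B') \<noteq> 0 \<and>
      (\<forall>\<mu>\<in>T. finite_partial_multiplicities (pencil A' B') \<mu> (drop (2 * s) (ns \<mu>))) \<and>
      finite_partial_multiplicities (pencil B' A') 0 (drop (2 * s) ns') \<and>
      (\<forall>\<mu>. \<mu> \<notin> T \<longrightarrow> order \<mu> (det (pencil A' B')) \<le> 2)" by blast
  define A1 B1 where "A1 = A + skew_sum n s v \<gamma>" and "B1 = B + skew_sum n s v \<delta>"
  have A1: "A1 \<in> carrier_mat n n" "A1\<^sup>T = - A1" and B1: "B1 \<in> carrier_mat n n" "B1\<^sup>T = - B1"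
    using A B by (auto simp: A1_def B1_def add_skew_sum_skew)
  have reg1: "det (pencil A1 B1) \<noteq> 0"
    and T1: "\<And>\<mu>. \<mu> \<in> T \<Longrightarrow> finite_partial_multiplicities (pencil A1 B1) \<mu> (drop (2 * s) (ns \<mu>))"
    and ns1': "finite_partial_multiplicities (pencil B1 A1) 0 (drop (2 * s) ns')"
    and new1: "\<And>\<mu>. \<mu> \<notin> T \<Longrightarrow> order \<mu> (det (pencil A1 B1)) \<le> 2"
    using IH by (auto simp: Let_def A1_def B1_def)
  \<comment> \<open>The eigenvalues created in the first \<open>s\<close> steps join the points that the next step controls.\<close>
  define T' where "T' = T \<union> {\<mu>. poly (det (pencil A1 B1)) \<mu> = 0}"
  have T': "finite T'" using T(1) poly_roots_finite[OF reg1] by (simp add: T'_def)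
  define ns1 where "ns1 \<mu> = (if \<mu> \<in> T then drop (2 * s) (ns \<mu>)
    else SOME ms. finite_partial_multiplicities (pencil A1 B1) \<mu> ms)" for \<mu>
  have ns1: "finite_partial_multiplicities (pencil A1 B1) \<mu> (ns1 \<mu>)" for \<mu>
    using T1 finite_partial_multiplicities_exist[OF A1(1) B1(1) reg1, of \<mu>]
    by (auto simp: ns1_def intro: someI)
  obtain v1 \<gamma>1 \<delta>1 where carr1: "v1 \<in> carrier_vec n" "\<gamma>1 \<in> carrier_vec n" "\<delta>1 \<in> carrier_vec n"
    and step: "det (pencil (A1 + skew_outer n v1 \<gamma>1) (B1 + skew_outer n v1 \<delta>1)) \<noteq> 0"
      "\<And>\<mu>. \<mu> \<in> T' \<Longrightarrow> order \<mu> (det (pencil (A1 + skew_outer n v1 \<gamma>1) (B1 + skew_outer n v1 \<delta>1)))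
        \<le> sum_list (drop 2 (ns1 \<mu>))"
      "order 0 (det (pencil (B1 + skew_outer n v1 \<delta>1) (A1 + skew_outer n v1 \<gamma>1)))
        \<le> sum_list (drop 2 (drop (2 * s) ns'))"
      "\<And>\<mu>. poly (det (pencil A1 B1)) \<mu> \<noteq> 0 \<Longrightarrow>
        order \<mu> (det (pencil (A1 + skew_outer n v1 \<gamma>1) (B1 + skew_outer n v1 \<delta>1))) \<le> 2"
    using good_rank_two_perturbation[OF A1 B1 T' ns1 reg1 ns1'] by blast
  define v2 \<gamma>2 \<delta>2 where "v2 = v(s := v1)" and "\<gamma>2 = \<gamma>(s := \<gamma>1)" and "\<delta>2 = \<delta>(s := \<delta>1)"
  define A2 B2 where "A2 = A + skew_sum n (Suc s) v2 \<gamma>2" and "B2 = B + skew_sum n (Suc s) v2 \<delta>2"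
  have "skew_sum n s v2 \<gamma>2 = skew_sum n s v \<gamma>" "skew_sum n s v2 \<delta>2 = skew_sum n s v \<delta>"
    by (intro skew_sum_cong; simp add: v2_def \<gamma>2_def \<delta>2_def)+
  then have A2_eq: "A2 = A1 + skew_outer n v1 \<gamma>1" and B2_eq: "B2 = B1 + skew_outer n v1 \<delta>1"
    unfolding A2_def B2_def add_skew_sum_Suc[OF A(1)] add_skew_sum_Suc[OF B(1)]
    by (simp_all add: A1_def B1_def v2_def \<gamma>2_def \<delta>2_def)
  have A2: "A2 \<in> carrier_mat n n" and B2: "B2 \<in> carrier_mat n n" using A B by (auto simp: A2_def B2_def)
  note step = step[folded A2_eq B2_eq]
  have fin: "finite_partial_multiplicities (pencil A2 B2) \<mu> (drop (2 * Suc s) (ns \<mu>))" if \<mu>: "\<mu> \<in> T" for \<mu>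
  proof -
    obtain ms where ms: "finite_partial_multiplicities (pencil A2 B2) \<mu> ms"
      using finite_partial_multiplicities_exist[OF A2 B2 step(1)] by blast
    have "ms = drop 2 (ns1 \<mu>)"
    proof (rule interlacing(2)[OF pencil_carrier[OF A1(1) B1(1)] pencil_carrier[OF A2 B2] _ ns1 ms])
      show "root_frame (pencil A2 B2) \<mu> k (d - 2)" if "root_frame (pencil A1 B1) \<mu> k d" for k d
        unfolding A2_eq B2_eq by (rule root_frame_skew_update[OF A1(1) B1(1) that])
      show "order \<mu> (det (pencil A2 B2)) \<le> sum_list (drop 2 (ns1 \<mu>))"
        using \<mu> by (intro step(2)) (simp add: T'_def)
    qed
    then show ?thesis using ms \<mu> by (simp add: ns1_def add.commute)
  qed
  have rev_nz: "det (pencil B2 A2) \<noteq> 0" by (rule det_pencil_reversal_nonzero[OF A2 B2 step(1)])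
  have inf: "finite_partial_multiplicities (pencil B2 A2) 0 (drop (2 * Suc s) ns')"
  proof -
    obtain ms where ms: "finite_partial_multiplicities (pencil B2 A2) 0 ms"
      using finite_partial_multiplicities_exist[OF B2 A2 rev_nz] by blast
    have "ms = drop 2 (drop (2 * s) ns')"
    proof (rule interlacing(2)[OF pencil_carrier[OF B1(1) A1(1)] pencil_carrier[OF B2 A2] _ ns1' ms step(3)])
      show "root_frame (pencil B2 A2) 0 k (d - 2)" if "root_frame (pencil B1 A1) 0 k d" for k d
        unfolding A2_eq B2_eq by (rule root_frame_skew_update[OF B1(1) A1(1) that])
    qed
    then show ?thesis using ms by (simp add: add.commute)
  qed
  have new: "order \<mu> (det (pencil A2 B2)) \<le> 2" if \<mu>: "\<mu> \<notin> T" for \<mu>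
  proof (cases "\<mu> \<in> T'")
    case True
    have "order \<mu> (det (pencil A2 B2)) \<le> sum_list (drop 2 (ns1 \<mu>))" by (rule step(2)[OF True])
    also have "\<dots> \<le> sum_list (ns1 \<mu>)" by (metis append_take_drop_id le_add2 sum_list_append)
    also have "\<dots> = order \<mu> (det (pencil A1 B1))"
      using finite_partial_multiplicities_profile(4)[OF pencil_carrier[OF A1(1) B1(1)] ns1] by simp
    also have "\<dots> \<le> 2" by (rule new1[OF \<mu>])
    finally show ?thesis .
  qed (auto simp: T'_def intro: step(4))
  have "\<forall>l. v2 l \<in> carrier_vec n \<and> \<gamma>2 l \<in> carrier_vec n \<and> \<delta>2 l \<in> carrier_vec n"
    using carr carr1 by (simp add: v2_def \<gamma>2_def \<delta>2_def)
  then show ?case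
    using step(1) fin inf new unfolding Let_def A2_def B2_def by blast
qed

section \<open>Generic parameters\<close>

lemma sum_linear_polys: "(\<Sum>l\<in>S. [:f l, g l:]) = [:\<Sum>l\<in>S. f l, \<Sum>l\<in>S. g l:]"
  by (induction S rule: infinite_finite_induct) auto

lemma pencil_add_Phi:
  assumes A: "A \<in> carrier_mat n n" and B: "B \<in> carrier_mat n n"
  shows "pencil A B + Phi n (2 * s) x =
    pencil (A + skew_sum n s (subvector n x) (\<lambda>l. subvector n x (s + l)))
      (B + skew_sum n s (subvector n x) (\<lambda>l. subvector n x (2 * s + l)))"
proof (intro eq_matI)
  fix i j assume "i < dim_row (pencil (A + skew_sum n s (subvector n x) (\<lambda>l. subvector n x (s + l)))
      (B + skew_sum n s (subvector n x) (\<lambda>l. subvector n x (2 * s + l))))"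
    and "j < dim_col (pencil (A + skew_sum n s (subvector n x) (\<lambda>l. subvector n x (s + l)))
      (B + skew_sum n s (subvector n x) (\<lambda>l. subvector n x (2 * s + l))))"
  then have ij: "i < n" "j < n" using A B by (auto simp: pencil_def)
  let ?u = "subvector n x"
  have "Phi n (2 * s) x $$ (i, j) = (\<Sum>l<s.
      [:?u l $ i * ?u (s + l) $ j - ?u (s + l) $ i * ?u l $ j,
        ?u l $ i * ?u (2 * s + l) $ j - ?u (2 * s + l) $ i * ?u l $ j:])"
    using ij by (auto simp: Phi_def Let_def subvector_def intro!: sum.cong)
  then show "(pencil A B + Phi n (2 * s) x) $$ (i, j) =
    pencil (A + skew_sum n s (subvector n x) (\<lambda>l. subvector n x (s + l)))
      (B + skew_sum n s (subvector n x) (\<lambda>l. subvector n x (2 * s + l))) $$ (i, j)"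
    using ij A B unfolding sum_linear_polys
    by (simp add: pencil_def skew_sum_def Phi_def Let_def)
qed (use A B in \<open>auto simp: pencil_def Phi_def Let_def\<close>)

lemma subvectors_surj:
  fixes v \<gamma> \<delta> :: "nat \<Rightarrow> complex vec"
  assumes carr: "\<And>l. v l \<in> carrier_vec n \<and> \<gamma> l \<in> carrier_vec n \<and> \<delta> l \<in> carrier_vec n"
  shows "\<exists>x\<in>carrier_vec (3 * s * n). \<forall>l<s. subvector n x l = v l \<and>
    subvector n x (s + l) = \<gamma> l \<and> subvector n x (2 * s + l) = \<delta> l"
proof -
  define u where "u l = (if l < s then v l else if l < 2 * s then \<gamma> (l - s) else \<delta> (l - 2 * s))" for l
  define x where "x = vec (3 * s * n) (\<lambda>i. u (i div n) $ (i mod n))"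
  have dim: "dim_vec (v l) = n \<and> dim_vec (\<gamma> l) = n \<and> dim_vec (\<delta> l) = n" for l
    using carr[of l] by (auto dest: carrier_vecD)
  have sub: "subvector n x l = u l" if l: "l < 3 * s" for l
  proof (intro eq_vecI)
    fix k assume "k < dim_vec (u l)"
    then have k: "k < n" by (simp add: u_def dim split: if_splits)
    have "l * n + k < Suc l * n" using k by simp
    also have "\<dots> \<le> 3 * s * n" using l by (intro mult_le_mono1) simp
    finally show "subvector n x l $ k = u l $ k" using k by (simp add: subvector_def x_def)
  qed (simp add: subvector_def u_def dim)
  show ?thesis
  proof (rule bexI[of _ x])
    show "x \<in> carrier_vec (3 * s * n)" by (simp add: x_def)
  qed (auto simp: sub u_def)
qed

lemma polyfun_poly_det_perturbed_pencil:
  assumes A: "A \<in> carrier_mat n n" and B: "B \<in> carrier_mat n n"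
    and js: "j \<le> s" and e: "e1 \<le> 2 * s" "e2 \<le> 2 * s"
  shows "polyfun_poly (3 * s * n) (\<lambda>x. det (pencil
    (A + skew_sum n j (subvector n x) (\<lambda>l. subvector n x (e1 + l)))
    (B + skew_sum n j (subvector n x) (\<lambda>l. subvector n x (e2 + l)))))"
proof (rule polyfun_poly_det)
  show "pencil (A + skew_sum n j (subvector n x) (\<lambda>l. subvector n x (e1 + l)))
    (B + skew_sum n j (subvector n x) (\<lambda>l. subvector n x (e2 + l))) \<in> carrier_mat n n" for x
    using A B by simp
  fix a b assume ab: "a < n" "b < n"
  have coord: "polyfun (3 * s * n) (\<lambda>x. subvector n x l $ k)" if "l < 3 * s" "k < n" for l k
  proof -
    have "l * n + k < Suc l * n" using that by simp
    also have "\<dots> \<le> 3 * s * n" using that by (intro mult_le_mono1) simp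
    finally show ?thesis using that by (simp add: subvector_def polyfun_index)
  qed
  have eq: "pencil (A + skew_sum n j (subvector n x) (\<lambda>l. subvector n x (e1 + l)))
      (B + skew_sum n j (subvector n x) (\<lambda>l. subvector n x (e2 + l))) $$ (a, b) =
    [:A $$ (a, b) + (\<Sum>l<j. subvector n x l $ a * subvector n x (e1 + l) $ b
        - subvector n x (e1 + l) $ a * subvector n x l $ b),
      B $$ (a, b) + (\<Sum>l<j. subvector n x l $ a * subvector n x (e2 + l) $ b
        - subvector n x (e2 + l) $ a * subvector n x l $ b):]" for x
    using A B ab by (simp add: pencil_def skew_sum_def)
  show "polyfun_poly (3 * s * n) (\<lambda>x.
    pencil (A + skew_sum n j (subvector n x) (\<lambda>l. subvector n x (e1 + l)))
      (B + skew_sum n j (subvector n x) (\<lambda>l. subvector n x (e2 + l))) $$ (a, b))"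
    unfolding eq using ab js e
    by (intro polyfun_poly_linear polyfun_add polyfun_sum polyfun_diff polyfun_mult polyfun_const coord) auto
qed

text \<open>The determinants of two successive partial sums multiply to a square, so the parity of the order at \<open>z\<close>
never changes, and it is even at the start.\<close>

lemma even_order_det_skew_sum:
  assumes A: "A \<in> carrier_mat n n" "A\<^sup>T = - A" and B: "B \<in> carrier_mat n n" "B\<^sup>T = - B"
    and nz: "\<And>j. j \<le> s \<Longrightarrow> det (pencil (A + skew_sum n j v \<gamma>) (B + skew_sum n j v \<delta>)) \<noteq> 0"
    and z: "poly (det (pencil A B)) z \<noteq> 0"
  shows "even (order z (det (pencil (A + skew_sum n s v \<gamma>) (B + skew_sum n s v \<delta>))))"
  using nz
proof (induction s)
  case 0
  then show ?case using A B z by (simp add: order_0I)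
next
  case (Suc s)
  define A1 B1 where "A1 = A + skew_sum n s v \<gamma>" and "B1 = B + skew_sum n s v \<delta>"
  define L f where "L = pencil A1 B1"
    and "f = det (pencil (A + skew_sum n (Suc s) v \<gamma>) (B + skew_sum n (Suc s) v \<delta>))"
  have A1: "A1 \<in> carrier_mat n n" "A1\<^sup>T = - A1" and B1: "B1 \<in> carrier_mat n n" "B1\<^sup>T = - B1"
    using A B by (auto simp: A1_def B1_def add_skew_sum_skew)
  have L: "L \<in> carrier_mat n n" using A1 B1 by (simp add: L_def)
  have L0: "det L \<noteq> 0" using Suc.prems[of s] by (simp add: L_def A1_def B1_def)
  have f0: "f \<noteq> 0" using Suc.prems[of "Suc s"] by (simp add: f_def)
  have "f = det (L + skew_outer n (const_vec n (v s)) (linear_vec n (\<gamma> s) (\<delta> s)))"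
    by (simp only: f_def L_def pencil_add_skew_outer[OF A1(1) B1(1)] add_skew_sum_Suc[OF A(1)]
        add_skew_sum_Suc[OF B(1)] A1_def[symmetric] B1_def[symmetric])
  then obtain g where g: "det L * f = g ^ 2"
    using det_skew_outer_update[OF L _ L0] pencil_skew[OF A1(1) B1(1) A1(2) B1(2)]
    by (metis L_def const_vec_carrier linear_vec_carrier)
  have gg: "g * g = det L * f" by (simp only: g power2_eq_square)
  have g0: "g * g \<noteq> 0" unfolding gg using L0 f0 by simp
  then have "order z (det L) + order z f = order z (g * g)"
    unfolding gg by (rule order_mult[symmetric])
  also have "\<dots> = order z g + order z g" by (rule order_mult[OF g0])
  finally have "even (order z (det L) + order z f)" by simp
  moreover have "even (order z (det L))" using Suc by (simp add: L_def A1_def B1_def)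
  ultimately show ?case by (simp add: f_def)
qed

lemma all_eq_2_if_sum_le:
  fixes o' :: "'a \<Rightarrow> nat"
  assumes "finite N" "\<And>z. z \<in> N \<Longrightarrow> 2 \<le> o' z" "sum o' N \<le> 2 * card N" "z \<in> N"
  shows "o' z = 2"
proof (rule ccontr)
  assume "o' z \<noteq> 2"
  then have "(\<Sum>z\<in>N. 2) < sum o' N"
    using assms(1,2,4) by (intro sum_strict_mono_ex1) force+
  then show False using assms(3) by simp
qed

theorem theorem21:
  fixes n r \<kappa> :: nat
    and A B :: "complex mat"
    and lam :: "nat \<Rightarrow> complex"
    and ns :: "nat \<Rightarrow> nat list"
  assumes "A \<in> carrier_mat n n" and "B \<in> carrier_mat n n"
    and "A\<^sup>T = - A" and "B\<^sup>T = - B"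
    and "regular_pencil (pencil A B)"
    and "inj_on lam {1..\<kappa>}"
    and "lam ` {1..\<kappa>} = {\<mu>. pencil_eigenvalue (pencil A B) (Fin \<mu>)}"
    and "\<And>i. i \<in> {1..\<kappa>} \<Longrightarrow> partial_multiplicities (pencil A B) (Fin (lam i)) (ns i)"
    and "r > 0" and "even r"
  shows "\<exists>G. generic (3 * r * n div 2) G \<and>
    (\<forall>E \<in> Phi n r ` G.
       regular_pencil (pencil A B + E) \<and>
       (\<forall>i \<in> {1..\<kappa>}.
          partial_multiplicities (pencil A B + E) (Fin (lam i)) (drop r (ns i))) \<and>
       (\<forall>\<mu>. pencil_eigenvalue (pencil A B + E) \<mu> \<and> \<not> pencil_eigenvalue (pencil A B) \<mu> \<longrightarrow>
          algebraic_multiplicity (pencil A B + E) \<mu> 2))"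
proof -
  note A = assms(1,3) and B = assms(2,4)
  obtain s where r: "r = 2 * s" using \<open>even r\<close> by blast
  have dim: "3 * r * n div 2 = 3 * s * n" by (simp add: r)
  have reg: "det (pencil A B) \<noteq> 0" using assms(5) by (simp add: regular_pencil_def)
  have rev_reg: "det (pencil B A) \<noteq> 0" by (rule det_pencil_reversal_nonzero[OF A(1) B(1) reg])
  define T where "T = lam ` {1..\<kappa>}"
  have T: "finite T" by (simp add: T_def)
  have spec: "\<mu> \<in> T \<longleftrightarrow> poly (det (pencil A B)) \<mu> = 0" for \<mu>
    unfolding T_def assms(7) by simp
  \<comment> \<open>The multiplicities indexed by the eigenvalue instead of its number.\<close>
  define nsT where "nsT \<mu> = ns (inv_into {1..\<kappa>} lam \<mu>)" for \<mu>
  have nsT_lam: "nsT (lam i) = ns i" if "i \<in> {1..\<kappa>}" for i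
    using inv_into_f_f[OF assms(6) that] by (simp add: nsT_def)
  have nsT: "finite_partial_multiplicities (pencil A B) \<mu> (nsT \<mu>)" if "\<mu> \<in> T" for \<mu>
    using that assms(8) nsT_lam by (auto simp: T_def)
  obtain ns' where ns': "finite_partial_multiplicities (pencil B A) 0 ns'"
    using finite_partial_multiplicities_exist[OF B(1) A(1) rev_reg] by blast

  \<comment> \<open>The coefficients of the pencil perturbed by the first \<open>j\<close> summands only: the parity argument passes
    through these intermediate pencils, which must be regular as well.\<close>
  define A' where "A' j x = A + skew_sum n j (subvector n x) (\<lambda>l. subvector n x (s + l))" for j x
  define B' where "B' j x = B + skew_sum n j (subvector n x) (\<lambda>l. subvector n x (2 * s + l))" for j x
  have A': "A' j x \<in> carrier_mat n n" and B': "B' j x \<in> carrier_mat n n" for j x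
    using A B by (simp_all add: A'_def B'_def)
  define F where "F j x = det (pencil (A' j x) (B' j x))" for j x
  define H where "H x = det (pencil (B' s x) (A' s x))" for x
  have F_poly: "polyfun_poly (3 * s * n) (F j)" if "j \<le> s" for j
    unfolding F_def[abs_def] A'_def B'_def
    by (rule polyfun_poly_det_perturbed_pencil[OF A(1) B(1) that]) auto
  have H_poly: "polyfun_poly (3 * s * n) H"
    unfolding H_def[abs_def] A'_def B'_def
    by (rule polyfun_poly_det_perturbed_pencil[OF B(1) A(1)]) auto
  define a where "a \<mu> = sum_list (drop r (nsT \<mu>))" for \<mu>
  define b where "b = sum_list (drop r ns')"

  obtain v \<gamma> \<delta> where carr: "\<And>l. v l \<in> carrier_vec n \<and> \<gamma> l \<in> carrier_vec n \<and> \<delta> l \<in> carrier_vec n"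
    and good: "let A' = A + skew_sum n s v \<gamma>; B' = B + skew_sum n s v \<delta> in
      det (pencil A' B') \<noteq> 0 \<and>
      (\<forall>\<mu>\<in>T. finite_partial_multiplicities (pencil A' B') \<mu> (drop (2 * s) (nsT \<mu>))) \<and>
      finite_partial_multiplicities (pencil B' A') 0 (drop (2 * s) ns') \<and>
      (\<forall>\<mu>. \<mu> \<notin> T \<longrightarrow> order \<mu> (det (pencil A' B')) \<le> 2)"
    using good_perturbation[OF A B T nsT iffD2[OF spec] reg ns', of s] by blast
  have "\<exists>x\<in>carrier_vec (3 * s * n). \<forall>l<s. subvector n x l = v l \<and>
      subvector n x (s + l) = \<gamma> l \<and> subvector n x (2 * s + l) = \<delta> l"
    by (rule subvectors_surj) (rule carr)
  then obtain x0 where x0: "x0 \<in> carrier_vec (3 * s * n)" and sub: "\<forall>l<s. subvector n x0 l = v l \<and>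
      subvector n x0 (s + l) = \<gamma> l \<and> subvector n x0 (2 * s + l) = \<delta> l" ..
  have eq0: "A' s x0 = A + skew_sum n s v \<gamma>" "B' s x0 = B + skew_sum n s v \<delta>"
  proof -
    have "skew_sum n s (subvector n x0) (\<lambda>l. subvector n x0 (s + l)) = skew_sum n s v \<gamma>"
      "skew_sum n s (subvector n x0) (\<lambda>l. subvector n x0 (2 * s + l)) = skew_sum n s v \<delta>"
      by (rule skew_sum_cong; use sub in blast)+
    then show "A' s x0 = A + skew_sum n s v \<gamma>" "B' s x0 = B + skew_sum n s v \<delta>"
      by (simp_all only: A'_def B'_def)
  qed
  have F0: "F s x0 \<noteq> 0"
    and fpm0: "\<And>\<mu>. \<mu> \<in> T \<Longrightarrow> finite_partial_multiplicities (pencil (A' s x0) (B' s x0)) \<mu> (drop r (nsT \<mu>))"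
    and fpm0': "finite_partial_multiplicities (pencil (B' s x0) (A' s x0)) 0 (drop r ns')"
    and new0: "\<And>\<mu>. \<mu> \<notin> T \<Longrightarrow> order \<mu> (F s x0) \<le> 2"
    using good unfolding Let_def F_def eq0 r by auto
  have ord0: "order \<mu> (F s x0) = a \<mu>" if "\<mu> \<in> T" for \<mu>
    using finite_partial_multiplicities_profile(4)[OF pencil_carrier[OF A' B'] fpm0[OF that]]
    by (simp add: F_def a_def)
  have ordH0: "order 0 (H x0) = b" and H0: "H x0 \<noteq> 0"
    using finite_partial_multiplicities_profile(3,4)[OF pencil_carrier[OF B' A'] fpm0']
    by (simp_all add: H_def b_def)
  have deg0: "degree (F s x0) + b = n"
    using degree_add_order_reversal[OF A' B' F0[unfolded F_def]] ordH0 by (simp add: F_def H_def)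

  have c1: "generically (3 * s * n) (\<lambda>x. \<forall>\<mu>\<in>T. \<not> [:-\<mu>, 1:] ^ Suc (a \<mu>) dvd F s x)"
  proof (rule generically_ball[OF T generically_not_power_dvd[OF F_poly[OF order_refl] x0]])
    show "\<not> [:-\<mu>, 1:] ^ Suc (a \<mu>) dvd F s x0" if "\<mu> \<in> T" for \<mu>
      using F0 ord0[OF that] by (simp only: order_divides) simp
  qed
  have c2: "generically (3 * s * n) (\<lambda>x. \<not> [:-0, 1:] ^ Suc b dvd H x)"
  proof (rule generically_not_power_dvd[OF H_poly x0])
    show "\<not> [:-0, 1:] ^ Suc b dvd H x0" using H0 ordH0 by (simp only: order_divides) simp
  qed
  have c3: "generically (3 * s * n)
      (\<lambda>x. F s x \<noteq> 0 \<longrightarrow> card {z. poly (F s x0) z = 0} \<le> card {z. poly (F s x) z = 0})"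
    by (rule generically_card_roots_ge[OF F_poly[OF order_refl] x0 F0])
  have c4: "generically (3 * s * n) (\<lambda>x. \<forall>j\<in>{..s}. F j x \<noteq> 0)"
  proof (rule generically_ball)
    fix j assume j: "j \<in> {..s}"
    \<comment> \<open>The zero perturbation leaves all intermediate pencils equal to the given one.\<close>
    obtain x1 where x1: "x1 \<in> carrier_vec (3 * s * n)" "\<forall>l<s. subvector n x1 l = 0\<^sub>v n \<and>
        subvector n x1 (s + l) = 0\<^sub>v n \<and> subvector n x1 (2 * s + l) = 0\<^sub>v n"
      using subvectors_surj[of "\<lambda>_. 0\<^sub>v n" n "\<lambda>_. 0\<^sub>v n" "\<lambda>_. 0\<^sub>v n" s] by auto
    have zero: "skew_sum n j (subvector n x1) w = 0\<^sub>m n n" if "\<And>l. l < s \<Longrightarrow> w l = 0\<^sub>v n" for w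
      using j x1(2) that by (intro eq_matI) (auto simp: skew_sum_def)
    have "A' j x1 = A" "B' j x1 = B"
      unfolding A'_def B'_def using A B x1(2) by (simp_all add: zero)
    then have "F j x1 \<noteq> 0" using reg by (simp add: F_def)
    then show "generically (3 * s * n) (\<lambda>x. F j x \<noteq> 0)"
      using generically_nonzero[OF F_poly x1(1)] j by simp
  qed simp
  have "\<exists>G. generic (3 * s * n) G \<and> (\<forall>x\<in>G.
      ((\<forall>\<mu>\<in>T. \<not> [:-\<mu>, 1:] ^ Suc (a \<mu>) dvd F s x) \<and> \<not> [:-0, 1:] ^ Suc b dvd H x) \<and>
      (F s x \<noteq> 0 \<longrightarrow> card {z. poly (F s x0) z = 0} \<le> card {z. poly (F s x) z = 0}) \<and>
      (\<forall>j\<in>{..s}. F j x \<noteq> 0))"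
    by (intro generically_imp_generic generically_conj c1 c2 c3 c4)
  then obtain G where G: "generic (3 * s * n) G" and cond: "\<forall>x\<in>G.
      ((\<forall>\<mu>\<in>T. \<not> [:-\<mu>, 1:] ^ Suc (a \<mu>) dvd F s x) \<and> \<not> [:-0, 1:] ^ Suc b dvd H x) \<and>
      (F s x \<noteq> 0 \<longrightarrow> card {z. poly (F s x0) z = 0} \<le> card {z. poly (F s x) z = 0}) \<and>
      (\<forall>j\<in>{..s}. F j x \<noteq> 0)" by blast

  have "regular_pencil (pencil A B + Phi n r x) \<and>
       (\<forall>i \<in> {1..\<kappa>}.
          partial_multiplicities (pencil A B + Phi n r x) (Fin (lam i)) (drop r (ns i))) \<and>
       (\<forall>\<mu>. pencil_eigenvalue (pencil A B + Phi n r x) \<mu> \<and> \<not> pencil_eigenvalue (pencil A B) \<mu> \<longrightarrow>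
          algebraic_multiplicity (pencil A B + Phi n r x) \<mu> 2)"
    if x: "x \<in> G" for x
  proof -
    define M where "M = pencil (A' s x) (B' s x)"
    have M_eq: "pencil A B + Phi n r x = M"
      unfolding r M_def A'_def B'_def by (rule pencil_add_Phi[OF A(1) B(1)])
    have M: "M \<in> carrier_mat n n" using A' B' by (simp add: M_def)
    define f where "f = F s x"
    have detM: "det M = f" by (simp add: M_def f_def F_def)
    have f0: "f \<noteq> 0" using bspec[OF cond x] by (simp add: f_def)
    have le_a: "order \<mu> f \<le> a \<mu>" if "\<mu> \<in> T" for \<mu>
    proof -
      have "\<not> [:-\<mu>, 1:] ^ Suc (a \<mu>) dvd f" using bspec[OF cond x] that by (simp only: f_def) blast
      then show ?thesis using f0 by (simp only: order_divides) simp
    qed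
    have fpm_exists: "\<exists>ms. finite_partial_multiplicities M z ms" for z
      using finite_partial_multiplicities_exist[OF A' B', of s x s x z] f0
      unfolding M_def f_def F_def by blast
    have frames: "root_frame M \<mu> k (d - r)" if "root_frame (pencil A B) \<mu> k d" for \<mu> k d
      unfolding M_def A'_def B'_def r by (rule root_frame_skew_sum_update[OF A(1) B(1) that])
    have fpm: "finite_partial_multiplicities M \<mu> (drop r (nsT \<mu>))" if \<mu>: "\<mu> \<in> T" for \<mu>
    proof -
      obtain ms where ms: "finite_partial_multiplicities M \<mu> ms" using fpm_exists by blast
      have "ms = drop r (nsT \<mu>)"
        using interlacing(2)[OF pencil_carrier[OF A(1) B(1)] M frames nsT[OF \<mu>] ms] le_a[OF \<mu>]
        by (simp add: detM a_def)
      then show ?thesis using ms by simp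
    qed
    have ord_T: "order \<mu> f = a \<mu>" if "\<mu> \<in> T" for \<mu>
      using finite_partial_multiplicities_profile(4)[OF M fpm[OF that]] by (simp add: detM a_def)

    have rev: "H x \<noteq> 0" "degree f + order 0 (H x) = n"
      using degree_add_order_reversal[OF A' B', of s x s x] f0 by (simp_all add: f_def F_def H_def)
    have H_le: "order 0 (H x) \<le> b"
    proof -
      have "\<not> [:-0, 1:] ^ Suc b dvd H x" using bspec[OF cond x] by blast
      then show ?thesis using rev(1) by (simp only: order_divides) simp
    qed
    have H_ge: "b \<le> order 0 (H x)"
    proof -
      obtain ms where ms: "finite_partial_multiplicities (pencil (B' s x) (A' s x)) 0 ms"
        using finite_partial_multiplicities_exist[OF B' A'] rev(1) unfolding H_def by metis
      have "root_frame (pencil (B' s x) (A' s x)) 0 k (d - r)" if "root_frame (pencil B A) 0 k d" for k d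
        unfolding A'_def B'_def r by (rule root_frame_skew_sum_update[OF B(1) A(1) that])
      from interlacing(1)[OF pencil_carrier[OF B(1) A(1)] pencil_carrier[OF B' A'] this ns' ms]
      show ?thesis by (simp add: b_def H_def)
    qed
    have deg: "degree f = degree (F s x0)" using rev(2) H_le H_ge deg0 by simp

    \<comment> \<open>\<open>f\<close> and \<open>F s x0\<close> have the same degree and the same orders on \<open>T\<close>. Outside \<open>T\<close>, \<open>f\<close> has at least
      as many distinct roots, of order at least two, where \<open>F s x0\<close> has order at most two.\<close>
    have new: "order z f = 2" if z: "poly f z = 0" "z \<notin> T" for z
    proof -
      define R R0 where "R = {z. poly f z = 0}" and "R0 = {z. poly (F s x0) z = 0}"
      have fin: "finite R" "finite R0"
        using f0 F0 by (simp_all add: R_def R0_def poly_roots_finite)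
      have RT: "R \<inter> T = R0 \<inter> T"
      proof -
        have "poly f \<mu> = 0 \<longleftrightarrow> poly (F s x0) \<mu> = 0" if "\<mu> \<in> T" for \<mu>
          using ord_T[OF that] ord0[OF that] f0 F0 by (simp add: order_root)
        then show ?thesis by (auto simp: R_def R0_def)
      qed
      have split: "sum h S = sum h (S \<inter> T) + sum h (S - T)" "card S = card (S \<inter> T) + card (S - T)"
        if "finite S" for S and h :: "complex \<Rightarrow> nat"
        using that by (auto simp: sum.Int_Diff card_Int_Diff)
      have two: "2 \<le> order w f" if w: "w \<in> R - T" for w
      proof -
        have "even (order w f)"
          unfolding f_def F_def A'_def B'_def
        proof (rule even_order_det_skew_sum[OF A B])
          show "poly (det (pencil A B)) w \<noteq> 0" using w spec by blast
          show "det (pencil (A + skew_sum n j (subvector n x) (\<lambda>l. subvector n x (s + l)))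
              (B + skew_sum n j (subvector n x) (\<lambda>l. subvector n x (2 * s + l)))) \<noteq> 0" if "j \<le> s" for j
            using bspec[OF cond x] that by (simp add: F_def A'_def B'_def)
        qed
        moreover have "order w f \<noteq> 0" using w f0 by (simp add: R_def order_root)
        ultimately show ?thesis by presburger
      qed
      have "card R0 \<le> card R" using bspec[OF cond x] f0 by (simp add: R_def R0_def f_def)
      then have card_le: "card (R0 - T) \<le> card (R - T)"
        using split(2)[OF fin(1)] split(2)[OF fin(2)] RT by simp
      have "(\<Sum>w\<in>R. order w f) = (\<Sum>w\<in>R0. order w (F s x0))"
        using sum_order_eq_degree[OF f0] sum_order_eq_degree[OF F0] deg by (simp add: R_def R0_def)
      moreover have "(\<Sum>w\<in>R \<inter> T. order w f) = (\<Sum>w\<in>R0 \<inter> T. order w (F s x0))"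
        unfolding RT by (intro sum.cong) (auto simp: ord_T ord0)
      ultimately have "(\<Sum>w\<in>R - T. order w f) = (\<Sum>w\<in>R0 - T. order w (F s x0))"
        using split(1)[OF fin(1)] split(1)[OF fin(2)] by simp
      also have "\<dots> \<le> (\<Sum>w\<in>R0 - T. 2)" by (intro sum_mono new0) auto
      also have "\<dots> \<le> 2 * card (R - T)" using card_le by simp
      finally have "(\<Sum>w\<in>R - T. order w f) \<le> 2 * card (R - T)" .
      from all_eq_2_if_sum_le[OF _ two this, of z] show ?thesis using fin z by (simp add: R_def)
    qed

    have "algebraic_multiplicity M \<mu> 2" if \<mu>: "pencil_eigenvalue M \<mu>" "\<not> pencil_eigenvalue (pencil A B) \<mu>" for \<mu>
    proof (cases \<mu>)
      case (Fin z)
      obtain ms where ms: "finite_partial_multiplicities M z ms" using fpm_exists by blast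
      have "order z f = 2" using \<mu> spec by (intro new) (auto simp: Fin detM)
      then have "sum_list ms = 2" using finite_partial_multiplicities_profile(4)[OF M ms] by (simp add: detM)
      then show ?thesis using ms by (auto simp: algebraic_multiplicity_def Fin)
    next
      case Infty
      have "poly (det (pencil B A)) 0 \<noteq> 0"
        using \<mu>(2) by (simp add: Infty rev_pencil_pencil[OF A(1) B(1)])
      then have "sum_list ns' = 0"
        using finite_partial_multiplicities_profile(4)[OF pencil_carrier[OF B(1) A(1)] ns']
        by (simp add: order_0I)
      then have "b = 0" using set_drop_subset[of r ns'] by (auto simp: b_def)
      then have "poly (H x) 0 \<noteq> 0" using H_le rev(1) by (simp add: order_root)
      then have False using \<mu>(1) by (simp add: Infty M_def rev_pencil_pencil[OF A' B'] H_def)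
      then show ?thesis ..
    qed
    moreover have "regular_pencil M" using f0 by (simp add: regular_pencil_def detM)
    moreover have "partial_multiplicities M (Fin (lam i)) (drop r (ns i))" if "i \<in> {1..\<kappa>}" for i
      using fpm[of "lam i"] nsT_lam[OF that] that by (simp add: T_def)
    ultimately show ?thesis unfolding M_eq by blast
  qed
  then show ?thesis unfolding dim using G by blast
qed

end
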